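(* Let $\sigma=\{\sigma_i \mid i\in I\}$ be a partition of the set $\mathbb{P}$ of all primes, let $G$ be a finite $\sigma$-soluble group, and let $D=G^{\mathfrak{N}_{\sigma}}$ be the $\sigma$-nilpotent residual of $G$. Then the following statements are equivalent. (1) $G$ is a $T_{\sigma}$-group. (2) $G$ satisfies the condition $\mathfrak{R}_{\sigma_i}$ for all $i\in I$. (3) $G$ satisfies the following conditions: (i) $G=D\rtimes M$ for some subgroup $M$ of $G$, where $D$ is an abelian Hall subgroup of $G$ of odd order and $M$ is a Dedekind group; (ii) every element of $G$ induces (by conjugation) a power automorphism on $D$; and (iii) for all $i\in I$, $O_{\sigma_i}(D)$ has a normal complement in a Hall $\sigma_i$-subgroup of $G$.
   Context: All groups are finite. $\mathbb{P}$ is the set of all primes and $\sigma=\{\sigma_i\mid i\in I\}$ is a partition of $\mathbb{P}$, i.e. $\mathbb{P}=\bigcup_{i\in I}\sigma_i$ and $\sigma_i\cap\sigma_j=\emptyset$ for $i\neq j$. For a finite group $G$, $\pi(G)$ is the set of primes dividing $|G|$, and $\sigma(G)=\{\sigma_i \mid \sigma_i\cap\pi(G)\neq\emptyset\}$. For a set $\pi$ of primes, a $\pi$-group is a finite group whose order is divisible only by primes in $\pi$; a Hall $\pi$-subgroup of $G$ is a $\pi$-subgroup $H$ such that no prime in $\pi$ divides $|G:H|$. In particular this defines $\sigma_i$-groups and Hall $\sigma_i$-subgroups. A Hall subgroup of $G$ is a subgroup whose order and index in $G$ are coprime. A group $G$ is $\sigma$-primary if $|\sigma(G)|\le 1$ (i.e.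 $G$ is a $\sigma_j$-group for some $j\in I$); $\sigma$-soluble if every chief factor of $G$ is $\sigma$-primary; $\sigma$-nilpotent if $G=G_1\times\cdots\times G_n$ for some $\sigma$-primary groups $G_1,\dots,G_n$. $\mathfrak{N}_{\sigma}$ denotes the class of all $\sigma$-nilpotent groups, and the $\sigma$-nilpotent residual $G^{\mathfrak{N}_{\sigma}}$ is the intersection of all normal subgroups $N$ of $G$ such that $G/N$ is $\sigma$-nilpotent. A subgroup $H$ of $G$ is $\sigma$-subnormal in $G$ if there is a chain of subgroups $H=H_0\le H_1\le\cdots\le H_n=G$ such that for each $i=1,\dots,n$ either $H_{i-1}$ is normal in $H_i$ or $H_i/(H_{i-1})_{H_i}$ is $\sigma$-primary, where $(H_{i-1})_{H_i}$ denotes the core of $H_{i-1}$ in $H_i$ (the largest normal subgroup of $H_i$ contained in $H_{i-1}$). $G$ is a $T_{\sigma}$-group if every $\sigma$-subnormal subgroup of $G$ is normal in $G$. $G$ satisfies the condition $\mathfrak{R}_{\sigma_i}$ if, for every set $\pi\subseteq\sigma_i$ and every Hall $\pi$-subgroup $H$ of $G$, every subgroup $K$ of $H$ is normal in the normalizer $N_G(H)$. A Dedekind group is a group all of whose subgroups are normal. $G=D\rtimes M$ means that $D$ is normal in $G$, $M\le G$, $G=DM$ and $D\cap M=1$. A power automorphism of a group is an automorphism mapping every subgroup onto itself. $O_{\sigma_i}(D)$ is the largest normal $\sigma_i$-subgroup of $D$. A normal complement of a subgroup $A$ in a group $E$ is a normal subgroup $S$ of $E$ with $E=AS$ and $A\cap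 S=1$. *)

theory Defs
  imports
    "HOL-Algebra.Algebra"
    "HOL-Library.Disjoint_Sets"
    "HOL-Computational_Algebra.Primes"
begin

definition prime_divisors :: "('a, 'b) monoid_scheme \<Rightarrow> nat set" where
  "prime_divisors G = {p. Factorial_Ring.prime p \<and> p dvd order G}"

definition pi_group :: "nat set \<Rightarrow> ('a, 'b) monoid_scheme \<Rightarrow> bool" where
  "pi_group \<pi> G \<longleftrightarrow> group G \<and> finite (carrier G) \<and> prime_divisors G \<subseteq> \<pi>"

definition hall_pi_subgroup :: "nat set \<Rightarrow> 'a set \<Rightarrow> ('a, 'b) monoid_scheme \<Rightarrow> bool" where
  "hall_pi_subgroup \<pi> H G \<longleftrightarrow>
     subgroup H G \<and> pi_group \<pi> (G\<lparr>carrier := H\<rparr>) \<and>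
     (\<forall>p\<in>\<pi>. Factorial_Ring.prime p \<longrightarrow> \<not> p dvd card (rcosets\<^bsub>G\<^esub> H))"

definition hall_subgroup :: "'a set \<Rightarrow> ('a, 'b) monoid_scheme \<Rightarrow> bool" where
  "hall_subgroup H G \<longleftrightarrow> subgroup H G \<and> coprime (card H) (card (rcosets\<^bsub>G\<^esub> H))"

definition is_chief_factor :: "('a, 'b) monoid_scheme \<Rightarrow> 'a set \<Rightarrow> 'a set \<Rightarrow> bool" where
  "is_chief_factor G H K \<longleftrightarrow>
     H \<lhd> G \<and> K \<lhd> G \<and> K \<subset> H \<and> (\<nexists>N. N \<lhd> G \<and> K \<subset> N \<and> N \<subset> H)"

text \<open>The greatest element is taken with respect to inclusion; it exists for every group
  \<^term>\<open>G\<close> and every subgroup \<^term>\<open>H\<close> of \<^term>\<open>G\<close>.\<close>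

definition normal_core :: "('a, 'b) monoid_scheme \<Rightarrow> 'a set \<Rightarrow> 'a set" where
  "normal_core G H = (GREATEST N. N \<lhd> G \<and> N \<subseteq> H)"

text \<open>The subgroup $O_\pi(G)$; again the greatest element with respect to inclusion, which
  exists for every finite group \<^term>\<open>G\<close>.\<close>

definition pi_radical :: "nat set \<Rightarrow> ('a, 'b) monoid_scheme \<Rightarrow> 'a set" where
  "pi_radical \<pi> G = (GREATEST N. N \<lhd> G \<and> pi_group \<pi> (G\<lparr>carrier := N\<rparr>))"

definition dedekind_group :: "('a, 'b) monoid_scheme \<Rightarrow> bool" where
  "dedekind_group G \<longleftrightarrow> group G \<and> (\<forall>H. subgroup H G \<longrightarrow> H \<lhd> G)"

definition is_semidirect_product :: "('a, 'b) monoid_scheme \<Rightarrow> 'a set \<Rightarrow> 'a set \<Rightarrow> bool" where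
  "is_semidirect_product G D M \<longleftrightarrow>
     D \<lhd> G \<and> subgroup M G \<and> carrier G = D <#>\<^bsub>G\<^esub> M \<and> D \<inter> M = {\<one>\<^bsub>G\<^esub>}"

definition power_automorphism :: "('a, 'b) monoid_scheme \<Rightarrow> ('a \<Rightarrow> 'a) \<Rightarrow> bool" where
  "power_automorphism G f \<longleftrightarrow> f \<in> iso G G \<and> (\<forall>H. subgroup H G \<longrightarrow> f ` H = H)"

definition has_normal_complement :: "'a set \<Rightarrow> ('a, 'b) monoid_scheme \<Rightarrow> bool" where
  "has_normal_complement A E \<longleftrightarrow>
     subgroup A E \<and> (\<exists>S. S \<lhd> E \<and> carrier E = A <#>\<^bsub>E\<^esub> S \<and> A \<inter> S = {\<one>\<^bsub>E\<^esub>})"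

definition condition_R :: "nat set \<Rightarrow> ('a, 'b) monoid_scheme \<Rightarrow> bool" where
  "condition_R \<tau> G \<longleftrightarrow>
     (\<forall>\<pi> H K. \<pi> \<subseteq> \<tau> \<longrightarrow> hall_pi_subgroup \<pi> H G \<longrightarrow> subgroup K (G\<lparr>carrier := H\<rparr>) \<longrightarrow>
        K \<lhd> G\<lparr>carrier := normalizer G H\<rparr>)"

text \<open>The members of the partition are indexed, and none is required to be nonempty.\<close>

definition prime_partition :: "'i set \<Rightarrow> ('i \<Rightarrow> nat set) \<Rightarrow> bool" where
  "prime_partition I \<sigma> \<longleftrightarrow> (\<Union>i\<in>I. \<sigma> i) = {p. Factorial_Ring.prime p} \<and> disjoint_family_on \<sigma> I"

definition sigma_set :: "'i set \<Rightarrow> ('i \<Rightarrow> nat set) \<Rightarrow> ('a, 'b) monoid_scheme \<Rightarrow> nat set set" where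
  "sigma_set I \<sigma> G = {\<sigma> i | i. i \<in> I \<and> \<sigma> i \<inter> prime_divisors G \<noteq> {}}"

definition sigma_primary :: "'i set \<Rightarrow> ('i \<Rightarrow> nat set) \<Rightarrow> ('a, 'b) monoid_scheme \<Rightarrow> bool" where
  "sigma_primary I \<sigma> G \<longleftrightarrow> group G \<and> finite (carrier G) \<and> card (sigma_set I \<sigma> G) \<le> 1"

definition sigma_soluble :: "'i set \<Rightarrow> ('i \<Rightarrow> nat set) \<Rightarrow> ('a, 'b) monoid_scheme \<Rightarrow> bool" where
  "sigma_soluble I \<sigma> G \<longleftrightarrow>
     (\<forall>H K. is_chief_factor G H K \<longrightarrow> sigma_primary I \<sigma> (G\<lparr>carrier := H\<rparr> Mod K))"

text \<open>
  The direct factors are groups on the element type of \<^term>\<open>G\<close>. This is no restriction, because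
  each factor of a direct decomposition is isomorphic to a subgroup of \<^term>\<open>G\<close>.
\<close>

definition sigma_nilpotent :: "'i set \<Rightarrow> ('i \<Rightarrow> nat set) \<Rightarrow> ('a, 'b) monoid_scheme \<Rightarrow> bool" where
  "sigma_nilpotent I \<sigma> G \<longleftrightarrow>
     (\<exists>(n::nat) (F :: nat \<Rightarrow> 'a monoid).
        (\<forall>k<n. sigma_primary I \<sigma> (F k)) \<and> G \<cong> product_group {..<n} F)"

definition sigma_nilpotent_residual ::
  "'i set \<Rightarrow> ('i \<Rightarrow> nat set) \<Rightarrow> ('a, 'b) monoid_scheme \<Rightarrow> 'a set" where
  "sigma_nilpotent_residual I \<sigma> G = \<Inter>{N. N \<lhd> G \<and> sigma_nilpotent I \<sigma> (G Mod N)}"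

definition sigma_subnormal ::
  "'i set \<Rightarrow> ('i \<Rightarrow> nat set) \<Rightarrow> 'a set \<Rightarrow> ('a, 'b) monoid_scheme \<Rightarrow> bool" where
  "sigma_subnormal I \<sigma> H G \<longleftrightarrow>
     (\<exists>(n::nat) C. C 0 = H \<and> C n = carrier G \<and> (\<forall>k\<le>n. subgroup (C k) G) \<and>
        (\<forall>k<n. C k \<subseteq> C (Suc k) \<and>
           (let L = G\<lparr>carrier := C (Suc k)\<rparr>
            in C k \<lhd> L \<or> sigma_primary I \<sigma> (L Mod normal_core L (C k)))))"

definition T_sigma_group :: "'i set \<Rightarrow> ('i \<Rightarrow> nat set) \<Rightarrow> ('a, 'b) monoid_scheme \<Rightarrow> bool" where
  "T_sigma_group I \<sigma> G \<longleftrightarrow> (\<forall>H. sigma_subnormal I \<sigma> H G \<longrightarrow> H \<lhd> G)"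

end

theory Submission
  imports Defs "HOL-Number_Theory.Cong"
begin

text \<open>
  All arguments take place inside \<open>G\<close>, with indices \<open>|H : K|\<close> in place of quotient groups.
  A chain of \<open>\<sigma>\<close>-subnormality can be shortened one step at a time, so \<open>G\<close> is a \<open>T\<^sub>\<sigma>\<close>-group iff
  normality in \<open>G\<close> is transitive and every subgroup between two normal subgroups \<open>K \<subseteq> L\<close> with \<open>L / K\<close> a
  \<open>\<sigma>\<^sub>i\<close>-group is normal. All three conditions are compared with a fourth one, that \<open>D\<close> is an abelian normal
  Hall subgroup, all subgroups above or below \<open>D\<close> are normal in \<open>G\<close>, and \<open>\<sigma>\<^sub>i\<close>-elements of \<open>G\<close> commute with
  \<open>\<sigma>\<^sub>i\<close>-elements of \<open>D\<close>.

  If \<open>G\<close> is a \<open>T\<^sub>\<sigma>\<close>-group, then \<open>G'\<close> centralises every cyclic normal section. Descending along such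
  sections, transitivity makes every subgroup of \<open>G'\<close> normal; as \<open>D \<subseteq> G'\<close> by minimality of \<open>D\<close>, all cyclic
  subgroups of \<open>D\<close> are normal and centralised by \<open>D\<close>, so \<open>D\<close> is abelian. For a prime \<open>p\<close> dividing \<open>|D|\<close>
  with \<open>p\<close>-complement \<open>R\<close> of \<open>D\<close>, minimality of \<open>D\<close> yields a \<open>p'\<close>-element \<open>x\<close> moving the normal Sylow
  \<open>p\<close>-subgroup \<open>A / R\<close> of \<open>G / R\<close>. It acts by powers, so every moved \<open>a\<close> is a power of \<open>[x, a] \<in> D\<close>, and the
  moved elements generate \<open>A / R\<close>. Hence \<open>A = D\<close>, and \<open>p\<close> is odd because \<open>x\<close> raises \<open>a\<close> to a power \<open>k\<close>
  with \<open>p\<close> dividing neither \<open>k\<close> nor \<open>k - 1\<close>.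

  Conversely, a conjugate of a \<open>q\<close>-element \<open>h\<close> with \<open>q\<close> prime to \<open>|D|\<close> is \<open>d h\<^sup>m\<close> with \<open>d \<in> D\<close>. A factor of
  \<open>d\<close> that commutes with \<open>h\<close> is trivial by comparing orders, and one that does not is a power of its
  commutator with \<open>h\<close>.

  The conditions \<open>\<R>\<^sub>\<sigma>\<^sub>i\<close> for Sylow subgroups make \<open>Q\<close> the only conjugate of a \<open>p\<close>-subgroup \<open>Q\<close> inside a
  Sylow subgroup containing \<open>Q\<close>, which forces normality to be transitive. Hall \<open>\<sigma>\<^sub>i\<close>-subgroups exist by the
  Schur-Zassenhaus theorem and are Dedekind groups, which makes the \<open>\<sigma>\<^sub>i\<close>-sections of \<open>G\<close> Dedekind.
\<close>

section \<open>Conjugation, indices and sections\<close>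

text \<open>What is used of \<open>D\<close> is that it is least. A quotient of \<open>G\<close> is
  \<sigma>-nilpotent iff for each \<open>i\<close> it has a normal Hall
  \<open>\<sigma> i\<close>-subgroup, a property that passes to intersections of kernels. If
  \<open>G\<close> is a T_\<sigma>-group, this says that all subgroups above the kernel are normal,
  so an inclusion \<open>D \<subseteq> N\<close> amounts to normality of all subgroups above
  \<open>N\<close>. This is how the derived subgroup comes to contain \<open>D\<close>, and why a
  prime \<open>p\<close> dividing \<open>card D\<close> forces a moving element: without one, all
  subgroups above the \<open>p\<close>-complement would be normal. Elements of prime power order
  carry the argument because a coprime action on a cyclic \<open>p\<close>-group is all or nothing:
  a generator is fixed or is a power of its commutator. A subgroup contains an element as soon as it
  contains those of its powers that have prime power order, so normality and commuting can be tested
  on such elements.\<close>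

definition pi_number :: "nat set \<Rightarrow> nat \<Rightarrow> bool" where
  "pi_number \<pi> n \<longleftrightarrow> (\<forall>p. Factorial_Ring.prime p \<longrightarrow> p dvd n \<longrightarrow> p \<in> \<pi>)"

lemma pi_number_1 [simp]: "pi_number \<pi> 1" "pi_number \<pi> (Suc 0)"
  by (auto simp: pi_number_def)

lemma pi_number_mult: "pi_number \<pi> a \<Longrightarrow> pi_number \<pi> b \<Longrightarrow> pi_number \<pi> (a * b)"
  by (auto simp: pi_number_def prime_dvd_mult_iff)

lemma pi_number_dvd: "pi_number \<pi> b \<Longrightarrow> a dvd b \<Longrightarrow> pi_number \<pi> a"
  by (meson pi_number_def dvd_trans)

lemma pi_number_mono: "pi_number \<pi> a \<Longrightarrow> \<pi> \<subseteq> \<tau> \<Longrightarrow> pi_number \<tau> a"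
  by (auto simp: pi_number_def)

lemma pi_number_power: "pi_number \<pi> a \<Longrightarrow> pi_number \<pi> (a ^ n)"
  by (auto simp: pi_number_def dest: prime_dvd_power)

lemma pi_number_prime: "Factorial_Ring.prime p \<Longrightarrow> p \<in> \<pi> \<Longrightarrow> pi_number \<pi> p"
  by (metis pi_number_def primes_dvd_imp_eq)

lemma coprime_pi_number:
  assumes "pi_number \<pi> a" "pi_number (- \<pi>) b" shows "coprime a b"
proof (rule ccontr)
  assume "\<not> coprime a b"
  then have "gcd a b \<noteq> 1" by (simp add: coprime_iff_gcd_eq_1)
  then obtain p where "Factorial_Ring.prime p" "p dvd gcd a b"
    using prime_factor_nat by blast
  then show False using assms by (auto simp: pi_number_def)
qed

lemma coprime_dvd_both:
  assumes "pi_number \<pi> a" "pi_number (- \<pi>) b" "(c::nat) dvd a" "c dvd b" shows "c = 1"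
  using coprime_pi_number[OF assms(1,2)] assms(3,4) by (metis coprime_common_divisor_nat nat_dvd_1_iff_1)

lemma exists_max_card:
  assumes "finite U" "P A0" "\<And>A. P A \<Longrightarrow> A \<subseteq> U"
  shows "\<exists>A. P A \<and> (\<forall>B. P B \<longrightarrow> card B \<le> card A)"
proof -
  have "\<forall>A. P A \<longrightarrow> card A < Suc (card U)"
    using assms by (auto simp: less_Suc_eq_le card_mono)
  then show ?thesis using ex_has_greatest_nat[of P A0 card "Suc (card U)"] assms(2) by blast
qed

text \<open>As a quotient of orders it is defined without cosets. It is the index when
  \<open>K\<close> is a subgroup of \<open>H\<close> (\<open>card_mult_index\<close>), and chains of
  subgroups then reduce to arithmetic.\<close>

definition index :: "'a set \<Rightarrow> 'a set \<Rightarrow> nat" where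
  "index H K = card H div card K"

definition (in group) cj :: "'a \<Rightarrow> 'a \<Rightarrow> 'a" where
  "cj x h = x \<otimes> h \<otimes> inv x"

text \<open>A one-sided inclusion for an arbitrary set \<open>Y\<close>, so that a single element, a
  subgroup or all of \<open>G\<close> can be plugged in. For a subgroup of a finite group the
  inclusion already forces equality (\<open>normalises_image\<close>), so this is containment of
  \<open>Y\<close> in the normalizer.\<close>

definition (in group) normalises :: "'a set \<Rightarrow> 'a set \<Rightarrow> bool" where
  "normalises Y H \<longleftrightarrow> (\<forall>y\<in>Y. \<forall>h\<in>H. cj y h \<in> H)"

context group
begin

lemma inv_mult_cancel [simp]:
  "\<lbrakk>x \<in> carrier G; y \<in> carrier G\<rbrakk> \<Longrightarrow> inv x \<otimes> (x \<otimes> y) = y"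
  "\<lbrakk>x \<in> carrier G; y \<in> carrier G\<rbrakk> \<Longrightarrow> x \<otimes> (inv x \<otimes> y) = y"
  by (simp_all add: m_assoc[symmetric])

lemma cj_closed [simp]: "x \<in> carrier G \<Longrightarrow> h \<in> carrier G \<Longrightarrow> cj x h \<in> carrier G"
  by (simp add: cj_def)

lemma cj_mult: "\<lbrakk>x \<in> carrier G; h \<in> carrier G; k \<in> carrier G\<rbrakk> \<Longrightarrow> cj x (h \<otimes> k) = cj x h \<otimes> cj x k"
  by (simp add: cj_def m_assoc)

lemma cj_cj: "\<lbrakk>x \<in> carrier G; y \<in> carrier G; h \<in> carrier G\<rbrakk> \<Longrightarrow> cj x (cj y h) = cj (x \<otimes> y) h"
  unfolding cj_def by (simp add: m_assoc inv_mult_group)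

lemma cj_one [simp]: "x \<in> carrier G \<Longrightarrow> cj x \<one> = \<one>" "h \<in> carrier G \<Longrightarrow> cj \<one> h = h"
  by (simp_all add: cj_def)

lemma cj_inv: "\<lbrakk>x \<in> carrier G; h \<in> carrier G\<rbrakk> \<Longrightarrow> cj x (inv h) = inv (cj x h)"
  unfolding cj_def by (simp add: m_assoc inv_mult_group)

lemma cj_pow: "\<lbrakk>x \<in> carrier G; h \<in> carrier G\<rbrakk> \<Longrightarrow> cj x (h [^] (n::nat)) = cj x h [^] n"
  by (induction n) (simp_all add: cj_mult)

lemma cj_cancel [simp]: "\<lbrakk>x \<in> carrier G; h \<in> carrier G\<rbrakk> \<Longrightarrow> cj x (cj (inv x) h) = h"
  "\<lbrakk>x \<in> carrier G; h \<in> carrier G\<rbrakk> \<Longrightarrow> cj (inv x) (cj x h) = h"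
  by (simp_all add: cj_cj)

lemma cj_inj: "x \<in> carrier G \<Longrightarrow> inj_on (cj x) (carrier G)"
  by (rule inj_on_inverseI[where g = "cj (inv x)"]) simp

lemma cj_commute: "\<lbrakk>x \<in> carrier G; h \<in> carrier G\<rbrakk> \<Longrightarrow> cj x h = h \<longleftrightarrow> x \<otimes> h = h \<otimes> x"
  unfolding cj_def by (metis inv_solve_right m_closed)

lemma cj_in_subgroup [simp]: "subgroup H G \<Longrightarrow> x \<in> H \<Longrightarrow> h \<in> H \<Longrightarrow> cj x h \<in> H"
  unfolding cj_def by (simp add: subgroup.m_closed subgroup.m_inv_closed)

lemma subgroup_cj:
  assumes "subgroup H G" "x \<in> carrier G" shows "subgroup (cj x ` H) G"
proof (rule subgroupI)
  have sub: "H \<subseteq> carrier G" using assms subgroup.subset by blast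
  show "cj x ` H \<subseteq> carrier G" using sub assms by auto
  show "cj x ` H \<noteq> {}" using subgroup.one_closed[OF assms(1)] by auto
  show "inv a \<in> cj x ` H" if "a \<in> cj x ` H" for a
    using that sub assms by (auto simp: subset_iff cj_inv[symmetric] subgroup.m_inv_closed)
  show "a \<otimes> b \<in> cj x ` H" if "a \<in> cj x ` H" "b \<in> cj x ` H" for a b
    using that sub assms by (auto simp: subset_iff cj_mult[symmetric] subgroup.m_closed)
qed

lemma normal_iff: "N \<lhd> G \<longleftrightarrow> subgroup N G \<and> normalises (carrier G) N"
  by (simp add: normal_inv_iff normalises_def cj_def)

lemma relative_normal_iff:
  assumes L: "subgroup L G"
  shows "H \<lhd> G\<lparr>carrier := L\<rparr> \<longleftrightarrow> subgroup H G \<and> H \<subseteq> L \<and> normalises L H"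
proof -
  interpret L: group "G\<lparr>carrier := L\<rparr>" using L subgroup_imp_group by blast
  have "subgroup H (G\<lparr>carrier := L\<rparr>) \<longleftrightarrow> subgroup H G \<and> H \<subseteq> L"
    using incl_subgroup[OF L] subgroup_incl[OF _ L] subgroup.subset by fastforce
  then show ?thesis
    by (auto simp: L.normal_inv_iff normalises_def cj_def m_inv_consistent[OF L])
qed

lemma relative_subgroup_iff:
  assumes L: "subgroup L G"
  shows "subgroup H (G\<lparr>carrier := L\<rparr>) \<longleftrightarrow> subgroup H G \<and> H \<subseteq> L"
  using incl_subgroup[OF L] subgroup_incl[OF _ L] subgroup.subset by fastforce

lemma normalises_mono: "normalises Y H \<Longrightarrow> Z \<subseteq> Y \<Longrightarrow> normalises Z H"
  by (auto simp: normalises_def)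

lemma normalises_self: "subgroup H G \<Longrightarrow> normalises H H"
  by (simp add: normalises_def)

lemma normalises_one: "Y \<subseteq> carrier G \<Longrightarrow> normalises Y {\<one>}"
  by (auto simp: normalises_def)

lemma pow_in_subgroup: "subgroup H G \<Longrightarrow> x \<in> H \<Longrightarrow> x [^] (n::nat) \<in> H"
  by (induction n) (auto simp: subgroup.one_closed subgroup.m_closed)

lemma set_mult_subgroup:
  assumes K: "subgroup K G" and H: "subgroup H G" and nK: "normalises H K"
  shows "subgroup (K <#> H) G"
proof (rule subgroupI)
  have sub: "K \<subseteq> carrier G" "H \<subseteq> carrier G" using K H subgroup.subset by auto
  show "K <#> H \<subseteq> carrier G" using sub setmult_subset_G by blast
  show "K <#> H \<noteq> {}"
    using subgroup.one_closed[OF K] subgroup.one_closed[OF H] by (auto simp: set_mult_def)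
  show "a \<otimes> b \<in> K <#> H" if "a \<in> K <#> H" "b \<in> K <#> H" for a b
  proof -
    obtain k h k' h' where 1: "k \<in> K" "h \<in> H" "k' \<in> K" "h' \<in> H" "a = k \<otimes> h" "b = k' \<otimes> h'"
      using \<open>a \<in> K <#> H\<close> \<open>b \<in> K <#> H\<close> by (auto simp: set_mult_def)
    have c: "k \<in> carrier G" "h \<in> carrier G" "k' \<in> carrier G" "h' \<in> carrier G"
      using 1 sub by auto
    have "a \<otimes> b = (k \<otimes> cj h k') \<otimes> (h \<otimes> h')"
      using 1 c by (simp add: cj_def m_assoc)
    moreover have "cj h k' \<in> K" using nK 1 by (auto simp: normalises_def)
    ultimately show ?thesis
      using 1 K H unfolding set_mult_def by (blast intro: subgroup.m_closed)
  qed
  show "inv a \<in> K <#> H" if ain: "a \<in> K <#> H" for a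
  proof -
    obtain k h where 1: "k \<in> K" "h \<in> H" "a = k \<otimes> h"
      using ain by (auto simp: set_mult_def)
    have c: "k \<in> carrier G" "h \<in> carrier G" using 1 sub by auto
    have "inv a = cj (inv h) (inv k) \<otimes> inv h"
      using 1 c by (simp add: cj_def m_assoc inv_mult_group)
    moreover have "cj (inv h) (inv k) \<in> K"
      using nK 1 K H by (auto simp: normalises_def subgroup.m_inv_closed)
    ultimately show ?thesis
      using 1 H unfolding set_mult_def by (blast intro: subgroup.m_inv_closed)
  qed
qed

lemma subset_set_mult:
  assumes "subgroup K G" "subgroup H G"
  shows "K \<subseteq> K <#> H" "H \<subseteq> K <#> H"
proof -
  have sub: "K \<subseteq> carrier G" "H \<subseteq> carrier G" using assms subgroup.subset by auto
  show "K \<subseteq> K <#> H"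
  proof
    fix x assume "x \<in> K"
    then have "x = x \<otimes> \<one>" using sub by auto
    then show "x \<in> K <#> H" using \<open>x \<in> K\<close> subgroup.one_closed[OF assms(2)]
      unfolding set_mult_def by blast
  qed
  show "H \<subseteq> K <#> H"
  proof
    fix x assume "x \<in> H"
    then have "x = \<one> \<otimes> x" using sub by auto
    then show "x \<in> K <#> H" using \<open>x \<in> H\<close> subgroup.one_closed[OF assms(1)]
      unfolding set_mult_def by blast
  qed
qed

lemma set_mult_least:
  assumes "subgroup L G" "K \<subseteq> L" "H \<subseteq> L" shows "K <#> H \<subseteq> L"
  using assms by (auto simp: set_mult_def subset_iff subgroup.m_closed)

lemma normalises_set_mult:
  assumes "normalises Y K" "normalises Y H" "Y \<subseteq> carrier G" "K \<subseteq> carrier G" "H \<subseteq> carrier G"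
  shows "normalises Y (K <#> H)"
  unfolding normalises_def
proof (intro ballI)
  fix y a assume y: "y \<in> Y" and "a \<in> K <#> H"
  then obtain k h where "k \<in> K" "h \<in> H" "a = k \<otimes> h" by (auto simp: set_mult_def)
  then show "cj y a \<in> K <#> H"
    using assms y unfolding normalises_def set_mult_def by (fastforce simp: cj_mult subset_iff)
qed

lemma normal_set_mult:
  assumes "K \<lhd> G" "H \<lhd> G" shows "K <#> H \<lhd> G"
proof -
  have s: "subgroup K G" "subgroup H G" using assms by (auto simp: normal_iff)
  then have c: "K \<subseteq> carrier G" "H \<subseteq> carrier G" using subgroup.subset by auto
  show ?thesis using assms s c set_mult_subgroup normalises_mono normalises_set_mult
    by (meson normal_iff order_refl)
qed

lemma normal_Int: "K \<lhd> G \<Longrightarrow> H \<lhd> G \<Longrightarrow> K \<inter> H \<lhd> G"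
  by (rule normal_subgroup_intersect)

text \<open>With \<open>u a + v b = 1\<close>, \<open>x\<close> is a product of powers of
  \<open>x [^] a\<close> and \<open>x [^] b\<close>. Typically one exponent comes from the order of
  \<open>x\<close> and the other from an index.\<close>

lemma coprime_pow_mem:
  assumes H: "subgroup H G" and x: "x \<in> carrier G" and "x [^] (a::nat) \<in> H" "x [^] (b::nat) \<in> H"
    and "coprime a b"
  shows "x \<in> H"
proof -
  obtain u v where uv: "u * int a + v * int b = 1"
    using \<open>coprime a b\<close> bezout_int[of "int a" "int b"] by (auto simp: coprime_iff_gcd_eq_1)
  have p: "x [^] (int n * u) \<in> H" if "x [^] (n::nat) \<in> H" for n u
    using subgroup_int_pow_closed[OF H that, of u] x
    by (metis int_pow_int int_pow_pow)
  have "x = x [^] (1::int)" using x by simp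
  also have "\<dots> = x [^] (int a * u) \<otimes> x [^] (int b * v)"
    using x uv by (simp add: int_pow_mult[symmetric] mult.commute)
  finally show ?thesis using p assms subgroup.m_closed[OF H] by metis
qed

end

section \<open>Products and indices of subgroups of a finite group\<close>

locale finite_group = group +
  assumes finite_carrier [simp]: "finite (carrier G)"
begin

lemma finite_subgroup [simp]: "subgroup H G \<Longrightarrow> finite H"
  using subgroup.subset finite_subset finite_carrier by metis

lemma card_subgroup_pos [simp]: "subgroup H G \<Longrightarrow> card H > 0"
  by (simp add: subgroup.finite_imp_card_positive)


lemma card_mult_index:
  assumes "subgroup H G" "subgroup K G" "K \<subseteq> H"
  shows "card H = index H K * card K"
proof -
  interpret H: group "G\<lparr>carrier := H\<rparr>" using assms subgroup_imp_group by blast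
  have "subgroup K (G\<lparr>carrier := H\<rparr>)" using assms subgroup_incl by blast
  from H.lagrange[OF this] have "card (rcosets\<^bsub>G\<lparr>carrier := H\<rparr>\<^esub> K) * card K = card H"
    by (simp add: order_def)
  then have "card K dvd card H" by (metis dvd_triv_right)
  then show ?thesis by (simp add: index_def)
qed

lemma index_pos: "subgroup H G \<Longrightarrow> subgroup K G \<Longrightarrow> K \<subseteq> H \<Longrightarrow> index H K > 0"
  using card_mult_index[of H K] by (metis card_subgroup_pos mult_is_0 neq0_conv)

lemma index_self [simp]: "subgroup H G \<Longrightarrow> index H H = 1"
  using card_subgroup_pos[of H] unfolding index_def by (metis div_self neq0_conv)

lemma card_rcosets: "subgroup H G \<Longrightarrow> card (rcosets H) = index (carrier G) H"
  using lagrange[of H] card_subgroup_pos[of H] unfolding index_def order_def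
  by (metis nonzero_mult_div_cancel_right neq0_conv)

lemma index_trans:
  assumes "subgroup H G" "subgroup M G" "subgroup K G" "K \<subseteq> M" "M \<subseteq> H"
  shows "index H K = index H M * index M K"
proof -
  have "card H = index H M * index M K * card K"
    using card_mult_index[of H M] card_mult_index[of M K] assms by simp
  then show ?thesis
    using card_subgroup_pos[OF assms(3)] unfolding index_def[of H K] by simp
qed

lemma index_one_iff:
  assumes "subgroup H G" "subgroup K G" "K \<subseteq> H"
  shows "index H K = 1 \<longleftrightarrow> H = K"
proof
  assume "index H K = 1"
  then have "card K = card H" using card_mult_index[OF assms] by simp
  then show "H = K" using assms card_subset_eq[of H K] by simp
next
  assume "H = K"
  then show "index H K = 1" using assms by simp
qed

lemma index_one [simp]: "index H {\<one>} = card H"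
  by (simp add: index_def)

lemma card_set_mult:
  assumes K: "subgroup K G" and H: "subgroup H G"
  shows "card (K <#> H) * card (H \<inter> K) = card K * card H"
proof -
  have sub: "K \<subseteq> carrier G" "H \<subseteq> carrier G" using K H subgroup.subset by auto
  have "\<forall>y\<in>K <#> H. \<exists>k h. k \<in> K \<and> h \<in> H \<and> y = k \<otimes> h" by (auto simp: set_mult_def)
  then obtain k h where kh: "\<And>y. y \<in> K <#> H \<Longrightarrow> k y \<in> K \<and> h y \<in> H \<and> y = k y \<otimes> h y"
    by metis
  \<comment> \<open>Each \<open>y\<close> in the product has one chosen factorisation
    \<open>k y \<otimes> h y\<close>; all others arise by shifting an element \<open>z\<close> of
    the intersection from one factor to the other, which gives the bijection.\<close>
  have "bij_betw (\<lambda>(y, z). (k y \<otimes> z, inv z \<otimes> h y)) ((K <#> H) \<times> (H \<inter> K)) (K \<times> H)"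
  proof (rule bij_betwI[where g = "\<lambda>(a, b). (a \<otimes> b, inv (k (a \<otimes> b)) \<otimes> a)"])
    show "(\<lambda>(y, z). (k y \<otimes> z, inv z \<otimes> h y)) \<in> (K <#> H) \<times> (H \<inter> K) \<rightarrow> K \<times> H"
      using kh K H by (auto intro: subgroup.m_closed subgroup.m_inv_closed)
    show "(\<lambda>(a, b). (a \<otimes> b, inv (k (a \<otimes> b)) \<otimes> a)) \<in> K \<times> H \<rightarrow> (K <#> H) \<times> (H \<inter> K)"
    proof clarify
      fix a b assume ab: "a \<in> K" "b \<in> H"
      then have m: "a \<otimes> b \<in> K <#> H" by (auto simp: set_mult_def)
      let ?y = "a \<otimes> b"
      have c: "a \<in> carrier G" "b \<in> carrier G" "k ?y \<in> carrier G" "h ?y \<in> carrier G"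
        using ab kh[OF m] sub by auto
      have 1: "inv (k ?y) \<otimes> a \<in> K" using ab kh[OF m] K by (auto intro: subgroup.m_closed subgroup.m_inv_closed)
      have "a \<otimes> b = k ?y \<otimes> h ?y" using kh[OF m] by simp
      then have "inv (k ?y) \<otimes> a = h ?y \<otimes> inv b"
        using c by (metis inv_solve_left inv_solve_right m_assoc m_closed inv_closed)
      then have "inv (k ?y) \<otimes> a \<in> H" using ab kh[OF m] H by (auto intro: subgroup.m_closed subgroup.m_inv_closed)
      then show "?y \<in> K <#> H \<and> inv (k ?y) \<otimes> a \<in> H \<inter> K" using m 1 by auto
    qed
    show "(\<lambda>(a, b). (a \<otimes> b, inv (k (a \<otimes> b)) \<otimes> a)) ((\<lambda>(y, z). (k y \<otimes> z, inv z \<otimes> h y)) p) = p"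
      if pin: "p \<in> (K <#> H) \<times> (H \<inter> K)" for p
    proof -
      obtain y z where p: "p = (y, z)" "y \<in> K <#> H" "z \<in> H \<inter> K" using pin by auto
      have c: "k y \<in> carrier G" "h y \<in> carrier G" "z \<in> carrier G" using p kh[OF p(2)] sub by auto
      have "(k y \<otimes> z) \<otimes> (inv z \<otimes> h y) = y"
        using c kh[OF p(2)] by (metis inv_solve_left m_assoc m_closed inv_closed)
      moreover have "inv (k y) \<otimes> (k y \<otimes> z) = z" using c by (simp add: m_assoc[symmetric])
      ultimately show ?thesis using p by auto
    qed
    show "(\<lambda>(y, z). (k y \<otimes> z, inv z \<otimes> h y)) ((\<lambda>(a, b). (a \<otimes> b, inv (k (a \<otimes> b)) \<otimes> a)) p) = p"
      if pin: "p \<in> K \<times> H" for p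
    proof -
      obtain a b where p: "p = (a, b)" "a \<in> K" "b \<in> H" using pin by auto
      then have m: "a \<otimes> b \<in> K <#> H" by (auto simp: set_mult_def)
      let ?y = "a \<otimes> b"
      have c: "a \<in> carrier G" "b \<in> carrier G" "k ?y \<in> carrier G" "h ?y \<in> carrier G"
        using p kh[OF m] sub by auto
      have "k ?y \<otimes> (inv (k ?y) \<otimes> a) = a" using c by (simp add: m_assoc[symmetric])
      moreover have "inv (inv (k ?y) \<otimes> a) \<otimes> h ?y = inv a \<otimes> (k ?y \<otimes> h ?y)"
        using c by (simp add: inv_mult_group m_assoc)
      moreover have "inv a \<otimes> (k ?y \<otimes> h ?y) = b" using c kh[OF m] by (metis inv_solve_left m_closed)
      ultimately show ?thesis using p by simp
    qed
  qed
  then have "card ((K <#> H) \<times> (H \<inter> K)) = card (K \<times> H)" by (rule bij_betw_same_card)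
  then show ?thesis by (simp add: card_cartesian_product)
qed

text \<open>The second isomorphism theorem at the level of orders; both equations follow from
  \<open>card_set_mult\<close> by cancelling.\<close>

lemma index_set_mult:
  assumes K: "subgroup K G" and H: "subgroup H G" and n: "normalises H K"
  shows "index (K <#> H) K = index H (H \<inter> K)" "index (K <#> H) H = index K (H \<inter> K)"
proof -
  have s: "subgroup (H \<inter> K) G" "subgroup (K <#> H) G"
    using subgroups_Inter_pair[OF H K] set_mult_subgroup[OF K H n] by auto
  note sm = subset_set_mult[OF K H]
  have e: "card (K <#> H) * card (H \<inter> K) = card K * card H" by (rule card_set_mult[OF K H])
  have "index (K <#> H) K * card K * card (H \<inter> K) = card K * (index H (H \<inter> K) * card (H \<inter> K))"
    using e card_mult_index[OF s(2) K sm(1)] card_mult_index[OF H s(1)] by simp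
  then have "index (K <#> H) K * (card K * card (H \<inter> K)) = index H (H \<inter> K) * (card K * card (H \<inter> K))"
    by (simp add: ac_simps)
  then show "index (K <#> H) K = index H (H \<inter> K)"
    using card_subgroup_pos[OF K] card_subgroup_pos[OF s(1)] by (metis mult_cancel2 mult_is_0 neq0_conv)
  have "index (K <#> H) H * card H * card (H \<inter> K) = (index K (H \<inter> K) * card (H \<inter> K)) * card H"
    using e card_mult_index[OF s(2) H sm(2)] card_mult_index[OF K s(1)] by simp
  then have "index (K <#> H) H * (card H * card (H \<inter> K)) = index K (H \<inter> K) * (card H * card (H \<inter> K))"
    by (simp add: ac_simps)
  then show "index (K <#> H) H = index K (H \<inter> K)"
    using card_subgroup_pos[OF H] card_subgroup_pos[OF s(1)] by (metis mult_cancel2 mult_is_0 neq0_conv)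
qed

lemma mem_normalizer:
  assumes "subgroup H G"
  shows "g \<in> normalizer G H \<longleftrightarrow> g \<in> carrier G \<and> normalises {g} H"
proof -
  have sub: "H \<subseteq> carrier G" using assms subgroup.subset by auto
  have eq: "g <# H #> inv g = cj g ` H"
    by (auto simp: l_coset_def r_coset_def cj_def)
  have "cj g ` H = H \<longleftrightarrow> normalises {g} H" if "g \<in> carrier G"
  proof
    assume "normalises {g} H"
    then have "cj g ` H \<subseteq> H" by (auto simp: normalises_def)
    moreover have "card (cj g ` H) = card H"
      using cj_inj[OF that] sub by (meson card_image inj_on_subset)
    ultimately show "cj g ` H = H" using assms by (simp add: card_subset_eq)
  qed (auto simp: normalises_def)
  then show ?thesis using sub eq by (auto simp: normalizer_def stabilizer_def)
qed

lemma normalizer_subgroup: "subgroup H G \<Longrightarrow> subgroup (normalizer G H) G"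
  using normalizer_imp_subgroup subgroup.subset by blast

lemma normalises_iff_normalizer:
  "subgroup H G \<Longrightarrow> Y \<subseteq> carrier G \<Longrightarrow> normalises Y H \<longleftrightarrow> Y \<subseteq> normalizer G H"
  by (auto simp: mem_normalizer normalises_def)

lemma normalises_set_multI:
  assumes "subgroup N G" "subgroup A G" "subgroup B G" "normalises B A" "normalises A N" "normalises B N"
  shows "normalises (A <#> B) N"
proof -
  have "A <#> B \<subseteq> normalizer G N"
    using set_mult_least[OF normalizer_subgroup[OF assms(1)]] assms normalises_iff_normalizer subgroup.subset
    by metis
  moreover have "A <#> B \<subseteq> carrier G" using assms setmult_subset_G subgroup.subset by metis
  ultimately show ?thesis using assms(1) normalises_iff_normalizer by blast
qed

lemma normalises_image:
  assumes "subgroup H G" "normalises {g} H" "g \<in> carrier G"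
  shows "cj g ` H = H"
proof -
  have sub: "H \<subseteq> carrier G" using assms subgroup.subset by auto
  have "cj g ` H \<subseteq> H" using assms by (auto simp: normalises_def)
  moreover have "card (cj g ` H) = card H"
    using cj_inj[OF assms(3)] sub by (meson card_image inj_on_subset)
  ultimately show ?thesis using assms by (simp add: card_subset_eq)
qed

lemma order_FactGroup:
  assumes H: "subgroup H G" and K: "subgroup K G" "K \<subseteq> H" "normalises H K"
  shows "order (G\<lparr>carrier := H\<rparr> Mod K) = index H K"
proof -
  let ?H = "G\<lparr>carrier := H\<rparr>"
  interpret Hg: group ?H using H subgroup_imp_group by blast
  have "subgroup K ?H" using K H subgroup_incl by blast
  from Hg.lagrange[OF this] have "card (rcosets\<^bsub>?H\<^esub> K) * card K = card H"
    by (simp add: order_def)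
  moreover have "order (?H Mod K) = card (rcosets\<^bsub>?H\<^esub> K)" by (simp add: order_def FactGroup_def)
  ultimately show ?thesis
    using card_subgroup_pos[OF K(1)] unfolding index_def by (metis nonzero_mult_div_cancel_right neq0_conv)
qed

lemma pow_index_mem:
  assumes H: "subgroup H G" and K: "subgroup K G" "K \<subseteq> H" "normalises H K" and x: "x \<in> H"
  shows "x [^] index H K \<in> K"
proof -
  let ?H = "G\<lparr>carrier := H\<rparr>"
  interpret Hg: group ?H using H subgroup_imp_group by blast
  have n: "K \<lhd> ?H" using K relative_normal_iff[OF H] by auto
  interpret N: normal K ?H by (rule n)
  interpret Q: group "?H Mod K" by (rule N.factorgroup_is_group)
  have o: "order (?H Mod K) = index H K" by (rule order_FactGroup[OF H K])
  have xc: "K #>\<^bsub>?H\<^esub> x \<in> carrier (?H Mod K)" using x by (auto simp: carrier_FactGroup)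
  have "(K #>\<^bsub>?H\<^esub> x) [^]\<^bsub>?H Mod K\<^esub> index H K = K"
    using Q.pow_order_eq_1[OF xc] o by simp
  then have "K #>\<^bsub>?H\<^esub> (x [^]\<^bsub>?H\<^esub> index H K) = K"
    using N.FactGroup_pow[of x "index H K"] x by simp
  then have "x [^]\<^bsub>?H\<^esub> index H K \<in> K"
    by (intro Hg.coset_join1[OF _ _ N.subgroup_axioms]) (use x Hg.nat_pow_closed[of x] in simp_all)
  then show ?thesis by (simp add: nat_pow_consistent[symmetric])
qed

lemma card_Union_FactGroup:
  assumes N: "N \<lhd> G" and A: "subgroup A (G Mod N)"
  shows "card (\<Union>A) = card A * card N"
proof -
  interpret N: normal N G by (rule N)
  have sub: "R \<in> rcosets N" if "R \<in> A" for R
    using that subgroup.subset[OF A] by (auto simp: FactGroup_def)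
  have "card N * card A = card (\<Union>A)"
  proof (rule card_partition)
    have "finite (carrier (G Mod N))" by (simp add: carrier_FactGroup)
    then show "finite A" using A by (meson finite_subset subgroup.subset)
    show "finite (\<Union>A)" using N.factgroup_subgroup_union_subgroup[OF A] by simp
    show "c1 \<inter> c2 = {}" if "c1 \<in> A" "c2 \<in> A" "c1 \<noteq> c2" for c1 c2
      using sub that rcos_disjoint[OF N.subgroup_axioms] by (auto simp: pairwise_def disjnt_def)
    show "card R = card N" if "R \<in> A" for R
      using sub[OF that] card_rcosets_equal N.subset by metis
  qed
  then show ?thesis by (simp only: mult.commute)
qed

text \<open>Sylow's existence theorem in \<open>H/K\<close>, pulled back. \<open>p ^ k\<close> need
  not be the full \<open>p\<close>-part of the index, so \<open>k = 1\<close> is Cauchy's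
  theorem.\<close>

lemma exists_intermediate_prime_power:
  assumes H: "subgroup H G" and K: "subgroup K G" "K \<subseteq> H" "normalises H K"
    and p: "Factorial_Ring.prime p" "p ^ k dvd index H K"
  obtains B where "subgroup B G" "K \<subseteq> B" "B \<subseteq> H" "index B K = p ^ k"
proof -
  let ?H = "G\<lparr>carrier := H\<rparr>"
  interpret Hg: finite_group ?H
    using subgroup_imp_group[OF H] finite_subgroup[OF H] by (simp add: finite_group_def finite_group_axioms_def)
  have n: "K \<lhd> ?H" using K relative_normal_iff[OF H] by auto
  interpret N: normal K ?H by (rule n)
  interpret Q: group "?H Mod K" by (rule N.factorgroup_is_group)
  have o: "order (?H Mod K) = index H K" by (rule order_FactGroup[OF H K])
  have f: "finite (carrier (?H Mod K))" using H by (auto simp: carrier_FactGroup)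
  obtain m where "order (?H Mod K) = p ^ k * m" using o p by auto
  then obtain A where A: "subgroup A (?H Mod K)" "card A = p ^ k"
    using sylow_thm[OF p(1) Q.is_group _ f] by blast
  define B where "B = \<Union>A"
  have B: "subgroup B ?H" unfolding B_def by (rule N.factgroup_subgroup_union_subgroup[OF A(1)])
  then have BG: "subgroup B G" "B \<subseteq> H" using relative_subgroup_iff[OF H] by auto
  have KA: "K \<in> A" using subgroup.one_closed[OF A(1)] by simp
  then have KB: "K \<subseteq> B" unfolding B_def by auto
  have "index B K = p ^ k"
    using Hg.card_Union_FactGroup[OF n A(1)] A(2) card_subgroup_pos[OF K(1)] by (simp add: B_def index_def)
  then show thesis using that BG KB by blast
qed

text \<open>Let \<open>B/K\<close> have order \<open>p\<close>. If \<open>p\<close> did not divide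
  \<open>m\<close>, every element of \<open>B\<close> would have two coprime powers in
  \<open>K\<close>, so that \<open>B = K\<close>.\<close>

lemma index_prime_dvd_exponent:
  assumes H: "subgroup H G" and K: "subgroup K G" "K \<subseteq> H" "normalises H K"
    and m: "\<And>y. y \<in> H \<Longrightarrow> y [^] (m::nat) \<in> K" and p: "Factorial_Ring.prime p" "p dvd index H K"
  shows "p dvd m"
proof (rule ccontr)
  assume np: "\<not> p dvd m"
  obtain B where B: "subgroup B G" "K \<subseteq> B" "B \<subseteq> H" "index B K = p"
    using exists_intermediate_prime_power[OF H K p(1), of 1] p by auto
  have "B \<subseteq> K"
  proof
    fix b assume b: "b \<in> B"
    have "b [^] p \<in> K" using pow_index_mem[OF B(1) K(1) B(2) _ b] B normalises_mono[OF K(3) B(3)] by simp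
    moreover have "coprime p m" using np p by (simp add: prime_imp_coprime)
    moreover have "b [^] m \<in> K" "b \<in> carrier G"
      using m[of b] b B(3) subgroup.subset[OF H] by auto
    ultimately show "b \<in> K" using coprime_pow_mem[OF K(1)] by blast
  qed
  then have "B = K" using B by auto
  then have "index B K = 1" using card_subgroup_pos[OF K(1)] by (simp add: index_def)
  then show False using B(4) p by auto
qed

end

section \<open>Elements of prime power order\<close>

context group
begin

definition p_element :: "nat \<Rightarrow> 'a \<Rightarrow> bool" where
  "p_element p x \<longleftrightarrow> x \<in> carrier G \<and> (\<exists>n::nat. x [^] (p ^ n) = \<one>)"

text \<open>The preimage of the cyclic subgroup that \<open>x\<close> generates modulo
  \<open>K\<close>; it is a subgroup once \<open>x\<close> normalises \<open>K\<close>.\<close>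

definition adjoin :: "'a set \<Rightarrow> 'a \<Rightarrow> 'a set" where
  "adjoin K x = K <#> generate G {x}"

lemma p_element_carrier: "p_element p x \<Longrightarrow> x \<in> carrier G"
  by (simp add: p_element_def)

lemma p_element_pow: "p_element p x \<Longrightarrow> p_element p (x [^] (k::nat))"
  unfolding p_element_def by (metis nat_pow_closed nat_pow_one nat_pow_pow mult.commute)

lemma normalises_generate:
  assumes "subgroup K G" "x \<in> carrier G" "normalises {x} K" "finite (carrier G)"
  shows "normalises (generate G {x}) K"
proof -
  have K: "K \<subseteq> carrier G" using assms subgroup.subset by auto
  have "\<forall>h\<in>K. cj (x [^] (n::nat)) h \<in> K" for n
  proof (induction n)
    case (Suc n)
    show ?case
    proof
      fix h assume "h \<in> K"
      then have "cj (x [^] n) (cj x h) \<in> K" using Suc assms by (auto simp: normalises_def)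
      then show "cj (x [^] Suc n) h \<in> K" using \<open>h \<in> K\<close> K assms by (auto simp: cj_cj)
    qed
  qed (use K in auto)
  then show ?thesis
    using generate_pow_on_finite_carrier[OF assms(4,2)] by (auto simp: normalises_def)
qed

lemma pow_mod_normalised:
  assumes "subgroup K G" "x \<in> carrier G" "normalises {x} K" "finite (carrier G)" "k \<in> K"
  shows "\<exists>k'\<in>K. (k \<otimes> x) [^] (n::nat) = k' \<otimes> x [^] n"
proof (induction n)
  case 0
  then show ?case using subgroup.one_closed[OF assms(1)] by force
next
  case (Suc n)
  then obtain k' where k': "k' \<in> K" "(k \<otimes> x) [^] n = k' \<otimes> x [^] n" by auto
  have c: "k \<in> carrier G" "k' \<in> carrier G" using assms k' subgroup.mem_carrier by fastforce+
  have "x [^] n \<in> generate G {x}"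
    using generate_pow_on_finite_carrier[OF assms(4,2)] by auto
  then have m: "cj (x [^] n) k \<in> K" using normalises_generate[OF assms(1-4)] assms(5) by (auto simp: normalises_def)
  have "(k \<otimes> x) [^] Suc n = (k' \<otimes> cj (x [^] n) k) \<otimes> x [^] Suc n"
    using k' c assms(2) by (simp add: cj_def m_assoc)
  then show ?case using subgroup.m_closed[OF assms(1) k'(1) m] by blast
qed

text \<open>The elements \<open>g\<close> and \<open>h\<close> raise \<open>b\<close> to powers, and
  exponents multiply commutatively, so \<open>g \<otimes> h\<close> and \<open>h \<otimes> g\<close>
  act alike on \<open>b\<close>.\<close>

lemma commutator_fixes:
  assumes b: "b \<in> carrier G" and pw: "\<And>g. g \<in> carrier G \<Longrightarrow> \<exists>k::nat. cj g b = b [^] k"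
    and gh: "g \<in> carrier G" "h \<in> carrier G"
  shows "cj (g \<otimes> h \<otimes> inv g \<otimes> inv h) b = b"
proof -
  have comm: "cj (g \<otimes> h) b = cj (h \<otimes> g) b"
  proof -
    obtain k l :: nat where "cj g b = b [^] k" "cj h b = b [^] l" using pw gh by blast
    then show ?thesis using gh b by (simp add: cj_cj[symmetric] cj_pow nat_pow_pow mult.commute)
  qed
  obtain m :: nat where m: "cj (inv (h \<otimes> g)) b = b [^] m" using pw gh by blast
  have "g \<otimes> h \<otimes> inv g \<otimes> inv h = (g \<otimes> h) \<otimes> inv (h \<otimes> g)" using gh by (simp add: m_assoc inv_mult_group)
  then have "cj (g \<otimes> h \<otimes> inv g \<otimes> inv h) b = cj (g \<otimes> h) (b [^] m)" using gh b by (simp add: cj_cj[symmetric] m)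
  also have "\<dots> = cj (h \<otimes> g) (b [^] m)" using gh b comm by (simp add: cj_pow)
  also have "\<dots> = b" using gh b m by (metis cj_cancel(1) m_closed)
  finally show ?thesis .
qed

end

text \<open>\<open>k ^ m - 1\<close> is \<open>k - 1\<close> times a geometric sum that is congruent
  to \<open>m\<close> modulo \<open>p\<close>, hence prime to \<open>p\<close>. In other words, the
  units modulo \<open>p ^ e\<close> that are congruent to 1 modulo \<open>p\<close> form a
  \<open>p\<close>-group.\<close>

lemma prime_power_dvd_pred:
  fixes k :: nat
  assumes p: "Factorial_Ring.prime p" and 1: "p dvd k - 1" "k \<ge> 1" and 2: "p ^ e dvd k ^ m - 1" and 3: "\<not> p dvd m"
  shows "p ^ e dvd k - 1"
proof -
  have s: "k ^ m - 1 = (k - 1) * (\<Sum>i<m. k ^ i)"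
  proof -
    have "int k ^ m - 1 = (int k - 1) * (\<Sum>i<m. int k ^ i)" by (rule power_diff_1_eq)
    then have "int (k ^ m - 1) = int ((k - 1) * (\<Sum>i<m. k ^ i))"
      using 1 by (simp add: of_nat_diff)
    then show ?thesis by (simp only: of_nat_eq_iff)
  qed
  have k1: "[k = 1] (mod p)" using 1 by (simp add: cong_altdef_nat)
  have "[(\<Sum>i<m. k ^ i) = (\<Sum>i<m. 1)] (mod p)"
    by (rule cong_sum) (metis k1 cong_pow power_one)
  then have "\<not> p dvd (\<Sum>i<m. k ^ i)" using 3 cong_dvd_iff by fastforce
  then have "coprime (p ^ e) (\<Sum>i<m. k ^ i)" using p by (simp add: prime_imp_coprime)
  then show ?thesis using 2 s by (simp add: coprime_dvd_mult_left_iff)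
qed

context finite_group
begin

lemma mem_adjoin:
  assumes "x \<in> carrier G"
  shows "y \<in> adjoin K x \<longleftrightarrow> (\<exists>k\<in>K. \<exists>n::nat. y = k \<otimes> x [^] n)"
  using generate_pow_on_finite_carrier[OF finite_carrier assms] by (auto simp: adjoin_def set_mult_def)

lemma adjoin_subgroup:
  assumes "subgroup K G" "x \<in> carrier G" "normalises {x} K"
  shows "subgroup (adjoin K x) G"
  unfolding adjoin_def using assms by (intro set_mult_subgroup normalises_generate generate_is_subgroup) auto

lemma subset_adjoin:
  assumes "subgroup K G" "x \<in> carrier G"
  shows "K \<subseteq> adjoin K x" "x \<in> adjoin K x"
  using subset_set_mult[OF assms(1) generate_is_subgroup[of "{x}"]] assms generate.incl[of x "{x}" G]
  by (auto simp: adjoin_def)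

lemma adjoin_least:
  assumes "subgroup L G" "K \<subseteq> L" "x \<in> L"
  shows "adjoin K x \<subseteq> L"
  unfolding adjoin_def using assms
  by (intro set_mult_least generate_subgroup_incl) auto

lemma normalises_adjoin:
  assumes "subgroup K G" "x \<in> carrier G" "normalises {x} K"
  shows "normalises (adjoin K x) K"
  unfolding adjoin_def
  by (rule normalises_set_multI) (use assms in \<open>auto intro: normalises_generate normalises_self generate_is_subgroup\<close>)

lemma adjoin_pow_mem:
  assumes "subgroup K G" "x \<in> carrier G" "normalises {x} K" "x [^] (m::nat) \<in> K" "y \<in> adjoin K x"
  shows "y [^] m \<in> K"
proof -
  obtain k n where y: "k \<in> K" "y = k \<otimes> x [^] (n::nat)" using assms mem_adjoin by auto
  have "x [^] n \<in> generate G {x}" using generate_pow_on_finite_carrier[OF finite_carrier assms(2)] by auto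
  then have "normalises {x [^] n} K"
    using normalises_generate[OF assms(1-3) finite_carrier] by (auto simp: normalises_def)
  from pow_mod_normalised[OF assms(1) _ this finite_carrier y(1), of m]
  obtain k' where "k' \<in> K" "y [^] m = k' \<otimes> (x [^] n) [^] m" using y assms by auto
  moreover have "(x [^] n) [^] m = (x [^] m) [^] n" using assms by (simp add: nat_pow_pow mult.commute)
  ultimately show ?thesis using assms(1,4) pow_in_subgroup subgroup.m_closed by metis
qed

lemma index_adjoin:
  assumes "subgroup K G" "x \<in> carrier G" "normalises {x} K" "x [^] (m::nat) \<in> K"
    and "Factorial_Ring.prime r" "r dvd index (adjoin K x) K"
  shows "r dvd m"
  using index_prime_dvd_exponent[OF adjoin_subgroup[OF assms(1-3)] assms(1) subset_adjoin(1)[OF assms(1,2)]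
      normalises_adjoin[OF assms(1-3)] adjoin_pow_mem[OF assms(1-4)] assms(5,6)] by simp

lemma pi_number_index_adjoin:
  assumes "subgroup K G" "normalises {x} K" "p_element p x" "Factorial_Ring.prime p" "p \<in> \<pi>"
  shows "pi_number \<pi> (index (adjoin K x) K)"
  unfolding pi_number_def
proof (intro allI impI)
  fix r assume r: "Factorial_Ring.prime r" "r dvd index (adjoin K x) K"
  obtain n :: nat where "x [^] (p ^ n) = \<one>" using assms by (auto simp: p_element_def)
  then have "r dvd p ^ n"
    using index_adjoin[OF assms(1) _ assms(2) _ r] assms subgroup.one_closed[OF assms(1)]
    by (metis p_element_carrier)
  then show "r \<in> \<pi>" using r assms by (metis prime_dvd_power primes_dvd_imp_eq)
qed

text \<open>Induction on an exponent \<open>m\<close> that kills a power of \<open>x\<close>: when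
  \<open>m\<close> is \<open>p ^ e\<close> times a cofactor prime to \<open>p\<close>, the two
  corresponding powers are killed by smaller exponents, and \<open>coprime_pow_mem\<close>
  recombines them. Quantifying over powers \<open>x [^] k\<close> avoids an explicit decomposition
  of \<open>x\<close>.\<close>

lemma prime_parts_mem:
  assumes S: "subgroup S G" and x: "x \<in> carrier G"
    and parts: "\<And>p k. \<lbrakk>Factorial_Ring.prime p; p_element p (x [^] (k::nat))\<rbrakk> \<Longrightarrow> x [^] k \<in> S"
  shows "x \<in> S"
proof -
  have "(x [^] (k::nat)) [^] m = \<one> \<Longrightarrow> x [^] k \<in> S" if "m > 0" for m k :: nat
    using that
  proof (induction m arbitrary: k rule: less_induct)
    case (less m)
    show ?case
    proof (cases "m = 1")
      case True
      then show ?thesis using less.prems x subgroup.one_closed[OF S] by simp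
    next
      case False
      then obtain p where p: "Factorial_Ring.prime p" "p dvd m" using prime_factor_nat by blast
      obtain b where b: "m = p ^ multiplicity p m * b" "\<not> p dvd b"
        using multiplicity_decompose'[of m p] less.prems p by (metis neq0_conv not_prime_unit)
      define e where "e = multiplicity p m"
      have e: "e > 0" unfolding e_def using p less.prems by (simp add: prime_multiplicity_gt_zero_iff)
      have m: "m = p ^ e * b" using b e_def by simp
      have bpos: "b > 0" using less.prems m by (cases b) auto
      have pe: "p ^ e > 1" using p e by (metis one_less_power prime_gt_1_nat)
      show ?thesis
      proof (cases "b = 1")
        case True
        then have "p_element p (x [^] k)" using less.prems m x by (auto simp: p_element_def)
        then show ?thesis using parts p by blast
      next
        case False
        then have "p ^ e * 1 < p ^ e * b" "1 * b < p ^ e * b" using bpos pe False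
            by (metis One_nat_def Suc_lessI less_trans mult_less_cancel1 zero_less_one, metis mult_less_cancel2)
        then have lt: "p ^ e < m" "b < m" using m by auto
        have 1: "(x [^] k) [^] (p ^ e) \<in> S"
        proof -
          have "(x [^] (k * p ^ e)) [^] b = \<one>" using less.prems m x by (simp add: nat_pow_pow mult.assoc)
          then show ?thesis using less.IH[OF lt(2), of "k * p ^ e"] bpos x by (simp add: nat_pow_pow)
        qed
        have 2: "(x [^] k) [^] b \<in> S"
        proof -
          have "(x [^] (k * b)) [^] (p ^ e) = \<one>" using less.prems m x by (simp add: nat_pow_pow ac_simps)
          then show ?thesis using less.IH[OF lt(1), of "k * b"] pe prime_gt_0_nat[OF p(1)] x by (simp add: nat_pow_pow)
        qed
        have "coprime (p ^ e) b" using b p by (simp add: prime_imp_coprime)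
        then show ?thesis using coprime_pow_mem[OF S _ 1 2] x by simp
      qed
    qed
  qed
  from this[of "order G" 1] show ?thesis
    using x pow_order_eq_1[OF x] by (simp add: order_gt_0_iff_finite)
qed

text \<open>\<open>cj y h \<in> H\<close> says that \<open>h\<close> lies in the conjugate of
  \<open>H\<close> under \<open>inv y\<close>. This is a subgroup, so \<open>prime_parts_mem\<close>
  applies to it, and only elements of prime power order remain to be conjugated.\<close>

lemma normalises_of_p_elements:
  assumes H: "subgroup H G" and Y: "Y \<subseteq> carrier G"
    and pe: "\<And>p h y. \<lbrakk>Factorial_Ring.prime p; p_element p h; h \<in> H; y \<in> Y\<rbrakk> \<Longrightarrow> cj y h \<in> H"
  shows "normalises Y H"
  unfolding normalises_def
proof (intro ballI)
  fix y h assume y: "y \<in> Y" and h: "h \<in> H"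
  have yc: "y \<in> carrier G" and hc: "h \<in> carrier G" using y Y h subgroup.mem_carrier[OF H] by auto
  have S: "subgroup (cj (inv y) ` H) G" using subgroup_cj[OF H] yc by simp
  have "h \<in> cj (inv y) ` H"
  proof (rule prime_parts_mem[OF S hc])
    fix p and k :: nat assume "Factorial_Ring.prime p" "p_element p (h [^] k)"
    then have "cj y (h [^] k) \<in> H" using pe y h H pow_in_subgroup by blast
    then show "h [^] k \<in> cj (inv y) ` H" using yc hc by (metis cj_cancel(2) imageI nat_pow_closed)
  qed
  then obtain h' where "h' \<in> H" "h = cj (inv y) h'" by auto
  then show "cj y h \<in> H" using yc subgroup.mem_carrier[OF H] by auto
qed

lemma p_element_mem:
  assumes H: "subgroup H G" and K: "subgroup K G" "K \<subseteq> H" "normalises H K"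
    and x: "x \<in> H" "p_element p x" and p: "Factorial_Ring.prime p" "\<not> p dvd index H K"
  shows "x \<in> K"
proof -
  obtain n :: nat where n: "x [^] (p ^ n) = \<one>" using x by (auto simp: p_element_def)
  have "coprime (p ^ n) (index H K)" using p by (simp add: prime_imp_coprime)
  then show ?thesis using coprime_pow_mem[OF K(1) p_element_carrier[OF x(2)] _ pow_index_mem[OF H K x(1)]]
      n subgroup.one_closed[OF K(1)] by metis
qed

text \<open>A subgroup \<open>A\<close> of largest order for which \<open>index A N\<close> is a
  \<open>\<pi>\<close>-number works: \<open>A\<close> is normalised by \<open>H\<close>, so a prime
  of \<open>\<pi>\<close> dividing \<open>index H A\<close> would produce a larger one by Cauchy's
  theorem.\<close>

lemma dedekind_section_hall:
  assumes H: "subgroup H G" and N: "subgroup N G" "N \<subseteq> H"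
    and ded: "\<And>Y. \<lbrakk>subgroup Y G; N \<subseteq> Y; Y \<subseteq> H\<rbrakk> \<Longrightarrow> normalises H Y"
  obtains A where "subgroup A G" "N \<subseteq> A" "A \<subseteq> H" "pi_number \<pi> (index A N)" "pi_number (- \<pi>) (index H A)"
proof -
  let ?P = "\<lambda>A. subgroup A G \<and> N \<subseteq> A \<and> A \<subseteq> H \<and> pi_number \<pi> (index A N)"
  have "?P N" using N by simp
  then obtain A where A: "?P A" and max: "\<And>B. ?P B \<Longrightarrow> card B \<le> card A"
    using exists_max_card[of H ?P N] finite_subgroup[OF H] by blast
  have "pi_number (- \<pi>) (index H A)"
    unfolding pi_number_def
  proof (intro allI impI)
    fix p assume p: "Factorial_Ring.prime p" "p dvd index H A"
    obtain B where B: "subgroup B G" "A \<subseteq> B" "B \<subseteq> H" "index B A = p"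
      using exists_intermediate_prime_power[OF H _ _ ded p(1), of A 1] A p by auto
    have c: "card B = p * card A" using card_mult_index[of B A] A B by simp
    show "p \<in> - \<pi>"
    proof
      assume "p \<in> \<pi>"
      then have "pi_number \<pi> (index B A * index A N)" using A B p pi_number_mult pi_number_prime by metis
      then have "?P B" using A B N index_trans[of B A N] by auto
      then have "p * card A \<le> card A" using max c by metis
      then show False using card_subgroup_pos[of A] A prime_gt_1_nat[OF p(1)] by auto
    qed
  qed
  then show thesis using that A by blast
qed

text \<open>On the cyclic group of order \<open>p ^ e\<close> generated by \<open>a\<close>,
  \<open>x\<close> acts as an exponent \<open>k\<close> with \<open>k ^ (q ^ s)\<close> congruent to
  1 modulo \<open>p ^ e\<close>. If \<open>p\<close> divides \<open>k - 1\<close>, then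
  \<open>k\<close> itself is 1 modulo \<open>p ^ e\<close>, because \<open>q\<close> differs from
  \<open>p\<close>. Otherwise \<open>k - 1\<close> is invertible and the commutator
  \<open>a [^] (k - 1)\<close> generates the same group; then \<open>p\<close> divides neither
  \<open>k\<close> nor \<open>k - 1\<close>, so it is odd.\<close>

lemma power_action_cases:
  assumes p: "Factorial_Ring.prime p" and q: "Factorial_Ring.prime q" "p \<noteq> q"
    and x: "p_element q x" and a: "p_element p a" and k: "cj x a = a [^] (k::nat)"
  shows "cj x a = a \<or> (odd p \<and> (\<exists>j::nat. a = (cj x a \<otimes> inv a) [^] j))"
proof -
  have c: "x \<in> carrier G" "a \<in> carrier G" using a x p_element_carrier by auto
  obtain s :: nat where s: "x [^] (q ^ s) = \<one>" using x by (auto simp: p_element_def)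
  obtain n :: nat where n: "a [^] (p ^ n) = \<one>" using a by (auto simp: p_element_def)
  have "ord a dvd p ^ n" using n c by (simp add: pow_eq_id)
  then obtain e where e: "ord a = p ^ e" using p by (auto simp: divides_primepow_nat)
  have it: "cj (x [^] j) a = a [^] (k ^ j)" for j :: nat
  proof (induction j)
    case (Suc j)
    have "cj (x [^] Suc j) a = cj (x [^] j) (cj x a)" using c by (simp add: cj_cj)
    also have "\<dots> = a [^] (k ^ Suc j)" using c Suc by (simp add: k cj_pow nat_pow_pow mult.commute)
    finally show ?case .
  qed (use c in simp)
  have fixed: "a [^] (k ^ (q ^ s)) = a" using it[of "q ^ s"] s c by simp
  show ?thesis
  proof (cases "e = 0")
    case True
    then have "a = \<one>" using e c ord_eq_1 by simp
    then show ?thesis using c by simp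
  next
    case False
    \<comment> \<open>Exponents are natural numbers, so \<open>k - 1\<close> is truncated;
      \<open>k = 0\<close> would make \<open>a\<close> trivial.\<close>
    have k0: "k \<ge> 1"
    proof (rule ccontr)
      assume "\<not> 1 \<le> k"
      then have "k ^ (q ^ s) = 0" using q by (simp add: power_0_left prime_gt_0_nat)
      then have "a = \<one>" using fixed nat_pow_0 by metis
      then have "ord a = 1" using ord_eq_1 c by blast
      then show False using e False p by (metis nat_power_eq_Suc_0_iff One_nat_def not_prime_1)
    qed
    have sub1: "a [^] (j - 1) = a [^] j \<otimes> inv a" if j1: "j \<ge> 1" for j :: nat
    proof -
      have "a [^] (j - 1) \<otimes> a = a [^] j" using c nat_pow_Suc[of a "j - 1"] j1 by (simp del: nat_pow_Suc add: nat_pow_Suc[symmetric])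
      then show ?thesis using c by (metis inv_solve_right nat_pow_closed)
    qed
    have "a [^] (k ^ (q ^ s) - 1) = \<one>" using sub1[of "k ^ (q ^ s)"] k0 fixed c by simp
    then have d: "p ^ e dvd k ^ (q ^ s) - 1" using e c pow_eq_id by simp
    have pk: "\<not> p dvd k"
    proof
      assume "p dvd k"
      moreover have "k dvd k ^ (q ^ s)"
        using prime_gt_0_nat[OF q(1)] by (intro dvd_power) (simp add: zero_less_power)
      ultimately have "p dvd k ^ (q ^ s)" using dvd_trans by blast
      moreover have "p dvd p ^ e" using False by (intro dvd_power) simp
      then have "p dvd k ^ (q ^ s) - 1" using d dvd_trans by blast
      moreover have "k ^ (q ^ s) \<ge> 1" using k0 by (rule one_le_power)
      ultimately have "p dvd 1" by (metis dvd_diffD1)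
      then show False using p by (simp add: prime_nat_iff)
    qed
    have cd: "cj x a \<otimes> inv a = a [^] (k - 1)" using sub1[OF k0] k by simp
    show ?thesis
    proof (cases "p dvd k - 1")
      case True
      have "\<not> p dvd q ^ s" using p q by (metis prime_dvd_power primes_dvd_imp_eq)
      then have "p ^ e dvd k - 1" using prime_power_dvd_pred[OF p True k0 d] by simp
      then have "a [^] (k - 1) = \<one>" using e c pow_eq_id by simp
      then have "cj x a = a" using cd c by (metis cj_closed inv_equality inv_inv inv_closed)
      then show ?thesis by blast
    next
      case np: False
      have "coprime (k - 1) (p ^ e)" using np p by (metis coprime_commute prime_imp_coprime coprime_power_right_iff)
      then obtain j where j: "[(k - 1) * j = 1] (mod (p ^ e))"
        using cong_solve_coprime_nat[of "k - 1" "p ^ e"] by auto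
      have "a [^] ((k - 1) * j) = a [^] (1::nat)"
      proof -
        have "[int ((k - 1) * j) = int 1] (mod int (ord a))" using j unfolding e cong_int_iff .
        then have "int (ord a) dvd int ((k - 1) * j) - 1" by (simp add: cong_iff_dvd_diff)
        then have "int (ord a) dvd int 1 - int ((k - 1) * j)" by (simp only: dvd_diff_commute of_nat_1)
        then have "a [^] (int ((k - 1) * j)) = a [^] int 1" using int_pow_eq[OF c(2)] by (simp del: of_nat_mult)
        then show ?thesis by (simp only: int_pow_int)
      qed
      then have "a = (cj x a \<otimes> inv a) [^] j" using cd c by (simp add: nat_pow_pow)
      moreover have "odd p"
      proof
        assume "even p"
        then have "p = 2" using p primes_dvd_imp_eq two_is_prime_nat by blast
        then show False using np pk k0 by simp
      qed
      ultimately show ?thesis by blast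
    qed
  qed
qed

section \<open>Coprime actions and commutators modulo a normal subgroup\<close>

context
  fixes R assumes R: "R \<lhd> G"
begin

lemma FactGroup_finite_group: "finite_group (G Mod R)"
proof -
  interpret N: normal R G by (rule R)
  show ?thesis
    by (intro finite_group.intro N.factorgroup_is_group finite_group_axioms.intro)
      (simp add: carrier_FactGroup)
qed

lemma rcos_eq_iff:
  assumes "x \<in> carrier G" "y \<in> carrier G"
  shows "R #> x = R #> y \<longleftrightarrow> x \<otimes> inv y \<in> R"
proof -
  interpret N: normal R G by (rule R)
  have "R #> x = R #> y \<longleftrightarrow> x \<in> R #> y"
    using rcos_self[OF assms(1) N.subgroup_axioms] repr_independence[OF _ assms(2) N.subgroup_axioms] by metis
  then show ?thesis using N.rcos_module[OF is_group assms(2,1)] by simp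
qed

lemma rcos_eq_self_iff: "x \<in> carrier G \<Longrightarrow> R #> x = R \<longleftrightarrow> x \<in> R"
  using rcos_eq_iff[of x \<one>] R by (simp add: normal_iff subgroup.subset)

lemma rcos_cj:
  assumes "x \<in> carrier G" "y \<in> carrier G"
  shows "group.cj (G Mod R) (R #> x) (R #> y) = R #> cj x y"
proof -
  interpret N: normal R G by (rule R)
  interpret Q: finite_group "G Mod R" by (rule FactGroup_finite_group)
  have "R #> x \<in> carrier (G Mod R)" using assms by (simp add: carrier_FactGroup)
  then show ?thesis using assms by (simp add: Q.cj_def cj_def N.inv_FactGroup N.rcos_inv N.rcos_sum)
qed

text \<open>Turns membership in \<open>adjoin R x\<close> into being a power in the quotient, the
  form in which the lemmas on cyclic actions can be applied to \<open>G Mod R\<close>.\<close>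

lemma rcos_adjoin:
  assumes "x \<in> carrier G" "y \<in> carrier G"
  shows "y \<in> adjoin R x \<longleftrightarrow> (\<exists>k::nat. R #> y = (R #> x) [^]\<^bsub>G Mod R\<^esub> k)"
proof -
  interpret N: normal R G by (rule R)
  have "y \<in> adjoin R x \<longleftrightarrow> (\<exists>k::nat. y \<otimes> inv (x [^] k) \<in> R)"
  proof
    assume "y \<in> adjoin R x"
    then obtain r k where "r \<in> R" "y = r \<otimes> x [^] (k::nat)" using mem_adjoin[OF assms(1)] by auto
    then have "y \<otimes> inv (x [^] k) = r" using assms N.mem_carrier by (simp add: m_assoc)
    then show "\<exists>k::nat. y \<otimes> inv (x [^] k) \<in> R" using \<open>r \<in> R\<close> by blast
  next
    assume "\<exists>k::nat. y \<otimes> inv (x [^] k) \<in> R"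
    then obtain k :: nat where "y \<otimes> inv (x [^] k) \<in> R" by blast
    moreover have "y = (y \<otimes> inv (x [^] k)) \<otimes> x [^] k" using assms by (simp add: m_assoc)
    ultimately show "y \<in> adjoin R x" using mem_adjoin[OF assms(1)] by blast
  qed
  then show ?thesis using assms by (simp add: rcos_eq_iff N.FactGroup_pow)
qed

lemma power_action_cases_mod:
  assumes p: "Factorial_Ring.prime p" and q: "Factorial_Ring.prime q" "p \<noteq> q"
    and x: "p_element q x" and a: "a \<in> carrier G" "a [^] (p ^ n) \<in> R" and m: "cj x a \<in> adjoin R a"
  shows "cj x a \<otimes> inv a \<in> R \<or> (odd p \<and> a \<in> adjoin R (cj x a \<otimes> inv a))"
proof -
  interpret N: normal R G by (rule R)
  interpret Q: finite_group "G Mod R" by (rule FactGroup_finite_group)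
  have xc: "x \<in> carrier G" using x p_element_carrier by blast
  have c: "R #> x \<in> carrier (G Mod R)" "R #> a \<in> carrier (G Mod R)"
    using xc a by (auto simp: carrier_FactGroup)
  obtain s :: nat where s: "x [^] (q ^ s) = \<one>" using x by (auto simp: p_element_def)
  have 1: "Q.p_element q (R #> x)"
  proof -
    have "(R #> x) [^]\<^bsub>G Mod R\<^esub> (q ^ s) = R" using xc s coset_mult_one[OF N.subset] N.FactGroup_pow by metis
    then show ?thesis unfolding Q.p_element_def one_FactGroup using c by blast
  qed
  have 2: "Q.p_element p (R #> a)"
  proof -
    have "(R #> a) [^]\<^bsub>G Mod R\<^esub> (p ^ n) = R" using a rcos_eq_self_iff[of "a [^] (p ^ n)"] N.FactGroup_pow by simp
    then show ?thesis unfolding Q.p_element_def one_FactGroup using c by blast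
  qed
  obtain k :: nat where "R #> cj x a = (R #> a) [^]\<^bsub>G Mod R\<^esub> k" using m rcos_adjoin[of a "cj x a"] a xc by auto
  then have k: "Q.cj (R #> x) (R #> a) = (R #> a) [^]\<^bsub>G Mod R\<^esub> k" using rcos_cj xc a by simp
  have e: "Q.cj (R #> x) (R #> a) \<otimes>\<^bsub>G Mod R\<^esub> inv\<^bsub>G Mod R\<^esub> (R #> a) = R #> (cj x a \<otimes> inv a)"
    using rcos_cj xc a c by (simp add: N.inv_FactGroup N.rcos_inv N.rcos_sum)
  consider "Q.cj (R #> x) (R #> a) = R #> a"
    | j :: nat where "odd p" "R #> a = (R #> (cj x a \<otimes> inv a)) [^]\<^bsub>G Mod R\<^esub> j"
    using Q.power_action_cases[OF p q 1 2 k] unfolding e by blast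
  then show ?thesis
  proof cases
    case 1
    then show ?thesis using rcos_cj[OF xc a(1)] rcos_eq_iff[of "cj x a" a] xc a by simp
  next
    case 2
    moreover have "cj x a \<otimes> inv a \<in> carrier G" using xc a by simp
    ultimately show ?thesis using rcos_adjoin[of "cj x a \<otimes> inv a" a] a(1) by blast
  qed
qed

text \<open>Automorphisms of a cyclic group commute, so every commutator fixes \<open>b\<close>
  modulo \<open>R\<close>. The elements that do so form a subgroup, which therefore contains the
  derived subgroup.\<close>

lemma derived_centralises_mod:
  assumes b: "b \<in> carrier G" and pw: "\<And>g. g \<in> carrier G \<Longrightarrow> cj g b \<in> adjoin R b"
    and c: "c \<in> derived G (carrier G)"
  shows "cj c b \<otimes> inv b \<in> R"
proof -
  interpret N: normal R G by (rule R)
  interpret Q: finite_group "G Mod R" by (rule FactGroup_finite_group)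
  have bc: "R #> b \<in> carrier (G Mod R)" using b by (simp add: carrier_FactGroup)
  have pwQ: "\<exists>k::nat. Q.cj y (R #> b) = (R #> b) [^]\<^bsub>G Mod R\<^esub> k" if yc: "y \<in> carrier (G Mod R)" for y
  proof -
    obtain g where g: "g \<in> carrier G" "y = R #> g" using yc by (auto simp: carrier_FactGroup)
    then show ?thesis using pw[OF g(1)] rcos_adjoin[of b "cj g b"] rcos_cj b by auto
  qed
  let ?C = "{c \<in> carrier G. R #> cj c b = R #> b}"
  have C: "subgroup ?C G"
  proof (rule subgroupI)
    show "a \<otimes> a' \<in> ?C" if "a \<in> ?C" "a' \<in> ?C" for a a'
    proof -
      have "cj (a \<otimes> a') b = cj a (cj a' b)" using that b by (simp add: cj_cj)
      also have "R #> \<dots> = Q.cj (R #> a) (R #> cj a' b)" by (rule rcos_cj[symmetric]) (use that b in auto)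
      also have "\<dots> = Q.cj (R #> a) (R #> b)" using that by simp
      also have "\<dots> = R #> b" using that b rcos_cj[of a b] by simp
      finally show ?thesis using that by simp
    qed
    show "inv a \<in> ?C" if "a \<in> ?C" for a
    proof -
      have "R #> cj (inv a) b = Q.cj (R #> inv a) (R #> b)" using that b by (simp add: rcos_cj)
      also have "\<dots> = Q.cj (R #> inv a) (R #> cj a b)" using that by simp
      also have "\<dots> = R #> b" using that b rcos_cj[of "inv a" "cj a b"] by simp
      finally show ?thesis using that by simp
    qed
  qed (use b in auto)
  have "derived G (carrier G) \<subseteq> ?C"
    unfolding derived_def
  proof (rule generate_subgroup_incl[OF _ C], clarsimp)
    fix g h assume gh: "g \<in> carrier G" "h \<in> carrier G"
    have m: "R #> g \<in> carrier (G Mod R)" "R #> h \<in> carrier (G Mod R)" using gh by (auto simp: carrier_FactGroup)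
    have "(R #> g) \<otimes>\<^bsub>G Mod R\<^esub> (R #> h) \<otimes>\<^bsub>G Mod R\<^esub> inv\<^bsub>G Mod R\<^esub> (R #> g) \<otimes>\<^bsub>G Mod R\<^esub> inv\<^bsub>G Mod R\<^esub> (R #> h) = R #> (g \<otimes> h \<otimes> inv g \<otimes> inv h)"
      using gh m by (simp add: N.inv_FactGroup N.rcos_inv N.rcos_sum)
    then show "R #> cj (g \<otimes> h \<otimes> inv g \<otimes> inv h) b = R #> b"
      using Q.commutator_fixes[OF bc pwQ m] gh b by (simp add: rcos_cj)
  qed
  then show ?thesis using c b rcos_eq_iff[of "cj c b" b] by auto
qed

end

section \<open>The conditions that are compared\<close>

definition normality_transitive :: bool where
  "normality_transitive \<longleftrightarrow>
     (\<forall>H L. L \<lhd> G \<longrightarrow> subgroup H G \<longrightarrow> H \<subseteq> L \<longrightarrow> normalises L H \<longrightarrow> H \<lhd> G)"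

text \<open>\<open>K\<close> takes the place of the core in a \<sigma>-primary step of a chain;
  together with \<open>normality_transitive\<close> this covers both kinds of steps.\<close>

definition sections_dedekind :: "'i set \<Rightarrow> ('i \<Rightarrow> nat set) \<Rightarrow> bool" where
  "sections_dedekind I \<sigma> \<longleftrightarrow>
     (\<forall>i\<in>I. \<forall>K H L. K \<lhd> G \<longrightarrow> L \<lhd> G \<longrightarrow> subgroup H G \<longrightarrow> K \<subseteq> H \<longrightarrow> H \<subseteq> L \<longrightarrow>
        pi_number (\<sigma> i) (index L K) \<longrightarrow> H \<lhd> G)"

text \<open>The fourth condition of the overview. Its last clause is restricted to elements of prime
  power order, the form in which conjugates are examined; \<open>p_elements_commute\<close> recovers
  the statement for subgroups.\<close>

definition power_structure :: "'i set \<Rightarrow> ('i \<Rightarrow> nat set) \<Rightarrow> 'a set \<Rightarrow> bool" where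
  "power_structure I \<sigma> D \<longleftrightarrow>
     D \<lhd> G \<and> (\<forall>x\<in>D. \<forall>y\<in>D. x \<otimes> y = y \<otimes> x) \<and> coprime (card D) (index (carrier G) D) \<and>
     (\<forall>Y. subgroup Y G \<longrightarrow> D \<subseteq> Y \<longrightarrow> Y \<lhd> G) \<and> (\<forall>Y. subgroup Y G \<longrightarrow> Y \<subseteq> D \<longrightarrow> Y \<lhd> G) \<and>
     (\<forall>i\<in>I. \<forall>p\<in>\<sigma> i. \<forall>q\<in>\<sigma> i. \<forall>d\<in>D. \<forall>x.
        p_element p d \<longrightarrow> p_element q x \<longrightarrow> d \<otimes> x = x \<otimes> d)"

lemma p_element_trivial:
  assumes "subgroup H G" "x \<in> H" "p_element p x" "Factorial_Ring.prime p" "\<not> p dvd card H"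
  shows "x = \<one>"
  using p_element_mem[OF assms(1) triv_subgroup _ _ assms(2,3,4)] assms subgroup.one_closed[OF assms(1)]
    normalises_one[OF subgroup.subset[OF assms(1)]] by auto

section \<open>Consequences of the power structure\<close>

context
  fixes I :: "'i set" and \<sigma> D
  assumes ps: "power_structure I \<sigma> D"
begin

abbreviation (input) cent :: "'a \<Rightarrow> 'a set" where
  "cent h \<equiv> {c \<in> D. c \<otimes> h = h \<otimes> c}"

lemma
  shows D_normal: "D \<lhd> G" and D_comm: "\<lbrakk>x \<in> D; y \<in> D\<rbrakk> \<Longrightarrow> x \<otimes> y = y \<otimes> x"
    and D_coprime: "coprime (card D) (index (carrier G) D)"
    and above_D: "\<lbrakk>subgroup Y G; D \<subseteq> Y\<rbrakk> \<Longrightarrow> Y \<lhd> G"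
    and below_D: "\<lbrakk>subgroup Y G; Y \<subseteq> D\<rbrakk> \<Longrightarrow> Y \<lhd> G"
    and D_commute: "\<lbrakk>i \<in> I; p \<in> \<sigma> i; q \<in> \<sigma> i; d \<in> D; p_element p d; p_element q x\<rbrakk> \<Longrightarrow> d \<otimes> x = x \<otimes> d"
  using ps unfolding power_structure_def by blast+

lemma D_sub: "subgroup D G" using D_normal by (simp add: normal_iff)

lemma D_carrier: "D \<subseteq> carrier G" using D_sub subgroup.subset by auto

lemma cent_subgroup:
  assumes "h \<in> carrier G" shows "subgroup (cent h) G"
proof (rule subgroupI)
  have c: "a \<in> carrier G" if "a \<in> D" for a using that D_carrier by auto
  show "inv a \<in> cent h" if "a \<in> cent h" for a
  proof -
    have "cj a h = h" using that c assms by (simp add: cj_commute)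
    then have "cj (inv a) h = h" using that c assms by (metis (mono_tags, lifting) cj_cancel(2) mem_Collect_eq)
    then show ?thesis using that c assms D_sub by (simp add: cj_commute subgroup.m_inv_closed)
  qed
  show "a \<otimes> b \<in> cent h" if "a \<in> cent h" "b \<in> cent h" for a b
  proof -
    have "cj a h = h" "cj b h = h" using that c assms by (auto simp: cj_commute)
    then have "cj (a \<otimes> b) h = h" using that c assms by (simp add: cj_cj[symmetric])
    then show ?thesis using that c assms D_sub by (simp add: cj_commute subgroup.m_closed)
  qed
qed (use assms D_carrier subgroup.one_closed[OF D_sub] in auto)

text \<open>The factor \<open>c\<close> of \<open>d\<close> in \<open>cent h\<close> commutes with
  \<open>h\<close>. Raising \<open>cj g h\<close> to a power \<open>q ^ n\<close> that kills
  \<open>h\<close> shows that \<open>c [^] (q ^ n)\<close> lies in \<open>U\<close>; since the order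
  of \<open>c\<close> is prime to \<open>q\<close>, \<open>c\<close> lies in \<open>U\<close> as
  well.\<close>

lemma central_part_mem:
  assumes h: "p_element q h" "Factorial_Ring.prime q" "\<not> q dvd card D" and g: "g \<in> carrier G"
    and eq: "cj g h = d \<otimes> h [^] (m::nat)"
    and U: "subgroup U G" "U \<subseteq> D" and d: "d \<in> U <#> cent h"
  shows "d \<in> U"
proof -
  have hc: "h \<in> carrier G" using h p_element_carrier by blast
  obtain e c where ec: "e \<in> U" "c \<in> cent h" "d = e \<otimes> c" using d by (auto simp: set_mult_def)
  have c: "e \<in> carrier G" "c \<in> carrier G" "c \<otimes> h = h \<otimes> c" using ec U D_carrier by auto
  obtain n :: nat where n: "h [^] (q ^ n) = \<one>" using h by (auto simp: p_element_def)
  let ?x = "c \<otimes> h [^] m"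
  have un: "normalises {?x} U" using below_D[OF U] c hc normalises_mono by (auto simp: normal_iff normalises_def)
  have com: "c \<otimes> h [^] m = h [^] m \<otimes> c" using group_commutes_pow[of h c m] c hc by simp
  obtain e' where e': "e' \<in> U" "(e \<otimes> ?x) [^] (q ^ n) = e' \<otimes> ?x [^] (q ^ n)"
    using pow_mod_normalised[OF U(1) _ un finite_carrier ec(1), of "q ^ n"] c hc by auto
  have e'c: "e' \<in> carrier G" using e' U(1) subgroup.mem_carrier by metis
  have "(cj g h) [^] (q ^ n) = \<one>" using n hc g by (metis cj_pow cj_one(1))
  moreover have "cj g h = e \<otimes> ?x" using eq ec c hc by (simp add: m_assoc)
  moreover have "?x [^] (q ^ n) = c [^] (q ^ n)"
  proof -
    have "(h [^] m) [^] (q ^ n) = (h [^] (q ^ n)) [^] m" using hc by (simp add: nat_pow_pow mult.commute)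
    then have "(h [^] m) [^] (q ^ n) = \<one>" using n by simp
    then show ?thesis using pow_mult_distrib[OF com, of "q ^ n"] c hc by simp
  qed
  ultimately have "e' \<otimes> c [^] (q ^ n) = \<one>" using e' by simp
  then have "c [^] (q ^ n) = inv e'" using c e'c by (metis inv_equality inv_inv inv_closed nat_pow_closed)
  then have 1: "c [^] (q ^ n) \<in> U" using e' U by (simp add: subgroup.m_inv_closed)
  have "c [^] card D \<in> {\<one>}"
    using pow_index_mem[OF D_sub triv_subgroup _ normalises_one[OF D_carrier], of c] ec
      subgroup.one_closed[OF D_sub] by auto
  then have 2: "c [^] card D \<in> U" using subgroup.one_closed[OF U(1)] by simp
  have "coprime (q ^ n) (card D)" using h by (simp add: prime_imp_coprime)
  then have "c \<in> U" using coprime_pow_mem[OF U(1) c(2) 1 2] by simp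
  then show ?thesis using ec U by (simp add: subgroup.m_closed)
qed

text \<open>The common step of the three main results on the power structure. If \<open>q\<close>
  divides \<open>card D\<close>, then \<open>h\<close> lies in \<open>D\<close> and generates a
  normal subgroup. Otherwise \<open>adjoin D h\<close> is normal, so
  \<open>cj g h = d \<otimes> h [^] m\<close>, and \<open>central_part_mem\<close> with
  \<open>U = H \<inter> D\<close> leaves only the primary parts of \<open>d\<close>, which
  \<open>parts\<close> takes care of.\<close>

lemma cj_p_element_mem:
  assumes h: "p_element q h" "Factorial_Ring.prime q" "h \<in> H" and H: "subgroup H G" and g: "g \<in> carrier G"
    and parts: "\<And>p d e m. \<lbrakk>\<not> q dvd card D; cj g h = d \<otimes> h [^] (m::nat); d \<in> D; Factorial_Ring.prime p;
        p_element p (d [^] (e::nat))\<rbrakk> \<Longrightarrow> d [^] e \<in> (H \<inter> D) <#> cent h"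
  shows "cj g h \<in> H"
proof (cases "q dvd card D")
  case True
  have hc: "h \<in> carrier G" using h p_element_carrier by blast
  have "\<not> q dvd index (carrier G) D"
    using True D_coprime h coprime_common_divisor_nat not_prime_1 by metis
  then have "h \<in> D"
    using p_element_mem[OF subgroup_self D_sub D_carrier _ hc h(1,2)] D_normal by (simp add: normal_iff)
  then have "generate G {h} \<lhd> G"
    using below_D[of "generate G {h}"] generate_is_subgroup[of "{h}"] generate_subgroup_incl[of "{h}" D] D_sub hc by auto
  then have "cj g h \<in> generate G {h}" using g generate.incl[of h "{h}" G] by (auto simp: normal_iff normalises_def)
  then show ?thesis using generate_subgroup_incl[of "{h}" H] H h by auto
next
  case False
  have hc: "h \<in> carrier G" using h p_element_carrier by blast
  have Dn: "normalises {h} D" using D_normal hc normalises_mono[of "carrier G" D "{h}"] by (auto simp: normal_iff)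
  have s: "subgroup (adjoin D h) G" by (rule adjoin_subgroup[OF D_sub hc Dn])
  then have "adjoin D h \<lhd> G" using above_D subset_adjoin[OF D_sub hc] by blast
  then have "cj g h \<in> adjoin D h" using g subset_adjoin[OF D_sub hc] by (auto simp: normal_iff normalises_def)
  then obtain d m where d: "d \<in> D" "cj g h = d \<otimes> h [^] (m::nat)" using mem_adjoin[OF hc] by auto
  have HD: "subgroup (H \<inter> D) G" "H \<inter> D \<subseteq> D" using subgroups_Inter_pair[OF H D_sub] by auto
  have "subgroup ((H \<inter> D) <#> cent h) G"
    using below_D[OF HD] D_carrier
    by (intro set_mult_subgroup[OF HD(1) cent_subgroup[OF hc]]) (auto simp: normal_iff normalises_def)
  then have "d \<in> (H \<inter> D) <#> cent h"
    using prime_parts_mem[of _ d] parts[OF False d(2,1)] d D_carrier by blast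
  then have "d \<in> H \<inter> D" using central_part_mem[OF h(1,2) False g d(2) HD] by blast
  then show ?thesis using d h H by (simp add: subgroup.m_closed pow_in_subgroup)
qed

lemma cent_mem:
  assumes "subgroup H G" "h \<in> carrier G" "x \<in> cent h" shows "x \<in> (H \<inter> D) <#> cent h"
  using subset_set_mult(2)[OF subgroups_Inter_pair[OF assms(1) D_sub] cent_subgroup[OF assms(2)]] assms by blast

lemma Int_mem:
  assumes "subgroup H G" "h \<in> carrier G" "x \<in> H \<inter> D" shows "x \<in> (H \<inter> D) <#> cent h"
  using subset_set_mult(1)[OF subgroups_Inter_pair[OF assms(1) D_sub] cent_subgroup[OF assms(2)]] assms by blast

lemma power_structure_normality_transitive: "normality_transitive"
  unfolding normality_transitive_def
proof (intro allI impI)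
  fix H L assume L: "L \<lhd> G" and H: "subgroup H G" "H \<subseteq> L" "normalises L H"
  have Ls: "subgroup L G" "normalises (carrier G) L" using L by (auto simp: normal_iff)
  have "normalises (carrier G) H"
  proof (rule normalises_of_p_elements[OF H(1) order_refl])
    fix q h g assume h: "Factorial_Ring.prime q" "p_element q h" "h \<in> H" and g: "g \<in> carrier G"
    have hc: "h \<in> carrier G" using h p_element_carrier by blast
    show "cj g h \<in> H"
    proof (rule cj_p_element_mem[OF h(2,1,3) H(1) g])
      fix p d e m assume *: "\<not> q dvd card D" "cj g h = d \<otimes> h [^] (m::nat)" "d \<in> D" "Factorial_Ring.prime p"
        "p_element p (d [^] (e::nat))"
      let ?a = "d [^] e"
      have dc: "d \<in> carrier G" using * D_carrier by auto
      have aD: "?a \<in> D" using * D_sub pow_in_subgroup by blast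
      have ac: "?a \<in> carrier G" using dc by simp
      have "d = cj g h \<otimes> inv (h [^] m)" using * hc dc by (simp add: m_assoc)
      moreover have "cj g h \<in> L" "h [^] m \<in> L" using Ls g h H by (auto simp: normalises_def intro: pow_in_subgroup)
      ultimately have "d \<in> L" using Ls by (simp add: subgroup.m_closed subgroup.m_inv_closed)
      then have aL: "?a \<in> L" using Ls pow_in_subgroup by blast
      \<comment> \<open>If the primes agree, \<open>?a\<close> is trivial because \<open>q\<close>
        does not divide \<open>card D\<close>. If they differ, \<open>h\<close> acts on the cyclic
        normal subgroup of \<open>?a\<close> by a power, and the dichotomy for coprime actions
        applies.\<close>
      show "?a \<in> (H \<inter> D) <#> cent h"
      proof (cases "p = q")
        case True
        then have "?a = \<one>" using p_element_trivial[OF D_sub aD] * by blast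
        then show ?thesis using Int_mem[OF H(1) hc, of ?a] subgroup.one_closed H D_sub by auto
      next
        case False
        have "generate G {?a} \<lhd> G"
          using below_D[of "generate G {?a}"] generate_is_subgroup[of "{?a}"] generate_subgroup_incl[of "{?a}" D] D_sub aD ac by auto
        then have "cj h ?a \<in> generate G {?a}" using hc generate.incl[of ?a "{?a}" G] by (auto simp: normal_iff normalises_def)
        then obtain k :: nat where "cj h ?a = ?a [^] k"
          using generate_pow_on_finite_carrier[OF finite_carrier ac] by auto
        then consider "cj h ?a = ?a" | j :: nat where "?a = (cj h ?a \<otimes> inv ?a) [^] j"
          using power_action_cases[OF *(4) h(1) False h(2) *(5)] by blast
        then show ?thesis
        proof cases
          case 1
          then have "?a \<otimes> h = h \<otimes> ?a" using cj_commute[OF hc ac] by simp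
          then show ?thesis using cent_mem[OF H(1) hc] aD by simp
        next
          case 2
          \<comment> \<open>\<open>?a\<close> lies in \<open>L\<close> and hence normalises
            \<open>H\<close>, so the commutator is a product of two elements of \<open>H\<close>,
            and \<open>?a\<close> is a power of it.\<close>
          have "cj h ?a \<otimes> inv ?a = h \<otimes> cj ?a (inv h)" using hc ac by (simp add: cj_def m_assoc)
          moreover have "cj ?a (inv h) \<in> H" using aL H h by (auto simp: normalises_def subgroup.m_inv_closed)
          ultimately have "cj h ?a \<otimes> inv ?a \<in> H" using h H by (simp add: subgroup.m_closed)
          then have "?a \<in> H" using 2 H(1) pow_in_subgroup by metis
          then show ?thesis using Int_mem[OF H(1) hc] aD by simp
        qed
      qed
    qed
  qed
  then show "H \<lhd> G" using H by (simp add: normal_iff)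
qed

lemma power_structure_sections_dedekind: "sections_dedekind I \<sigma>"
  unfolding sections_dedekind_def
proof (intro ballI allI impI)
  fix i K H L assume i: "i \<in> I" and K: "K \<lhd> G" and L: "L \<lhd> G" and H: "subgroup H G" "K \<subseteq> H" "H \<subseteq> L"
    and idx: "pi_number (\<sigma> i) (index L K)"
  have Ls: "subgroup L G" "normalises (carrier G) L" and Ks: "subgroup K G" "normalises (carrier G) K"
    using L K by (auto simp: normal_iff)
  have KL: "K \<subseteq> L" "normalises L K" using H Ks normalises_mono subgroup.subset[OF Ls(1)] by auto
  have inK: "y \<in> K" if "y \<in> L" "p_element p y" "Factorial_Ring.prime p" "p \<notin> \<sigma> i" for p y
    using p_element_mem[OF Ls(1) Ks(1) KL that(1,2,3)] that idx by (auto simp: pi_number_def)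
  have "normalises (carrier G) H"
  proof (rule normalises_of_p_elements[OF H(1) order_refl])
    fix q h g assume h: "Factorial_Ring.prime q" "p_element q h" "h \<in> H" and g: "g \<in> carrier G"
    have hc: "h \<in> carrier G" using h p_element_carrier by blast
    show "cj g h \<in> H"
    proof (cases "q \<in> \<sigma> i")
      case False
      then have "h \<in> K" using inK h H by blast
      then show ?thesis using Ks g H by (auto simp: normalises_def)
    next
      case True
      show ?thesis
      proof (rule cj_p_element_mem[OF h(2,1,3) H(1) g])
        fix p d e m assume *: "\<not> q dvd card D" "cj g h = d \<otimes> h [^] (m::nat)" "d \<in> D" "Factorial_Ring.prime p"
          "p_element p (d [^] (e::nat))"
        let ?a = "d [^] e"
        have dc: "d \<in> carrier G" using * D_carrier by auto
        have aD: "?a \<in> D" using * D_sub pow_in_subgroup by blast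
        have "d = cj g h \<otimes> inv (h [^] m)" using * hc dc by (simp add: m_assoc)
        moreover have "cj g h \<in> L" "h [^] m \<in> L" using Ls g h H by (auto simp: normalises_def intro: pow_in_subgroup)
        ultimately have "d \<in> L" using Ls by (simp add: subgroup.m_closed subgroup.m_inv_closed)
        then have aL: "?a \<in> L" using Ls pow_in_subgroup by blast
        show "?a \<in> (H \<inter> D) <#> cent h"
        proof (cases "p \<in> \<sigma> i")
          case True
          then have "?a \<otimes> h = h \<otimes> ?a" using D_commute[OF i True \<open>q \<in> \<sigma> i\<close> aD *(5) h(2)] by simp
          then show ?thesis using cent_mem[OF H(1) hc] aD by simp
        next
          case False
          then show ?thesis using inK[OF aL *(5,4)] H Int_mem[OF H(1) hc] aD by blast
        qed
      qed
    qed
  qed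
  then show "H \<lhd> G" using H by (simp add: normal_iff)
qed

text \<open>Since \<open>g\<close> normalises \<open>H\<close>, the factor \<open>d\<close> lies in
  \<open>H\<close>. Nontrivial primary parts of elements of \<open>H\<close> belong to primes of
  \<open>\<sigma> i\<close>, so here they all commute with \<open>h\<close>.\<close>

lemma power_structure_normalizer:
  assumes i: "i \<in> I" and H: "subgroup H G" "pi_number (\<sigma> i) (card H)" and K: "subgroup K G" "K \<subseteq> H"
  shows "normalises (normalizer G H) K"
proof (rule normalises_of_p_elements[OF K(1)])
  show "normalizer G H \<subseteq> carrier G" using mem_normalizer[OF H(1)] by auto
  have inS: "p \<in> \<sigma> i \<or> y = \<one>" if "y \<in> H" "p_element p y" "Factorial_Ring.prime p" for p y
    using p_element_trivial[OF H(1) that] H(2) that by (auto simp: pi_number_def)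
  fix q h g assume h: "Factorial_Ring.prime q" "p_element q h" "h \<in> K" and g: "g \<in> normalizer G H"
  have hc: "h \<in> carrier G" using h p_element_carrier by blast
  have gc: "g \<in> carrier G" and gH: "cj g h \<in> H" using g h K mem_normalizer[OF H(1)] by (auto simp: normalises_def)
  show "cj g h \<in> K"
  proof (rule cj_p_element_mem[OF h(2,1,3) K(1) gc])
    fix p d e m assume *: "\<not> q dvd card D" "cj g h = d \<otimes> h [^] (m::nat)" "d \<in> D" "Factorial_Ring.prime p"
      "p_element p (d [^] (e::nat))"
    let ?a = "d [^] e"
    have dc: "d \<in> carrier G" using * D_carrier by auto
    have aD: "?a \<in> D" using * D_sub pow_in_subgroup by blast
    have "d = cj g h \<otimes> inv (h [^] m)" using * hc dc by (simp add: m_assoc)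
    moreover have "h [^] m \<in> H" using H h K by (auto intro: pow_in_subgroup)
    ultimately have "d \<in> H" using H gH by (simp add: subgroup.m_closed subgroup.m_inv_closed)
    then have aH: "?a \<in> H" using H pow_in_subgroup by blast
    have "?a \<otimes> h = h \<otimes> ?a"
    proof (cases "?a = \<one> \<or> h = \<one>")
      case False
      then have "p \<in> \<sigma> i" "q \<in> \<sigma> i" using inS[OF aH *(5,4)] inS[OF _ h(2,1)] h K by auto
      then show ?thesis using D_commute[OF i _ _ aD *(5) h(2)] by simp
    qed (use hc dc in auto)
    then show "?a \<in> (K \<inter> D) <#> cent h" using cent_mem[OF K(1) hc] aD by simp
  qed
qed

end

end

section \<open>From transitivity of normality to the residual\<close>

lemma pi_number_singleton:
  assumes "pi_number {p} m" "m > 0" "Factorial_Ring.prime p"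
  obtains n where "m = p ^ n"
proof -
  obtain b where b: "m = p ^ multiplicity p m * b" "\<not> p dvd b"
    using multiplicity_decompose'[of m p] assms by (metis neq0_conv not_prime_unit)
  have "b = 1"
  proof (rule ccontr)
    assume "b \<noteq> 1"
    then obtain q where q: "Factorial_Ring.prime q" "q dvd b" using prime_factor_nat by blast
    then have "q dvd m" using b(1) by (metis dvd_mult)
    then have "q = p" using assms(1) q by (auto simp: pi_number_def)
    then show False using q b by simp
  qed
  then show thesis using b that by simp
qed

lemma prime_partition_memE:
  assumes "prime_partition I \<sigma>" "Factorial_Ring.prime p"
  obtains i where "i \<in> I" "p \<in> \<sigma> i"
  using assms unfolding prime_partition_def by blast

lemma prime_partition_prime:
  "\<lbrakk>prime_partition I \<sigma>; i \<in> I; p \<in> \<sigma> i\<rbrakk> \<Longrightarrow> Factorial_Ring.prime p"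
  unfolding prime_partition_def by blast

context finite_group
begin

lemma commutator_mem_derived:
  assumes "g \<in> carrier G" "h \<in> carrier G"
  shows "cj g h \<otimes> inv h \<in> derived G (carrier G)"
  unfolding derived_def cj_def using assms by (intro generate.incl) blast

lemma inv_cj_mult_inv:
  assumes "x \<in> carrier G" "y \<in> carrier G"
  shows "inv (cj x y \<otimes> inv y) = cj y x \<otimes> inv x"
  using assms by (simp add: cj_def inv_mult_group m_assoc)

lemma cj_eq_mult:
  assumes "x \<in> carrier G" "y \<in> carrier G"
  shows "cj x y = (cj x y \<otimes> inv y) \<otimes> y"
  using assms by (simp add: m_assoc)

lemma adjoin_one: "x \<in> carrier G \<Longrightarrow> adjoin {\<one>} x = generate G {x}"
  using generate_incl[of "{x}"] by (force simp: adjoin_def set_mult_def)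

section \<open>Subgroups of the derived subgroup\<close>

context
  fixes I :: "'i set" and \<sigma>
  assumes T1: "normality_transitive" and T2: "sections_dedekind I \<sigma>" and part: "prime_partition I \<sigma>"
    and sol: "\<And>N. \<lbrakk>N \<lhd> G; N \<noteq> {\<one>}\<rbrakk> \<Longrightarrow> \<exists>K i. i \<in> I \<and> K \<lhd> G \<and> K \<subset> N \<and> pi_number (\<sigma> i) (index N K)"
begin

text \<open>\<open>M\<close> is maximal among the proper subgroups of \<open>N\<close> above
  \<open>K\<close>; it is normal because \<open>index N K\<close> is a
  \<open>\<sigma> i\<close>-number. By maximality \<open>N/M\<close> is generated by any element
  outside \<open>M\<close>, and the derived subgroup centralises normal cyclic sections.\<close>

lemma normal_descent:
  assumes N: "N \<lhd> G" "N \<noteq> {\<one>}"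
  obtains M where "M \<lhd> G" "M \<subset> N"
    "\<And>b c. \<lbrakk>b \<in> N; c \<in> derived G (carrier G)\<rbrakk> \<Longrightarrow> cj c b \<otimes> inv b \<in> M"
proof -
  obtain K i where K: "i \<in> I" "K \<lhd> G" "K \<subset> N" "pi_number (\<sigma> i) (index N K)" using sol[OF N] by blast
  have Ns: "subgroup N G" "normalises (carrier G) N" and Ks: "subgroup K G" using N K by (auto simp: normal_iff)
  let ?P = "\<lambda>M. subgroup M G \<and> K \<subseteq> M \<and> M \<subset> N"
  have PK: "?P K" using Ks K by blast
  have PN: "M \<subseteq> N" if "?P M" for M using that by blast
  obtain M where M': "?P M" and max: "\<And>B. ?P B \<Longrightarrow> card B \<le> card M"
    using exists_max_card[where P = ?P, OF finite_subgroup[OF Ns(1)] PK PN] by blast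
  then have M: "subgroup M G" "K \<subseteq> M" "M \<subset> N" by auto
  have Mn: "M \<lhd> G" using T2 K M N(1) unfolding sections_dedekind_def by blast
  then have Mn': "normalises (carrier G) M" by (simp add: normal_iff)
  have "cj c b \<otimes> inv b \<in> M" if b: "b \<in> N" and c: "c \<in> derived G (carrier G)" for b c
  proof (cases "b \<in> M")
    case True
    have "c \<in> carrier G" using c derived_in_carrier[of "carrier G"] by auto
    then show ?thesis using True M Mn' by (auto simp: normalises_def subgroup.m_closed subgroup.m_inv_closed)
  next
    case False
    have bc: "b \<in> carrier G" using b Ns subgroup.mem_carrier by metis
    have nb: "normalises {b} M" using Mn' bc by (auto simp: normalises_def)
    have s: "subgroup (adjoin M b) G" by (rule adjoin_subgroup[OF M(1) bc nb])
    have le: "M \<subseteq> adjoin M b" "b \<in> adjoin M b" using subset_adjoin[OF M(1) bc] by auto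
    have sub: "adjoin M b \<subseteq> N" using adjoin_least[OF Ns(1) _ b] M by blast
    have "card M < card (adjoin M b)" using le False s by (intro psubset_card_mono) auto
    moreover have "card (adjoin M b) \<le> card M" if "adjoin M b \<noteq> N"
      using max[of "adjoin M b"] s le(1) sub M(2) that by blast
    ultimately have eq: "adjoin M b = N" by fastforce
    show ?thesis
      using derived_centralises_mod[OF Mn bc _ c] Ns b eq by (auto simp: normalises_def)
  qed
  then show thesis using that Mn M by blast
qed

text \<open>Descent along \<open>normal_descent\<close>: the product of
  \<open>N \<inter> derived G (carrier G)\<close> and \<open>H\<close> is the derived subgroup for
  \<open>N = carrier G\<close> and is \<open>H\<close> itself for \<open>N = {\<one>}\<close>.
  Choosing \<open>N\<close> of least order with a normal product forces the second case.\<close>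

lemma subgroup_derived_normal:
  assumes H: "subgroup H G" "H \<subseteq> derived G (carrier G)"
  shows "H \<lhd> G"
proof -
  let ?D = "derived G (carrier G)"
  let ?P = "\<lambda>N. N \<lhd> G \<and> (N \<inter> ?D) <#> H \<lhd> G"
  have D: "?D \<lhd> G" by (rule derived_self_is_normal)
  then have Ds: "subgroup ?D G" "?D \<subseteq> carrier G" by (auto simp: normal_iff subgroup.subset)
  have Hc: "H \<subseteq> carrier G" using H Ds by auto
  have "?D <#> H = ?D" using set_mult_least[OF Ds(1) order_refl H(2)] subset_set_mult[OF Ds(1) H(1)] by blast
  then have "?P (carrier G)" using D Ds normal_self by (simp add: Int_absorb1)
  then obtain N where N: "?P N" and least: "\<And>M. ?P M \<Longrightarrow> card N \<le> card M"
    using ex_has_least_nat[of ?P "carrier G" card] by blast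
  have "N = {\<one>}"
  proof (rule ccontr)
    assume "N \<noteq> {\<one>}"
    then obtain M where M: "M \<lhd> G" "M \<subset> N" and cm: "\<And>b c. \<lbrakk>b \<in> N; c \<in> ?D\<rbrakk> \<Longrightarrow> cj c b \<otimes> inv b \<in> M"
      using normal_descent N by metis
    let ?A = "N \<inter> ?D" and ?B = "M \<inter> ?D"
    have A: "?A \<lhd> G" and B: "?B \<lhd> G" using N M D normal_Int by auto
    then have As: "subgroup ?A G" "normalises (carrier G) ?A" and Bs: "subgroup ?B G" "normalises (carrier G) ?B"
      by (auto simp: normal_iff)
    have nB: "normalises Y ?B" and nA: "normalises Y ?A" if "Y \<subseteq> carrier G" for Y
      using As Bs that normalises_mono by auto
    have X: "subgroup (?B <#> H) G" by (rule set_mult_subgroup[OF Bs(1) H(1) nB[OF Hc]])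
    have BX: "?B \<subseteq> ?B <#> H" "H \<subseteq> ?B <#> H" using subset_set_mult[OF Bs(1) H(1)] by auto
    \<comment> \<open>\<open>H\<close> lies in the derived subgroup, so it centralises
      \<open>?A\<close> modulo \<open>M\<close> and hence modulo \<open>?B\<close>. Thus
      \<open>?A\<close> normalises the smaller product, and transitivity will apply inside the
      larger one.\<close>
    have 1: "normalises ?A (?B <#> H)"
      unfolding normalises_def
    proof (intro ballI)
      fix a z assume a: "a \<in> ?A" and "z \<in> ?B <#> H"
      then obtain b h where z: "b \<in> ?B" "h \<in> H" "z = b \<otimes> h" by (auto simp: set_mult_def)
      have c: "a \<in> carrier G" "h \<in> carrier G" "b \<in> carrier G" using a z Ds Hc by auto
      have "cj h a \<otimes> inv a \<in> M" using cm a z H by auto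
      moreover have "cj h a \<otimes> inv a \<in> ?D" using commutator_mem_derived c by blast
      ultimately have "inv (cj h a \<otimes> inv a) \<in> ?B" using subgroup.m_inv_closed[OF Bs(1)] by blast
      then have "cj a h \<otimes> inv h \<in> ?B" using inv_cj_mult_inv c by simp
      then have "cj a h \<in> ?B <#> H" using cj_eq_mult[of a h] c z unfolding set_mult_def by blast
      moreover have "cj a b \<in> ?B <#> H" using Bs z c BX by (auto simp: normalises_def)
      ultimately show "cj a z \<in> ?B <#> H" using z c X by (simp add: cj_mult subgroup.m_closed)
    qed
    have 2: "normalises H (?B <#> H)" using normalises_mono[OF normalises_self[OF X] BX(2)] .
    have "normalises (?A <#> H) (?B <#> H)"
      by (rule normalises_set_multI[OF X As(1) H(1) nA[OF Hc] 1 2])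
    moreover have "?B <#> H \<subseteq> ?A <#> H" using M by (intro mono_set_mult) auto
    ultimately have "?B <#> H \<lhd> G" using T1 N X unfolding normality_transitive_def by blast
    then have "card N \<le> card M" using least M by blast
    moreover have "card M < card N" using M N by (intro psubset_card_mono) (auto simp: normal_iff)
    ultimately show False by simp
  qed
  moreover have "\<one> \<in> ?D" using subgroup.one_closed[OF Ds(1)] .
  ultimately have "{\<one>} <#> H \<lhd> G" using N by (simp add: Int_absorb2)
  moreover have "{\<one>} <#> H = H" using Hc by (force simp: set_mult_def)
  ultimately show ?thesis by simp
qed

section \<open>Structure of the residual\<close>

context
  fixes D
  assumes D: "D \<lhd> G" and above: "\<And>Y. \<lbrakk>subgroup Y G; D \<subseteq> Y\<rbrakk> \<Longrightarrow> Y \<lhd> G"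
    and min: "\<And>N. \<lbrakk>N \<lhd> G; \<And>Y. \<lbrakk>subgroup Y G; N \<subseteq> Y\<rbrakk> \<Longrightarrow> Y \<lhd> G\<rbrakk> \<Longrightarrow> D \<subseteq> N"
begin

text \<open>A subgroup above the derived subgroup is normal, since \<open>cj g y\<close> differs
  from \<open>y\<close> by a commutator; so minimality of \<open>D\<close> applies.\<close>

lemma residual_subset_derived: "D \<subseteq> derived G (carrier G)"
proof (rule min[OF derived_self_is_normal])
  fix Y assume Y: "subgroup Y G" "derived G (carrier G) \<subseteq> Y"
  have "cj g y \<in> Y" if "g \<in> carrier G" "y \<in> Y" for g y
    using cj_eq_mult[of g y] commutator_mem_derived[of g y] that Y subgroup.mem_carrier[OF Y(1)]
      subgroup.m_closed[OF Y(1)] by (metis subsetD)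
  then show "Y \<lhd> G" using Y by (auto simp: normal_iff normalises_def)
qed

lemma residual_sub: "subgroup D G" "normalises (carrier G) D" "D \<subseteq> carrier G"
  using D subgroup.subset by (auto simp: normal_iff)

lemma below_residual: "\<lbrakk>subgroup Y G; Y \<subseteq> D\<rbrakk> \<Longrightarrow> Y \<lhd> G"
  using subgroup_derived_normal residual_subset_derived by blast

lemma cyclic_below_residual:
  assumes "d \<in> D" shows "generate G {d} \<lhd> G" "generate G {d} \<subseteq> D" "d \<in> generate G {d}"
proof -
  show 1: "generate G {d} \<subseteq> D" using generate_subgroup_incl[of "{d}" D] residual_sub assms by auto
  show "generate G {d} \<lhd> G" using below_residual[OF _ 1] generate_is_subgroup[of "{d}"] residual_sub assms by auto
  show "d \<in> generate G {d}" by (simp add: generate.incl)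
qed

text \<open>The cyclic subgroup of \<open>y\<close> is normal, so it is centralised by the derived
  subgroup, to which \<open>x\<close> belongs.\<close>

lemma residual_comm:
  assumes "x \<in> D" "y \<in> D" shows "x \<otimes> y = y \<otimes> x"
proof -
  have c: "x \<in> carrier G" "y \<in> carrier G" using assms residual_sub by auto
  have "cj g y \<in> adjoin {\<one>} y" if "g \<in> carrier G" for g
    using cyclic_below_residual[OF assms(2)] that c by (auto simp: adjoin_one normal_iff normalises_def)
  then have "cj x y \<otimes> inv y \<in> {\<one>}"
    using derived_centralises_mod[OF one_is_normal c(2)] assms residual_subset_derived by blast
  then have "cj x y = y" using cj_eq_mult[of x y] c by simp
  then show ?thesis using cj_commute c by simp
qed

lemma residual_prime_complement:
  assumes p: "Factorial_Ring.prime p"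
  obtains R where "R \<lhd> G" "R \<subseteq> D" "\<not> p dvd card R" "pi_number {p} (index D R)"
proof -
  obtain R where R: "subgroup R G" "{\<one>} \<subseteq> R" "R \<subseteq> D" "pi_number (- {p}) (index R {\<one>})" "pi_number (- (- {p})) (index D R)"
    using dedekind_section_hall[OF residual_sub(1) triv_subgroup, of "- {p}"] below_residual
      subgroup.one_closed[OF residual_sub(1)] normalises_mono[OF _ residual_sub(3)] by (metis normal_iff empty_subsetI insert_subset)
  moreover have "\<not> p dvd card R" using R(4) p by (auto simp: pi_number_def)
  ultimately show thesis using that[of R] below_residual[OF R(1,3)] by simp
qed

lemma residual_hall_odd:
  assumes p: "Factorial_Ring.prime p" "p dvd card D"
  shows "\<not> p dvd index (carrier G) D \<and> odd p"
proof -
  obtain i where i: "i \<in> I" "p \<in> \<sigma> i" using prime_partition_memE[OF part p(1)] .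
  obtain R where R: "R \<lhd> G" "R \<subseteq> D" "\<not> p dvd card R" "pi_number {p} (index D R)"
    using residual_prime_complement[OF p(1)] .
  have Rs: "subgroup R G" "normalises (carrier G) R" using R by (auto simp: normal_iff)
  \<comment> \<open>\<open>A/D\<close> is the Sylow \<open>p\<close>-subgroup of \<open>G/D\<close>,
    in which all subgroups are normal. The goal is \<open>A = D\<close>.\<close>
  obtain A where A: "subgroup A G" "D \<subseteq> A" "pi_number {p} (index A D)" "pi_number (- {p}) (index (carrier G) A)"
    using dedekind_section_hall[OF subgroup_self residual_sub(1,3), of "{p}"] above by (metis normal_iff)
  have An: "A \<lhd> G" using above A by blast
  then have An': "normalises (carrier G) A" by (simp add: normal_iff)
  have Ac: "A \<subseteq> carrier G" using A subgroup.subset by auto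
  have ARp: "pi_number {p} (index A R)"
    using index_trans[OF A(1) residual_sub(1) Rs(1) R(2) A(2)] A R pi_number_mult by metis
  have RA: "R \<subseteq> A" using R A by blast
  obtain n where n: "index A R = p ^ n"
    using pi_number_singleton[OF ARp index_pos[OF A(1) Rs(1) RA] p(1)] .
  have aR: "a [^] (p ^ n) \<in> R" if "a \<in> A" for a
    using pow_index_mem[OF A(1) Rs(1) RA _ that] n Rs Ac normalises_mono by metis
  have nR: "normalises {y} R" if "y \<in> carrier G" for y using Rs that by (auto simp: normalises_def)
  have nD: "normalises {y} D" if "y \<in> carrier G" for y using residual_sub that by (auto simp: normalises_def)
  \<comment> \<open>\<open>A/R\<close> is a \<open>p\<close>-group, so it is a section for the class
    \<open>\<sigma> i\<close> of \<open>p\<close>.\<close>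
  have mid: "Y \<lhd> G" if "subgroup Y G" "R \<subseteq> Y" "Y \<subseteq> A" for Y
    using T2 i R An that pi_number_mono[OF ARp, of "\<sigma> i"] unfolding sections_dedekind_def by blast
  have midA: "adjoin R a \<lhd> G" if "a \<in> A" for a
  proof (rule mid)
    have c: "a \<in> carrier G" using that Ac by auto
    show "subgroup (adjoin R a) G" "R \<subseteq> adjoin R a"
      using adjoin_subgroup[OF Rs(1) c nR[OF c]] subset_adjoin[OF Rs(1) c] by auto
    show "adjoin R a \<subseteq> A" by (rule adjoin_least[OF A(1) RA that])
  qed
  \<comment> \<open>Were there no such element, every subgroup above \<open>R\<close> would be
    normal and minimality would give \<open>D \<subseteq> R\<close>, although \<open>p\<close>
    divides \<open>card D\<close> but not \<open>card R\<close>.\<close>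
  have "\<exists>q x a. Factorial_Ring.prime q \<and> q \<noteq> p \<and> p_element q x \<and> a \<in> A \<and> cj x a \<otimes> inv a \<notin> R"
  proof (rule ccontr)
    assume "\<not> ?thesis"
    then have fixed: "\<And>q x a. \<lbrakk>Factorial_Ring.prime q; q \<noteq> p; p_element q x; a \<in> A\<rbrakk> \<Longrightarrow> cj x a \<otimes> inv a \<in> R" by blast
    have "D \<subseteq> R"
    proof (rule min[OF R(1)])
      fix Y assume Y: "subgroup Y G" "R \<subseteq> Y"
      have "normalises (carrier G) Y"
      proof (rule normalises_of_p_elements[OF Y(1) order_refl])
        fix q y g assume y: "Factorial_Ring.prime q" "p_element q y" "y \<in> Y" and g: "g \<in> carrier G"
        have yc: "y \<in> carrier G" using y p_element_carrier by blast
        have le: "adjoin R y \<subseteq> Y" by (rule adjoin_least[OF Y(1,2) y(3)])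
        have s: "subgroup (adjoin R y) G" "R \<subseteq> adjoin R y" "y \<in> adjoin R y"
          using adjoin_subgroup[OF Rs(1) yc nR[OF yc]] subset_adjoin[OF Rs(1) yc] by auto
        have "adjoin R y \<lhd> G"
        proof (cases "q = p")
          case True
          have "\<not> p dvd index (carrier G) A" using A(4) p by (auto simp: pi_number_def)
          then have "y \<in> A" using p_element_mem[OF subgroup_self A(1) Ac An' yc y(2,1)] True by simp
          then show ?thesis by (rule midA)
        next
          case False
          have L: "subgroup (adjoin D y) G" "D \<subseteq> adjoin D y"
            using adjoin_subgroup[OF residual_sub(1) yc nD[OF yc]] subset_adjoin[OF residual_sub(1) yc] by auto
          have gen: "subgroup (generate G {y}) G" "generate G {y} \<subseteq> adjoin R y"
            using generate_is_subgroup[of "{y}"] generate_subgroup_incl[of "{y}"] s yc by auto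
          \<comment> \<open>By assumption \<open>y\<close> centralises \<open>D\<close> modulo
            \<open>R\<close>, so \<open>D\<close> normalises \<open>adjoin R y\<close>. This makes
            it normal in \<open>adjoin D y\<close>, which is normal in \<open>G\<close> as it lies
            above \<open>D\<close>.\<close>
          have "normalises D (adjoin R y)"
            unfolding normalises_def
          proof (intro ballI)
            fix d z assume d: "d \<in> D" and "z \<in> adjoin R y"
            then obtain r m where z: "r \<in> R" "z = r \<otimes> y [^] (m::nat)" using mem_adjoin[OF yc] by auto
            have c: "d \<in> carrier G" "r \<in> carrier G" using d z residual_sub R by auto
            have "inv (cj y d \<otimes> inv d) \<in> R" using fixed[OF y(1) False y(2)] d A Rs by (simp add: subset_iff subgroup.m_inv_closed)
            then have "cj d y \<otimes> inv y \<in> R" using inv_cj_mult_inv c yc by simp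
            then have "cj d y \<in> adjoin R y" using cj_eq_mult[of d y] c yc s by (metis subgroup.m_closed subsetD)
            moreover have "cj d r \<in> adjoin R y" using z c Rs s by (auto simp: normalises_def)
            ultimately show "cj d z \<in> adjoin R y"
              using z c yc s(1) by (simp add: cj_mult cj_pow pow_in_subgroup subgroup.m_closed)
          qed
          then have "normalises (adjoin D y) (adjoin R y)"
            unfolding adjoin_def[of D] using gen s normalises_mono[OF normalises_self[OF s(1)] gen(2)]
              normalises_generate[OF residual_sub(1) yc nD[OF yc] finite_carrier]
            by (intro normalises_set_multI residual_sub) auto
          moreover have "adjoin R y \<subseteq> adjoin D y"
            using R L subset_adjoin[OF residual_sub(1) yc] by (intro adjoin_least) auto
          ultimately show ?thesis using T1 above[OF L] s unfolding normality_transitive_def by blast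
        qed
        then show "cj g y \<in> Y" using g s le by (auto simp: normal_iff normalises_def)
      qed
      then show "Y \<lhd> G" using Y by (simp add: normal_iff)
    qed
    then show False using R p by (metis subset_antisym)
  qed
  then obtain q x a0 where q: "Factorial_Ring.prime q" "q \<noteq> p" and x: "p_element q x"
    and a0: "a0 \<in> A" "cj x a0 \<otimes> inv a0 \<notin> R" by blast
  have xc: "x \<in> carrier G" using x p_element_carrier by blast
  have moved: "odd p \<and> a \<in> D" if a: "a \<in> A" "cj x a \<otimes> inv a \<notin> R" for a
  proof -
    have ac: "a \<in> carrier G" using a Ac by auto
    let ?c = "cj x a \<otimes> inv a"
    have "cj x a \<in> adjoin R a" using midA[OF a(1)] xc subset_adjoin[OF Rs(1) ac] by (auto simp: normal_iff normalises_def)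
    then have 1: "odd p" "a \<in> adjoin R ?c"
      using power_action_cases_mod[OF R(1) p(1) q(1) q(2)[symmetric] x ac aR[OF a(1)]] a by auto
    have "adjoin D x \<lhd> G"
      using above adjoin_subgroup[OF residual_sub(1) xc nD[OF xc]] subset_adjoin[OF residual_sub(1) xc] by blast
    then have L: "subgroup (adjoin D x) G" "normalises (carrier G) (adjoin D x)" by (auto simp: normal_iff)
    have xL: "x \<in> adjoin D x" using subset_adjoin[OF residual_sub(1) xc] by auto
    \<comment> \<open>The commutator \<open>?c\<close> lies in \<open>adjoin D x\<close>, so its
      \<open>q ^ s\<close>-th power is in \<open>D\<close>, and in \<open>A\<close>, so its
      \<open>p ^ n\<close>-th power is in \<open>R\<close>. Coprimality puts it into
      \<open>D\<close>, and \<open>a\<close> is a power of it modulo \<open>R\<close>.\<close>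
    have "?c = x \<otimes> cj a (inv x)" using xc ac by (simp add: cj_def m_assoc)
    then have cL: "?c \<in> adjoin D x" using xL L ac by (auto simp: normalises_def subgroup.m_closed subgroup.m_inv_closed)
    have cA: "?c \<in> A" using A An' xc a by (auto simp: normalises_def subgroup.m_closed subgroup.m_inv_closed)
    obtain s :: nat where s: "x [^] (q ^ s) = \<one>" using x by (auto simp: p_element_def)
    have e1: "?c [^] (q ^ s) \<in> D"
      using adjoin_pow_mem[OF residual_sub(1) xc nD[OF xc] _ cL] s subgroup.one_closed[OF residual_sub(1)] by metis
    have e2: "?c [^] (p ^ n) \<in> D" using aR[OF cA] R by blast
    have "coprime (q ^ s) (p ^ n)" using q p by (simp add: primes_coprime)
    then have "?c \<in> D" using coprime_pow_mem[OF residual_sub(1) _ e1 e2] xc ac by simp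
    then have "adjoin R ?c \<subseteq> D" using adjoin_least[OF residual_sub(1) R(2)] by blast
    then show ?thesis using 1 by blast
  qed
  have "A \<subseteq> D"
  proof
    fix b assume b: "b \<in> A"
    have c: "a0 \<in> carrier G" "b \<in> carrier G" using a0 b Ac by auto
    show "b \<in> D"
    proof (cases "cj x b \<otimes> inv b \<in> R")
      case True
      \<comment> \<open>The commutator of \<open>x\<close> with \<open>a0 \<otimes> b\<close> is the
        one with \<open>a0\<close> times a conjugate of the one with \<open>b\<close>. So
        \<open>a0 \<otimes> b\<close> is moved when \<open>b\<close> is not, and \<open>b\<close> is
        a quotient of two moved elements.\<close>
      have "cj x (a0 \<otimes> b) \<otimes> inv (a0 \<otimes> b) \<notin> R"
      proof
        assume "cj x (a0 \<otimes> b) \<otimes> inv (a0 \<otimes> b) \<in> R"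
        moreover have "inv (cj a0 (cj x b \<otimes> inv b)) \<in> R"
          using True Rs c by (auto simp: normalises_def subgroup.m_inv_closed)
        moreover have "cj x a0 \<otimes> inv a0 = cj x (a0 \<otimes> b) \<otimes> inv (a0 \<otimes> b) \<otimes> inv (cj a0 (cj x b \<otimes> inv b))"
          using c xc by (simp add: cj_def inv_mult_group m_assoc)
        ultimately show False using a0 Rs by (metis subgroup.m_closed)
      qed
      then have "a0 \<otimes> b \<in> D" using moved[of "a0 \<otimes> b"] a0 b A by (simp add: subgroup.m_closed)
      moreover have "inv a0 \<in> D" using moved[OF a0] residual_sub by (simp add: subgroup.m_inv_closed)
      ultimately have "inv a0 \<otimes> (a0 \<otimes> b) \<in> D" using residual_sub by (simp add: subgroup.m_closed)
      then show ?thesis using c by simp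
    qed (use moved b in blast)
  qed
  then have "A = D" using A by blast
  then show ?thesis using A(4) p moved[OF a0] by (auto simp: pi_number_def)
qed

lemma residual_commute:
  assumes i: "i \<in> I" "p \<in> \<sigma> i" "q \<in> \<sigma> i" and d: "d \<in> D" "p_element p d" and x: "p_element q x"
  shows "d \<otimes> x = x \<otimes> d"
proof -
  have p: "Factorial_Ring.prime p" and q: "Factorial_Ring.prime q" using prime_partition_prime[OF part] i by auto
  have xc: "x \<in> carrier G" and dc: "d \<in> carrier G" using x d p_element_carrier by auto
  consider "\<not> p dvd card D" | "p dvd card D" "p = q" | "p dvd card D" "p \<noteq> q" by blast
  then show ?thesis
  proof cases
    case 1
    then have "d = \<one>" using p_element_trivial[OF residual_sub(1) d p] by blast
    then show ?thesis using xc by simp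
  next
    case 2
    then have "x \<in> D"
      using p_element_mem[OF subgroup_self residual_sub(1,3,2) xc x q] residual_hall_odd[OF p] by simp
    then show ?thesis using residual_comm d by blast
  next
    case 3
    \<comment> \<open>The section from \<open>R\<close> to \<open>adjoin D x\<close> has a
      \<open>\<sigma> i\<close>-number as its order, so \<open>adjoin R x\<close> is normal and
      contains the commutator \<open>?c\<close>. Hence a power of \<open>?c\<close> with exponent
      \<open>q ^ s\<close> lies in \<open>R\<close>. But \<open>?c\<close> is also a power of
      \<open>d\<close>, so it is a \<open>p\<close>-element; it therefore lies in \<open>R\<close>,
      whose order is prime to \<open>p\<close>, and is trivial.\<close>
    obtain R where R: "R \<lhd> G" "R \<subseteq> D" "\<not> p dvd card R" "pi_number {p} (index D R)"
      using residual_prime_complement[OF p] .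
    have Rs: "subgroup R G" "normalises {x} R" using R xc normalises_mono[of "carrier G" R "{x}"] by (auto simp: normal_iff)
    have Dx: "normalises {x} D" using residual_sub xc normalises_mono[of "carrier G" D "{x}"] by auto
    have L: "subgroup (adjoin D x) G" "D \<subseteq> adjoin D x" "x \<in> adjoin D x"
      using adjoin_subgroup[OF residual_sub(1) xc Dx] subset_adjoin[OF residual_sub(1) xc] by auto
    have H: "subgroup (adjoin R x) G" "R \<subseteq> adjoin R x" "x \<in> adjoin R x"
      using adjoin_subgroup[OF Rs(1) xc Rs(2)] subset_adjoin[OF Rs(1) xc] by auto
    have "pi_number (\<sigma> i) (index (adjoin D x) D)"
      using pi_number_index_adjoin[OF residual_sub(1) Dx x q i(3)] .
    moreover have "pi_number (\<sigma> i) (index D R)" using pi_number_mono[OF R(4)] i by blast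
    ultimately have "pi_number (\<sigma> i) (index (adjoin D x) R)"
      using index_trans[OF L(1) residual_sub(1) Rs(1) R(2) L(2)] pi_number_mult by metis
    moreover have "adjoin R x \<subseteq> adjoin D x" using R L by (intro adjoin_least) auto
    ultimately have "adjoin R x \<lhd> G"
      using T2 i(1) R(1) above[OF L(1,2)] H unfolding sections_dedekind_def by blast
    then have Hn: "normalises (carrier G) (adjoin R x)" by (simp add: normal_iff)
    let ?c = "cj d x \<otimes> inv x"
    have cH: "?c \<in> adjoin R x" using Hn H dc by (auto simp: normalises_def subgroup.m_closed subgroup.m_inv_closed)
    have cc: "?c \<in> carrier G" using dc xc by simp
    obtain s :: nat where s: "x [^] (q ^ s) = \<one>" using x by (auto simp: p_element_def)
    have e1: "?c [^] (q ^ s) \<in> R"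
      using adjoin_pow_mem[OF Rs(1) xc Rs(2) _ cH] s subgroup.one_closed[OF Rs(1)] by metis
    have "?c = d \<otimes> cj x (inv d)" using xc dc by (simp add: cj_def m_assoc)
    then have "?c \<in> generate G {d}"
      using cyclic_below_residual[OF d(1)] xc
      by (auto simp: normal_iff normalises_def subgroup.m_closed subgroup.m_inv_closed)
    then obtain k where k: "?c = d [^] (k::nat)" using generate_pow_on_finite_carrier[OF finite_carrier dc] by auto
    then have pc: "p_element p ?c" using p_element_pow[OF d(2)] by simp
    then obtain n :: nat where n: "?c [^] (p ^ n) = \<one>" by (auto simp: p_element_def)
    have "coprime (q ^ s) (p ^ n)" using q p 3 by (simp add: primes_coprime)
    then have "?c \<in> R" using coprime_pow_mem[OF Rs(1) cc e1, of "p ^ n"] n subgroup.one_closed[OF Rs(1)] by simp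
    then have "?c = \<one>" using p_element_trivial[OF Rs(1) _ pc p R(3)] by blast
    then have "cj d x = x" using cj_eq_mult[OF dc xc] xc by simp
    then show ?thesis using cj_commute dc xc by simp
  qed
qed

lemma residual_power_structure: "power_structure I \<sigma> D" "odd (card D)"
proof -
  have "coprime (card D) (index (carrier G) D)"
  proof (rule ccontr)
    assume "\<not> ?thesis"
    then have "gcd (card D) (index (carrier G) D) \<noteq> 1" by (simp add: coprime_iff_gcd_eq_1)
    then obtain p where "Factorial_Ring.prime p" "p dvd gcd (card D) (index (carrier G) D)"
      using prime_factor_nat by blast
    then show False using residual_hall_odd[of p] dvd_trans[OF _ gcd_dvd1] dvd_trans[OF _ gcd_dvd2] by blast
  qed
  then show "power_structure I \<sigma> D"
    unfolding power_structure_def using D residual_comm above below_residual residual_commute by blast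
  show "odd (card D)" using residual_hall_odd[of 2] two_is_prime_nat by auto
qed

end

end

section \<open>Sylow's theorems and complements\<close>

lemma cj_image_cj:
  assumes "x \<in> carrier G" "y \<in> carrier G" "H \<subseteq> carrier G"
  shows "cj x ` cj y ` H = cj (x \<otimes> y) ` H"
  unfolding image_image using assms by (intro image_cong) (auto simp: cj_cj)

lemma cj_image_self:
  assumes "subgroup H G" "x \<in> H" shows "cj x ` H = H"
  using normalises_image[OF assms(1)] assms subgroup.mem_carrier[OF assms(1)] by (simp add: normalises_def)

lemma card_cj_image:
  assumes "subgroup H G" "x \<in> carrier G" shows "card (cj x ` H) = card H"
  using cj_inj[OF assms(2)] subgroup.subset[OF assms(1)] by (meson card_image inj_on_subset)

text \<open>Counting \<open>J\<close> by double cosets \<open>Q g P\<close>: the size of \<open>Q g P\<close> is \<open>|P|\<close> times the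
  index of \<open>Q \<inter> g P g\<inverse>\<close> in \<open>Q\<close>.\<close>

lemma dvd_card_non_fixed_cosets:
  assumes J: "subgroup J G" and P: "subgroup P G" "P \<subseteq> J" and Q: "subgroup Q G" "Q \<subseteq> J"
    and p: "Factorial_Ring.prime p" "pi_number {p} (card Q)"
  shows "p * card P dvd card (J - {g\<in>J. Q \<subseteq> cj g ` P})"
proof -
  let ?F = "{g\<in>J. Q \<subseteq> cj g ` P}"
  define C where "C g = {q \<otimes> g \<otimes> r | q r. q \<in> Q \<and> r \<in> P}" for g
  have Xc: "J \<subseteq> carrier G" and Pc: "P \<subseteq> carrier G" and Qc: "Q \<subseteq> carrier G"
    using subgroup.subset[OF J] subgroup.subset[OF P(1)] subgroup.subset[OF Q(1)] by auto
  have self: "g \<in> C g" if "g \<in> J" for g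
  proof -
    have "g = \<one> \<otimes> g \<otimes> \<one>" using that Xc by auto
    then show ?thesis unfolding C_def using subgroup.one_closed[OF P(1)] subgroup.one_closed[OF Q(1)] by blast
  qed
  have sub: "C g \<subseteq> J" if "g \<in> J" for g
    unfolding C_def using that P Q J by (auto intro!: subgroup.m_closed)
  have sym: "g \<in> C h" if gX: "g \<in> J" and hg: "h \<in> C g" for g h
  proof -
    obtain q r where 1: "q \<in> Q" "r \<in> P" "h = q \<otimes> g \<otimes> r" using hg by (auto simp: C_def)
    have c: "q \<in> carrier G" "g \<in> carrier G" "r \<in> carrier G" using 1 gX Xc Pc Qc by auto
    have "g = inv q \<otimes> h \<otimes> inv r" using 1 c by (simp add: m_assoc)
    moreover have "inv q \<in> Q" "inv r \<in> P" using 1 P Q by (auto intro: subgroup.m_inv_closed)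
    ultimately show ?thesis unfolding C_def by blast
  qed
  have tr: "C h \<subseteq> C g" if gX: "g \<in> J" and hg: "h \<in> C g" for g h
  proof
    fix y assume "y \<in> C h"
    then obtain q r where 1: "q \<in> Q" "r \<in> P" "y = q \<otimes> h \<otimes> r" by (auto simp: C_def)
    obtain q' r' where 2: "q' \<in> Q" "r' \<in> P" "h = q' \<otimes> g \<otimes> r'" using hg by (auto simp: C_def)
    have "y = (q \<otimes> q') \<otimes> g \<otimes> (r' \<otimes> r)" using 1 2 gX Xc Pc Qc by (simp add: m_assoc subset_iff)
    moreover have "q \<otimes> q' \<in> Q" "r' \<otimes> r \<in> P" using 1 2 P Q by (auto intro: subgroup.m_closed)
    ultimately show "y \<in> C g" unfolding C_def by blast
  qed
  have eq: "C h = C g" if "g \<in> J" "h \<in> C g" for g h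
    using tr[OF that] tr[of h g] sym[OF that] sub[OF that(1)] that by blast
  \<comment> \<open>The set \<open>?F\<close> consists of those \<open>g\<close> whose double coset
    is a single left coset of \<open>P\<close>. The property is constant on double cosets, so the
    remaining elements are a union of double cosets too.\<close>
  have fix_step: "h \<in> ?F" if g: "g \<in> ?F" and h: "h \<in> C g" for g h
  proof -
    obtain q r where 1: "q \<in> Q" "r \<in> P" "h = q \<otimes> g \<otimes> r" using h by (auto simp: C_def)
    have c: "q \<in> carrier G" "g \<in> carrier G" "r \<in> carrier G" using 1 g Xc Pc Qc by auto
    have "cj h ` P = cj q ` cj g ` cj r ` P" using 1 c Pc by (simp add: cj_image_cj image_subset_iff subset_iff m_assoc)
    also have "\<dots> = cj q ` cj g ` P" using cj_image_self[OF P(1) 1(2)] by simp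
    also have "\<dots> \<supseteq> cj q ` Q" using g by blast
    finally have "Q \<subseteq> cj h ` P" using cj_image_self[OF Q(1) 1(1)] by simp
    then show ?thesis using sub[of g] h g by blast
  qed
  let ?\<C> = "C ` (J - ?F)"
  have U: "\<Union>?\<C> = J - ?F"
  proof
    show "\<Union>?\<C> \<subseteq> J - ?F"
    proof
      fix h assume "h \<in> \<Union>?\<C>"
      then obtain g where g: "g \<in> J - ?F" "h \<in> C g" by blast
      have gX: "g \<in> J" using g by blast
      have "g \<in> C h" using sym gX g by blast
      then have "h \<notin> ?F" using fix_step[of h g] g by blast
      then show "h \<in> J - ?F" using sub gX g by blast
    qed
    show "J - ?F \<subseteq> \<Union>?\<C>" using self by blast
  qed
  have card: "p * card P dvd card (C g)" if g: "g \<in> J - ?F" for g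
  proof -
    have gc: "g \<in> carrier G" using g Xc by auto
    let ?P = "cj g ` P"
    have P': "subgroup ?P G" "?P \<subseteq> carrier G" using subgroup_cj[OF P(1) gc] subgroup.subset by auto
    have "C g = (\<lambda>x. x \<otimes> g) ` (Q <#> ?P)"
    proof
      show "C g \<subseteq> (\<lambda>x. x \<otimes> g) ` (Q <#> ?P)"
      proof
        fix y assume "y \<in> C g"
        then obtain q r where 1: "q \<in> Q" "r \<in> P" "y = q \<otimes> g \<otimes> r" by (auto simp: C_def)
        have "y = (q \<otimes> cj g r) \<otimes> g" using 1 gc Pc Qc by (simp add: cj_def m_assoc subset_iff)
        then show "y \<in> (\<lambda>x. x \<otimes> g) ` (Q <#> ?P)" unfolding set_mult_def using 1 by blast
      qed
      show "(\<lambda>x. x \<otimes> g) ` (Q <#> ?P) \<subseteq> C g"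
      proof clarify
        fix x assume "x \<in> Q <#> ?P"
        then obtain q r where 1: "q \<in> Q" "r \<in> P" "x = q \<otimes> cj g r" unfolding set_mult_def by blast
        have "x \<otimes> g = q \<otimes> g \<otimes> r" using 1 gc Pc Qc by (simp add: cj_def m_assoc subset_iff)
        then show "x \<otimes> g \<in> C g" unfolding C_def using 1 by blast
      qed
    qed
    moreover have "inj_on (\<lambda>x. x \<otimes> g) (Q <#> ?P)"
      using setmult_subset_G[OF Qc P'(2)] gc by (auto simp: inj_on_def subset_iff)
    ultimately have cC: "card (C g) = card (Q <#> ?P)" by (simp add: card_image)
    have I: "subgroup (?P \<inter> Q) G" using subgroups_Inter_pair[OF P'(1) Q(1)] .
    have "card (C g) * card (?P \<inter> Q) = (index Q (?P \<inter> Q) * card P) * card (?P \<inter> Q)"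
      using card_set_mult[OF Q(1) P'(1)] card_mult_index[OF Q(1) I Int_lower2]
      by (simp only: cC card_cj_image[OF P(1) gc] ac_simps)
    then have "card (C g) = index Q (?P \<inter> Q) * card P"
      using card_subgroup_pos[OF I] by (metis mult_cancel2 neq0_conv)
    \<comment> \<open>\<open>Q\<close> is not contained in the conjugate of \<open>P\<close>, so
      this index is a nontrivial divisor of a \<open>p\<close>-number.\<close>
    moreover have "p dvd index Q (?P \<inter> Q)"
    proof -
      have "index Q (?P \<inter> Q) \<noteq> 1" using index_one_iff[OF Q(1) I] g by blast
      then obtain r where r: "Factorial_Ring.prime r" "r dvd index Q (?P \<inter> Q)" using prime_factor_nat by blast
      then have "r dvd card Q" using card_mult_index[OF Q(1) I] by (metis Int_lower2 dvd_mult2)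
      then show ?thesis using r p by (auto simp: pi_number_def)
    qed
    ultimately show ?thesis by (simp add: mult_dvd_mono)
  qed
  have "card (\<Union>?\<C>) = sum card ?\<C>"
  proof (rule card_Union_disjoint)
    show "pairwise disjnt ?\<C>"
    proof (rule pairwiseI)
      fix A B assume "A \<in> ?\<C>" "B \<in> ?\<C>" and ne: "A \<noteq> B"
      then obtain g h where gh: "g \<in> J" "h \<in> J" "A = C g" "B = C h" by blast
      have "A \<inter> B = {}"
      proof (rule ccontr)
        assume "A \<inter> B \<noteq> {}"
        then obtain x where "x \<in> C g" "x \<in> C h" using gh by blast
        then show False using eq gh ne by metis
      qed
      then show "disjnt A B" by (simp add: disjnt_def)
    qed
    show "finite A" if "A \<in> ?\<C>" for A
      using that sub finite_subgroup[OF J] finite_subset by blast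
  qed
  moreover have "p * card P dvd sum card ?\<C>" by (rule dvd_sum) (use card in blast)
  ultimately show ?thesis using U by simp
qed

definition sylow_of :: "nat \<Rightarrow> 'a set \<Rightarrow> 'a set \<Rightarrow> bool" where
  "sylow_of p J P \<longleftrightarrow> subgroup P G \<and> P \<subseteq> J \<and> pi_number {p} (card P) \<and> \<not> p dvd index J P"

lemma sylow_of_exists:
  assumes J: "subgroup J G" and p: "Factorial_Ring.prime p"
  obtains P where "sylow_of p J P"
proof -
  have "p ^ multiplicity p (card J) dvd index J {\<one>}" by (simp add: multiplicity_dvd)
  then obtain P where P: "subgroup P G" "P \<subseteq> J" "index P {\<one>} = p ^ multiplicity p (card J)"
    using exists_intermediate_prime_power[OF J triv_subgroup _ _ p] normalises_one subgroup.subset[OF J]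
      subgroup.one_closed[OF J] by (metis empty_subsetI insert_subset)
  have "pi_number {p} (card P)" using P by (simp add: pi_number_power pi_number_prime p)
  moreover have "\<not> p dvd index J P"
  proof
    assume "p dvd index J P"
    then have "p * p ^ multiplicity p (card J) dvd card J"
      using card_mult_index[OF J P(1,2)] P(3) by (simp add: mult_dvd_mono)
    then have "p ^ Suc (multiplicity p (card J)) dvd card J" by simp
    then show False using card_subgroup_pos[OF J] p
      by (metis Suc_n_not_le_n multiplicity_geI not_prime_unit neq0_conv)
  qed
  ultimately have "sylow_of p J P" using P by (simp add: sylow_of_def)
  then show thesis by (rule that)
qed

text \<open>If no coset were fixed, the count would make \<open>p * card P\<close> divide
  \<open>card J\<close>, against the choice of \<open>P\<close>.\<close>

lemma sylow_contains_conjugate: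
  assumes J: "subgroup J G" and p: "Factorial_Ring.prime p" and P: "sylow_of p J P"
    and Q: "subgroup Q G" "Q \<subseteq> J" "pi_number {p} (card Q)"
  obtains g where "g \<in> J" "Q \<subseteq> cj g ` P"
proof -
  have Ps: "subgroup P G" "P \<subseteq> J" "\<not> p dvd index J P" using P by (auto simp: sylow_of_def)
  have "{g\<in>J. Q \<subseteq> cj g ` P} \<noteq> {}"
  proof
    assume e: "{g\<in>J. Q \<subseteq> cj g ` P} = {}"
    have "p * card P dvd card J"
      using dvd_card_non_fixed_cosets[OF J Ps(1,2) Q(1,2) p Q(3)] unfolding e by simp
    then have "p * card P dvd index J P * card P" using card_mult_index[OF J Ps(1,2)] by simp
    then show False using Ps card_subgroup_pos[OF Ps(1)] by (metis dvd_mult_cancel_right neq0_conv nat_mult_dvd_cancel_disj mult.commute)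
  qed
  then show thesis using that by blast
qed

lemma sylow_of_cj:
  assumes J: "subgroup J G" and P: "sylow_of p J P" and g: "g \<in> carrier G" "normalises {g} J"
  shows "sylow_of p J (cj g ` P)"
proof -
  have Ps: "subgroup P G" "P \<subseteq> J" using P by (auto simp: sylow_of_def)
  have "cj g ` P \<subseteq> J" using Ps g by (auto simp: normalises_def)
  then show ?thesis
    using P subgroup_cj[OF Ps(1) g(1)] card_cj_image[OF Ps(1) g(1)] by (auto simp: sylow_of_def index_def)
qed

lemma sylow_conjugate:
  assumes J: "subgroup J G" and p: "Factorial_Ring.prime p" and P: "sylow_of p J P" and S: "sylow_of p J S"
  obtains g where "g \<in> J" "S = cj g ` P"
proof -
  have Ps: "subgroup P G" "P \<subseteq> J" "pi_number {p} (card P)" and Ss: "subgroup S G" "S \<subseteq> J" "pi_number {p} (card S)" "\<not> p dvd index J S"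
    using P S by (auto simp: sylow_of_def)
  obtain g where g: "g \<in> J" "S \<subseteq> cj g ` P" using sylow_contains_conjugate[OF J p P Ss(1,2,3)] .
  have gc: "g \<in> carrier G" using g J subgroup.mem_carrier by metis
  have P': "subgroup (cj g ` P) G" "cj g ` P \<subseteq> J"
    using subgroup_cj[OF Ps(1) gc] Ps g J by auto
  have "index (cj g ` P) S = 1"
  proof (rule ccontr)
    assume "index (cj g ` P) S \<noteq> 1"
    then obtain r where r: "Factorial_Ring.prime r" "r dvd index (cj g ` P) S" using prime_factor_nat by blast
    then have "r dvd card P" using card_mult_index[OF P'(1) Ss(1) g(2)] card_cj_image[OF Ps(1) gc] by (metis dvd_mult2)
    then have "r = p" using Ps r by (auto simp: pi_number_def)
    then show False using r Ss index_trans[OF J P'(1) Ss(1) g(2) P'(2)] by (metis dvd_mult)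
  qed
  then show thesis using that g index_one_iff[OF P'(1) Ss(1) g(2)] by blast
qed

lemma sylow_containing:
  assumes J: "subgroup J G" and p: "Factorial_Ring.prime p"
    and Q: "subgroup Q G" "Q \<subseteq> J" "pi_number {p} (card Q)"
  obtains S where "sylow_of p J S" "Q \<subseteq> S"
proof -
  obtain P where P: "sylow_of p J P" using sylow_of_exists[OF J p] .
  obtain g where g: "g \<in> J" "Q \<subseteq> cj g ` P" using sylow_contains_conjugate[OF J p P Q] .
  have "sylow_of p J (cj g ` P)"
    using sylow_of_cj[OF J P] g J subgroup.mem_carrier[OF J] by (simp add: normalises_def)
  then show thesis using that g by blast
qed

text \<open>Conjugating \<open>P\<close> by \<open>x\<close> in \<open>J\<close> gives another Sylow
  subgroup of \<open>N\<close>, hence a conjugate of \<open>P\<close> under some \<open>n\<close> in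
  \<open>N\<close>; then \<open>inv n \<otimes> x\<close> normalises \<open>P\<close>.\<close>

lemma frattini_argument:
  assumes J: "subgroup J G" and N: "subgroup N G" "N \<subseteq> J" "normalises J N"
    and p: "Factorial_Ring.prime p" and P: "sylow_of p N P"
  shows "J = N <#> (J \<inter> normalizer G P)"
proof
  have Xc: "J \<subseteq> carrier G" using J subgroup.subset by auto
  have Ps: "subgroup P G" "P \<subseteq> carrier G" using P subgroup.subset by (auto simp: sylow_of_def)
  show "N <#> (J \<inter> normalizer G P) \<subseteq> J" by (rule set_mult_least[OF J N(2)]) auto
  show "J \<subseteq> N <#> (J \<inter> normalizer G P)"
  proof
    fix x assume x: "x \<in> J"
    then have xc: "x \<in> carrier G" using Xc by auto
    have "sylow_of p N (cj x ` P)" using sylow_of_cj[OF N(1) P xc] N x by (auto simp: normalises_def)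
    then obtain n where n: "n \<in> N" "cj x ` P = cj n ` P" using sylow_conjugate[OF N(1) p P] by metis
    then have nc: "n \<in> carrier G" using N subgroup.mem_carrier by metis
    have "cj (inv n \<otimes> x) ` P = cj (inv n) ` cj n ` P" using n nc xc Ps by (simp add: cj_image_cj[symmetric])
    also have "\<dots> = P" using nc Ps cj_image_cj[of "inv n" n P] by (simp add: subset_iff)
    finally have "inv n \<otimes> x \<in> normalizer G P" using mem_normalizer[OF Ps(1)] nc xc by (auto simp: normalises_def)
    moreover have "inv n \<otimes> x \<in> J" using n x N J by (simp add: subset_iff subgroup.m_closed subgroup.m_inv_closed)
    moreover have "x = n \<otimes> (inv n \<otimes> x)" using nc xc by simp
    ultimately show "x \<in> N <#> (J \<inter> normalizer G P)" unfolding set_mult_def using n by blast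
  qed
qed

text \<open>The cocycle \<open>\<delta> g = (\<Prod>t\<in>T. g t r(g t)\<inverse>)\<close>, with \<open>r\<close> choosing representatives \<open>T\<close> of the cosets
  of \<open>A\<close>, satisfies \<open>\<delta> (g h) = g (\<delta> h) g\<inverse> (\<delta> g)\<close> and \<open>\<delta> a = a ^ |G : A|\<close> for \<open>a \<in> A\<close>.
  Its kernel is the complement.\<close>

lemma abelian_normal_hall_complement:
  assumes A: "A \<lhd> G" and comm: "\<And>a b. \<lbrakk>a \<in> A; b \<in> A\<rbrakk> \<Longrightarrow> a \<otimes> b = b \<otimes> a"
    and cop: "coprime (card A) (index (carrier G) A)"
  obtains C where "subgroup C G" "A <#> C = carrier G" "A \<inter> C = {\<one>}"
proof -
  have As: "subgroup A G" "normalises (carrier G) A" "A \<subseteq> carrier G" using A subgroup.subset by (auto simp: normal_iff)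
  let ?A = "G\<lparr>carrier := A\<rparr>"
  interpret Ag: comm_group ?A
    using subgroup_imp_group[OF As(1)] comm by (intro group.group_comm_groupI) auto
  \<comment> \<open>The choice refers to the coset alone, which makes \<open>r\<close> constant on
    cosets (\<open>r_eq\<close>).\<close>
  define r where "r x = (SOME y. y \<in> A #> x)" for x
  have r_mem: "r x \<in> A #> x" if "x \<in> carrier G" for x
    unfolding r_def using rcos_self[OF that As(1)] by (rule someI)
  have r_car: "r x \<in> carrier G" if "x \<in> carrier G" for x
    using r_mem[OF that] r_coset_subset_G[OF As(3) that] by blast
  have r_coset: "A #> r x = A #> x" if "x \<in> carrier G" for x
    using repr_independence[OF r_mem[OF that] that As(1)] by simp
  have r_eq: "r x = r y" if "x \<in> carrier G" "y \<in> carrier G" "x \<otimes> inv y \<in> A" for x y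
    using rcos_eq_iff[OF A that(1,2)] that(3) by (simp add: r_def)
  have r_diff: "x \<otimes> inv (r x) \<in> A" "r x \<otimes> inv x \<in> A" if "x \<in> carrier G" for x
    using rcos_eq_iff[OF A that r_car[OF that]] rcos_eq_iff[OF A r_car[OF that] that] r_coset[OF that] by auto
  define T where "T = r ` carrier G"
  have T: "T \<subseteq> carrier G" "finite T" using r_car by (auto simp: T_def)
  have rT: "r t = t" if "t \<in> T" for t
    using that r_eq[OF r_car _ r_diff(2)] by (auto simp: T_def)
  have cardT: "card T = index (carrier G) A"
  proof -
    have "bij_betw (\<lambda>t. A #> t) T (rcosets A)"
    proof (rule bij_betwI')
      show "A #> s = A #> t \<longleftrightarrow> s = t" if "s \<in> T" "t \<in> T" for s t
        using that rT r_eq[of s t] rcos_eq_iff[OF A, of s t] T by (metis subsetD)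
      show "A #> t \<in> rcosets A" if "t \<in> T" for t using that T As by (intro rcosetsI) auto
      show "\<exists>t\<in>T. C = A #> t" if "C \<in> rcosets A" for C
        using that r_coset by (force simp: RCOSETS_def T_def)
    qed
    then show ?thesis using card_rcosets[OF As(1)] by (simp add: bij_betw_same_card)
  qed
  define f where "f g t = g \<otimes> t \<otimes> inv (r (g \<otimes> t))" for g t
  have fA: "f g t \<in> A" if "g \<in> carrier G" "t \<in> T" for g t
    unfolding f_def using that T r_diff(1)[of "g \<otimes> t"] by auto
  define \<delta> where "\<delta> g = finprod ?A (f g) T" for g
  have \<delta>A: "\<delta> g \<in> A" if "g \<in> carrier G" for g
    unfolding \<delta>_def using Ag.finprod_closed[of "f g" T] fA that by auto
  have cjA: "cj g a \<in> A" if "g \<in> carrier G" "a \<in> A" for g a using As that by (auto simp: normalises_def)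
  have fin: "finprod ?A (\<lambda>t. cj g (h t)) S = cj g (finprod ?A h S)"
    if "finite S" "h \<in> S \<rightarrow> A" "g \<in> carrier G" for g h S
    using that
  proof (induction S rule: finite_induct)
    case empty
    then show ?case by simp
  next
    case (insert s S)
    then have hA: "h s \<in> A" "h \<in> S \<rightarrow> A" by auto
    have "finprod ?A h S \<in> A" using Ag.finprod_closed[of h S] hA by simp
    moreover have "finprod ?A (\<lambda>t. cj g (h t)) (insert s S) = cj g (h s) \<otimes> finprod ?A (\<lambda>t. cj g (h t)) S"
      using Ag.finprod_insert[of S s "\<lambda>t. cj g (h t)"] insert.hyps hA cjA[OF insert.prems(2)]
      by (simp add: Pi_iff)
    moreover have "finprod ?A h (insert s S) = h s \<otimes> finprod ?A h S"
      using Ag.finprod_insert[of S s h] insert.hyps hA by (simp add: Pi_iff)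
    ultimately show ?case using insert hA As by (simp add: cj_mult subset_iff)
  qed
  have cocycle: "\<delta> (g \<otimes> h) = cj g (\<delta> h) \<otimes> \<delta> g" if g: "g \<in> carrier G" and h: "h \<in> carrier G" for g h
  proof -
    \<comment> \<open>Left multiplication by \<open>h\<close> followed by \<open>r\<close> permutes
      \<open>T\<close>, so the product defining \<open>\<delta> g\<close> may be reindexed along
      \<open>?u\<close>.\<close>
    let ?u = "\<lambda>t. r (h \<otimes> t)"
    have uT: "?u t \<in> T" if "t \<in> T" for t using that T h by (auto simp: T_def)
    have inj: "inj_on ?u T"
    proof (rule inj_onI)
      fix s t assume st: "s \<in> T" "t \<in> T" "?u s = ?u t"
      have c: "s \<in> carrier G" "t \<in> carrier G" using st T by auto
      have "A #> (h \<otimes> s) = A #> (h \<otimes> t)" using r_coset[of "h \<otimes> s"] r_coset[of "h \<otimes> t"] st c h by simp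
      then have "h \<otimes> s \<otimes> inv (h \<otimes> t) \<in> A" using rcos_eq_iff[OF A] c h by simp
      then have "cj (inv h) (h \<otimes> s \<otimes> inv (h \<otimes> t)) \<in> A" using cjA h by simp
      moreover have "cj (inv h) (h \<otimes> s \<otimes> inv (h \<otimes> t)) = s \<otimes> inv t"
        using c h by (simp add: cj_def m_assoc inv_mult_group)
      ultimately show "s = t" using r_eq[OF c] rT st by metis
    qed
    have img: "?u ` T = T" using inj uT T by (intro endo_inj_surj) auto
    have step: "f (g \<otimes> h) t = cj g (f h t) \<otimes> f g (?u t)" if t: "t \<in> T" for t
    proof -
      have c: "t \<in> carrier G" "?u t \<in> carrier G" using t T uT by auto
      have "r (g \<otimes> ?u t) = r (g \<otimes> h \<otimes> t)"
      proof (rule r_eq)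
        have "g \<otimes> ?u t \<otimes> inv (g \<otimes> h \<otimes> t) = cj g (?u t \<otimes> inv (h \<otimes> t))"
          using c g h by (simp add: cj_def m_assoc inv_mult_group)
        then show "g \<otimes> ?u t \<otimes> inv (g \<otimes> h \<otimes> t) \<in> A" using cjA g h c r_diff(2)[of "h \<otimes> t"] by simp
      qed (use c g h in auto)
      moreover have "r (g \<otimes> h \<otimes> t) \<in> carrier G" using c g h r_car by simp
      ultimately show ?thesis unfolding f_def using c g h by (simp add: cj_def m_assoc)
    qed
    have "\<delta> (g \<otimes> h) = finprod ?A (\<lambda>t. cj g (f h t) \<otimes>\<^bsub>?A\<^esub> f g (?u t)) T"
      unfolding \<delta>_def by (rule Ag.finprod_cong') (use step fA cjA g h uT As in \<open>auto intro!: subgroup.m_closed\<close>)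
    also have "\<dots> = finprod ?A (\<lambda>t. cj g (f h t)) T \<otimes>\<^bsub>?A\<^esub> finprod ?A (\<lambda>t. f g (?u t)) T"
      by (rule Ag.finprod_multf) (use fA cjA g h uT in auto)
    also have "finprod ?A (\<lambda>t. cj g (f h t)) T = cj g (\<delta> h)"
      unfolding \<delta>_def by (rule fin) (use T fA g h in auto)
    also have "finprod ?A (\<lambda>t. f g (?u t)) T = \<delta> g"
      unfolding \<delta>_def using Ag.finprod_reindex[of "f g" ?u T] inj img fA g by auto
    finally show ?thesis by simp
  qed
  have \<delta>_A: "\<delta> a = a [^] card T" if a: "a \<in> A" for a
  proof -
    have "f a t = a" if t: "t \<in> T" for t
    proof -
      have c: "a \<in> carrier G" "t \<in> carrier G" using a t As T by auto
      have "r (a \<otimes> t) = r t" by (rule r_eq) (use c a in \<open>auto simp: m_assoc\<close>)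
      then show ?thesis unfolding f_def using rT[OF t] c by (simp add: m_assoc)
    qed
    then have "\<delta> a = finprod ?A (\<lambda>t. a) T" unfolding \<delta>_def using a by (intro Ag.finprod_cong') auto
    also have "\<dots> = a [^]\<^bsub>?A\<^esub> card T" using Ag.finprod_const a by simp
    finally show ?thesis by (simp add: nat_pow_consistent[symmetric])
  qed
  have copT: "coprime (card A) (card T)" using cop cardT by simp
  have powA: "a [^] card A = \<one>" if "a \<in> A" for a
    using pow_index_mem[OF As(1) triv_subgroup _ normalises_one[OF As(3)] that] subgroup.one_closed[OF As(1)] by auto
  have trivA: "a = \<one>" if "a \<in> A" "a [^] card T = \<one>" for a
    using coprime_pow_mem[OF triv_subgroup, of a "card A" "card T"] powA that As copT by auto
  \<comment> \<open>The exponent \<open>card T\<close> has an inverse modulo \<open>card A\<close>,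
    which serves as the exponent of a root.\<close>
  have pow_surj: "\<exists>b\<in>A. b [^] card T = a" if a: "a \<in> A" for a
  proof -
    have ac: "a \<in> carrier G" using a As by auto
    obtain j where "[card T * j = 1] (mod card A)" using cong_solve_coprime_nat[of "card T" "card A"] copT
      by (auto simp: coprime_commute)
    then have "[int (card T * j) = int 1] (mod int (card A))" unfolding cong_int_iff .
    then have "int (card A) dvd int (card T * j) - int 1" by (simp only: cong_iff_dvd_diff)
    moreover have "ord a dvd card A" using powA[OF a] pow_eq_id[OF ac] by blast
    ultimately have "int (ord a) dvd int 1 - int (card T * j)" by (metis dvd_diff_commute dvd_trans int_dvd_int_iff)
    then have "a [^] int (card T * j) = a [^] int 1" using int_pow_eq[OF ac] by blast
    then have "(a [^] j) [^] card T = a" using ac by (simp add: int_pow_int nat_pow_pow mult.commute del: of_nat_mult)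
    then show ?thesis using pow_in_subgroup[OF As(1) a] by blast
  qed
  define C where "C = {g \<in> carrier G. \<delta> g = \<one>}"
  have \<delta>1: "\<delta> \<one> = \<one>" using \<delta>_A[of \<one>] subgroup.one_closed[OF As(1)] by simp
  have C: "subgroup C G"
  proof (rule subgroupI)
    show "a \<otimes> b \<in> C" if "a \<in> C" "b \<in> C" for a b using that cocycle[of a b] by (simp add: C_def)
    show "inv a \<in> C" if "a \<in> C" for a
      using that cocycle[of "inv a" a] \<delta>1 \<delta>A[of "inv a"] As by (auto simp: C_def)
    show "C \<noteq> {}" using \<delta>1 by (auto simp: C_def)
  qed (auto simp: C_def)
  have "A \<inter> C = {\<one>}"
    using \<delta>_A trivA subgroup.one_closed[OF As(1)] subgroup.one_closed[OF C] by (auto simp: C_def)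
  moreover have "A <#> C = carrier G"
  proof
    show "A <#> C \<subseteq> carrier G" using set_mult_least[OF subgroup_self] As subgroup.subset[OF C] by blast
    show "carrier G \<subseteq> A <#> C"
    proof
      fix g assume g: "g \<in> carrier G"
      \<comment> \<open>\<open>a\<close> is chosen to cancel the cocycle:
        \<open>\<delta> (inv a) = inv (\<delta> g)\<close>, while conjugation by
        \<open>inv a\<close> fixes \<open>\<delta> g\<close> because \<open>A\<close> is
        abelian.\<close>
      obtain a where a: "a \<in> A" "a [^] card T = \<delta> g" using pow_surj[OF \<delta>A[OF g]] by blast
      have c: "a \<in> carrier G" "\<delta> g \<in> carrier G" using a As \<delta>A[OF g] by auto
      have ia: "inv a \<in> A" using a As by (simp add: subgroup.m_inv_closed)
      have "\<delta> (inv a \<otimes> g) = cj (inv a) (\<delta> g) \<otimes> \<delta> (inv a)" using cocycle g c by simp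
      also have "cj (inv a) (\<delta> g) = \<delta> g"
        using comm[OF ia \<delta>A[OF g]] c by (simp add: cj_commute)
      also have "\<delta> (inv a) = inv (\<delta> g)" using \<delta>_A[OF ia] a c by (simp add: nat_pow_inv)
      finally have "inv a \<otimes> g \<in> C" using c g by (simp add: C_def)
      moreover have "g = a \<otimes> (inv a \<otimes> g)" using c g by simp
      ultimately show "g \<in> A <#> C" unfolding set_mult_def using a by blast
    qed
  qed
  ultimately show thesis using that C by blast
qed

section \<open>The Schur-Zassenhaus theorem for sections\<close>

lemma derived_subset_iff:
  assumes "subgroup M G"
  shows "derived G N \<subseteq> M \<longleftrightarrow> (\<forall>a\<in>N. \<forall>b\<in>N. a \<otimes> b \<otimes> inv a \<otimes> inv b \<in> M)"
proof
  assume d: "derived G N \<subseteq> M"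
  show "\<forall>a\<in>N. \<forall>b\<in>N. a \<otimes> b \<otimes> inv a \<otimes> inv b \<in> M"
  proof (intro ballI)
    fix a b assume "a \<in> N" "b \<in> N"
    then have "a \<otimes> b \<otimes> inv a \<otimes> inv b \<in> derived G N" unfolding derived_def by (intro generate.incl) blast
    then show "a \<otimes> b \<otimes> inv a \<otimes> inv b \<in> M" using d by blast
  qed
next
  assume "\<forall>a\<in>N. \<forall>b\<in>N. a \<otimes> b \<otimes> inv a \<otimes> inv b \<in> M"
  then show "derived G N \<subseteq> M" unfolding derived_def by (intro generate_subgroup_incl[OF _ assms]) auto
qed

lemma normalises_derived:
  assumes N: "subgroup N G" and Y: "Y \<subseteq> carrier G" "normalises Y N"
  shows "normalises Y (derived G N)"
  unfolding normalises_def
proof (intro ballI)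
  fix y d assume y: "y \<in> Y" and d: "d \<in> derived G N"
  have yc: "y \<in> carrier G" using y Y by auto
  have Nc: "N \<subseteq> carrier G" using N subgroup.subset by auto
  have D: "subgroup (derived G N) G" by (rule derived_is_subgroup[OF Nc])
  have S: "subgroup (cj (inv y) ` derived G N) G" using subgroup_cj[OF D] yc by simp
  have "derived G N \<subseteq> cj (inv y) ` derived G N"
    unfolding derived_subset_iff[OF S]
  proof (intro ballI)
    fix a b assume ab: "a \<in> N" "b \<in> N"
    then have c: "a \<in> carrier G" "b \<in> carrier G" using Nc by auto
    have "cj y a \<in> N" "cj y b \<in> N" using ab y Y by (auto simp: normalises_def)
    then have "cj y a \<otimes> cj y b \<otimes> inv (cj y a) \<otimes> inv (cj y b) \<in> derived G N"
      using derived_subset_iff[OF D, of N] by blast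
    moreover have "cj y a \<otimes> cj y b \<otimes> inv (cj y a) \<otimes> inv (cj y b) = cj y (a \<otimes> b \<otimes> inv a \<otimes> inv b)"
      using c yc by (simp add: cj_mult cj_inv)
    ultimately have "cj (inv y) (cj y (a \<otimes> b \<otimes> inv a \<otimes> inv b)) \<in> cj (inv y) ` derived G N" by auto
    then show "a \<otimes> b \<otimes> inv a \<otimes> inv b \<in> cj (inv y) ` derived G N" using c yc by simp
  qed
  then obtain d' where "d' \<in> derived G N" "d = cj (inv y) d'" using d by blast
  then show "cj y d \<in> derived G N" using yc subgroup.mem_carrier[OF D] by simp
qed

text \<open>A maximal proper subgroup \<open>M\<close> above \<open>S\<close> is properly contained
  in its normaliser in \<open>P\<close>, by the double coset count with both groups equal to
  \<open>M\<close>. So \<open>M\<close> is normal with cyclic quotient. Prescribing \<open>S\<close>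
  allows \<open>M\<close> to be kept above an intersection.\<close>

lemma prime_power_group_not_perfect:
  assumes P: "subgroup P G" and p: "Factorial_Ring.prime p" "pi_number {p} (card P)"
    and S: "subgroup S G" "S \<subset> P"
  obtains M where "subgroup M G" "S \<subseteq> M" "M \<subset> P" "derived G P \<subseteq> M"
proof -
  let ?P = "\<lambda>M. subgroup M G \<and> S \<subseteq> M \<and> M \<subset> P"
  have PS: "?P S" using S by blast
  have PN: "M \<subseteq> P" if "?P M" for M using that by blast
  obtain M where "?P M" and max: "\<And>B. ?P B \<Longrightarrow> card B \<le> card M"
    using exists_max_card[where P = ?P, OF finite_subgroup[OF P] PS PN] by blast
  then have M: "subgroup M G" "S \<subseteq> M" "M \<subset> P" "M \<subseteq> P" by auto
  have Pc: "P \<subseteq> carrier G" using P subgroup.subset by auto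
  have "index P M \<noteq> 1" using index_one_iff[OF P M(1,4)] M by blast
  then obtain r where r: "Factorial_Ring.prime r" "r dvd index P M" using prime_factor_nat by blast
  then have "r dvd card P" using card_mult_index[OF P M(1,4)] by simp
  then have pd: "p dvd index P M" using r p by (auto simp: pi_number_def)
  have pM: "pi_number {p} (card M)"
    using pi_number_dvd[OF p(2)] card_mult_index[OF P M(1,4)] by simp
  let ?F = "{g\<in>P. M \<subseteq> cj g ` M}"
  have finF: "finite ?F" and FP: "?F \<subseteq> P" using finite_subgroup[OF P] by auto
  \<comment> \<open>The fixed elements form the normaliser of \<open>M\<close> in \<open>P\<close>.
    Their number turns out to be divisible by \<open>p * card M\<close>, so one of them lies outside
    \<open>M\<close>.\<close>
  have d1: "p * card M dvd card (P - ?F)" by (rule dvd_card_non_fixed_cosets[OF P M(1,4) M(1,4) p(1) pM])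
  have d2: "p * card M dvd card P"
    unfolding card_mult_index[OF P M(1,4)] using pd by (rule mult_dvd_mono) simp
  have "card P = card (P - ?F) + card ?F"
    using card_Diff_subset[OF finF FP] card_mono[OF finite_subgroup[OF P] FP] by linarith
  then have "p * card M dvd card (P - ?F) + card ?F" using d2 by (simp only:)
  then have d: "p * card M dvd card ?F" by (rule dvd_add_right_iff[OF d1, THEN iffD1])
  have MF: "M \<subseteq> ?F" using cj_image_self[OF M(1)] M by auto
  have "card ?F \<ge> p * card M"
    using d card_mono[OF finF MF] card_subgroup_pos[OF M(1)] by (intro dvd_imp_le) linarith+
  moreover have "p * card M > card M" using prime_gt_1_nat[OF p(1)] card_subgroup_pos[OF M(1)] by simp
  ultimately have "?F \<noteq> M" by auto
  then obtain g where g: "g \<in> P" "g \<notin> M" "M \<subseteq> cj g ` M" using MF by blast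
  have gc: "g \<in> carrier G" using g Pc by auto
  have "cj g ` M = M" using card_subset_eq[OF finite_subgroup[OF subgroup_cj[OF M(1) gc]] g(3)]
      card_cj_image[OF M(1) gc] by simp
  then have gM: "normalises {g} M" by (auto simp: normalises_def)
  note ad = adjoin_subgroup[OF M(1) gc gM] subset_adjoin[OF M(1) gc] adjoin_least[OF P M(4) g(1)]
  have "card M < card (adjoin M g)" using ad g by (intro psubset_card_mono) auto
  moreover have "card (adjoin M g) \<le> card M" if "adjoin M g \<noteq> P"
    using max[of "adjoin M g"] ad M(2) that by blast
  ultimately have eq: "adjoin M g = P" by fastforce
  have "derived G P \<subseteq> M"
    unfolding derived_subset_iff[OF M(1)]
  proof (intro ballI)
    fix y z assume "y \<in> P" "z \<in> P"
    then obtain m a n b where y: "m \<in> M" "y = m \<otimes> g [^] (a::nat)" and z: "n \<in> M" "z = n \<otimes> g [^] (b::nat)"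
      using mem_adjoin[OF gc, of _ M] eq by metis
    have c: "m \<in> carrier G" "n \<in> carrier G" using y z subgroup.mem_carrier[OF M(1)] by auto
    have gp: "g [^] k \<in> generate G {g}" for k :: nat
      using generate_pow_on_finite_carrier[OF finite_carrier gc] by auto
    have cjM: "cj (g [^] k) u \<in> M" if "u \<in> M" for k :: nat and u
      using normalises_generate[OF M(1) gc gM finite_carrier] gp[of k] that by (auto simp: normalises_def)
    have 1: "y \<otimes> z = (m \<otimes> cj (g [^] a) n) \<otimes> g [^] (a + b)"
      using y z c gc by (simp add: cj_def m_assoc nat_pow_mult[symmetric])
    have 2: "z \<otimes> y = (n \<otimes> cj (g [^] b) m) \<otimes> g [^] (a + b)"
      using y z c gc by (simp add: cj_def m_assoc nat_pow_mult[symmetric] add.commute[of a b])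
    have "y \<otimes> z \<otimes> inv y \<otimes> inv z = (y \<otimes> z) \<otimes> inv (z \<otimes> y)"
      using y z c gc by (simp add: m_assoc inv_mult_group)
    also have "\<dots> = (m \<otimes> cj (g [^] a) n) \<otimes> inv (n \<otimes> cj (g [^] b) m)"
      unfolding 1 2 using c gc by (simp add: m_assoc inv_mult_group)
    finally show "y \<otimes> z \<otimes> inv y \<otimes> inv z \<in> M"
      using cjM y z M(1) by (simp add: subgroup.m_closed subgroup.m_inv_closed)
  qed
  then show thesis using that M by blast
qed

text \<open>The complement theorem for abelian normal Hall subgroups is applied to the image of
  \<open>N\<close> in the quotient of \<open>J\<close> by \<open>K\<close>; \<open>H\<close> is the
  preimage of the complement found there.\<close>

lemma abelian_section_complement:
  assumes J: "subgroup J G" and K: "subgroup K G" and N: "subgroup N G" and sub: "K \<subseteq> N" "N \<subseteq> J"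
    and nK: "normalises J K" and nN: "normalises J N"
    and ab: "derived G N \<subseteq> K" and cop: "coprime (index N K) (index J N)"
  obtains H where "subgroup H G" "K \<subseteq> H" "H \<subseteq> J" "N <#> H = J" "N \<inter> H = K"
proof -
  let ?J = "G\<lparr>carrier := J\<rparr>"
  let ?Q = "?J Mod K"
  interpret Jg: finite_group ?J
    using subgroup_imp_group[OF J] finite_subgroup[OF J] by (simp add: finite_group_def finite_group_axioms_def)
  have Kn: "K \<lhd> ?J" using relative_normal_iff[OF J] K sub nK by auto
  interpret Kn: normal K ?J by (rule Kn)
  interpret Q: finite_group ?Q by (rule Jg.FactGroup_finite_group[OF Kn])
  have NJ: "N \<lhd> ?J" using relative_normal_iff[OF J] N sub nN by auto
  have Jc: "J \<subseteq> carrier G" using J subgroup.subset by auto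
  define A where "A = (\<lambda>x. K #>\<^bsub>?J\<^esub> x) ` N"
  have hom: "(\<lambda>x. K #>\<^bsub>?J\<^esub> x) \<in> hom ?J ?Q" by (rule Kn.r_coset_hom_Mod)
  have As: "A \<lhd> ?Q"
  proof -
    have "subgroup A ?Q" unfolding A_def
      using group_hom.subgroup_img_is_subgroup[of ?J ?Q "\<lambda>x. K #>\<^bsub>?J\<^esub> x" N] hom NJ
      by (simp add: group_hom_def group_hom_axioms_def Jg.is_group Q.is_group normal_imp_subgroup)
    moreover have "Q.cj x a \<in> A" if "x \<in> carrier ?Q" and aA: "a \<in> A" for x a
    proof -
      obtain y where y: "y \<in> J" "x = K #>\<^bsub>?J\<^esub> y" using \<open>x \<in> carrier ?Q\<close> by (auto simp: carrier_FactGroup)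
      obtain n where n: "n \<in> N" "a = K #>\<^bsub>?J\<^esub> n" using aA by (auto simp: A_def)
      have "Jg.cj y n \<in> N" using NJ y n by (auto simp: Jg.normal_iff Jg.normalises_def)
      then show ?thesis using Jg.rcos_cj[OF Kn, of y n] y n sub by (auto simp: A_def)
    qed
    ultimately show ?thesis by (auto simp: Q.normal_iff Q.normalises_def)
  qed
  have Acomm: "a \<otimes>\<^bsub>?Q\<^esub> b = b \<otimes>\<^bsub>?Q\<^esub> a" if aA: "a \<in> A" and bA: "b \<in> A" for a b
  proof -
    obtain m where m: "m \<in> N" "a = K #>\<^bsub>?J\<^esub> m" using aA by (auto simp: A_def)
    obtain n where n: "n \<in> N" "b = K #>\<^bsub>?J\<^esub> n" using bA by (auto simp: A_def)
    have c: "m \<in> J" "n \<in> J" "m \<in> carrier G" "n \<in> carrier G" using m n sub Jc by auto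
    have "m \<otimes> n \<otimes> inv m \<otimes> inv n \<in> K" using ab derived_subset_iff[OF K] m n by blast
    moreover have "m \<otimes> n \<otimes> inv m \<otimes> inv n = (m \<otimes> n) \<otimes> inv (n \<otimes> m)" using c by (simp add: m_assoc inv_mult_group)
    moreover have nm: "n \<otimes> m \<in> J" "m \<otimes> n \<in> J" using c J by (auto intro: subgroup.m_closed)
    ultimately have "(m \<otimes> n) \<otimes>\<^bsub>?J\<^esub> inv\<^bsub>?J\<^esub> (n \<otimes> m) \<in> K" using m_inv_consistent[OF J nm(1)] by simp
    then have "K #>\<^bsub>?J\<^esub> (m \<otimes> n) = K #>\<^bsub>?J\<^esub> (n \<otimes> m)" using Jg.rcos_eq_iff[OF Kn, of "m \<otimes> n" "n \<otimes> m"] nm by simp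
    then show ?thesis using m n c Kn.rcos_sum[of m n] Kn.rcos_sum[of n m] by simp
  qed
  have cardA: "card A = index N K"
  proof -
    have "A = carrier (G\<lparr>carrier := N\<rparr> Mod K)" by (auto simp: A_def carrier_FactGroup)
    then show ?thesis using order_FactGroup[OF N K sub(1) normalises_mono[OF nK sub(2)]] by (simp add: order_def)
  qed
  have cardQ: "card (carrier ?Q) = index J K"
    using order_FactGroup[OF J K _ nK] sub by (simp add: order_def)
  have "index (carrier ?Q) A = index J N"
  proof -
    have "index (carrier ?Q) A = (index J N * index N K) div index N K"
      using cardA cardQ index_trans[OF J N K sub] unfolding index_def[of "carrier ?Q"] by simp
    then show ?thesis using index_pos[OF N K sub(1)] by simp
  qed
  then have "coprime (card A) (index (carrier ?Q) A)" using cop cardA by simp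
  then obtain C where C: "subgroup C ?Q" "A <#>\<^bsub>?Q\<^esub> C = carrier ?Q" "A \<inter> C = {\<one>\<^bsub>?Q\<^esub>}"
    using Q.abelian_normal_hall_complement[OF As Acomm] by blast
  define H where "H = \<Union>C"
  have Hchar: "H = {x \<in> J. K #>\<^bsub>?J\<^esub> x \<in> C}" unfolding H_def using Kn.factgroup_subgroup_union_char[OF C(1)] by simp
  have H: "subgroup H ?J" unfolding H_def by (rule Kn.factgroup_subgroup_union_subgroup[OF C(1)])
  then have HG: "subgroup H G" "H \<subseteq> J" using relative_subgroup_iff[OF J] by auto
  have KH: "K \<subseteq> H" unfolding H_def using subgroup.one_closed[OF C(1)] by auto
  have "N \<inter> H \<subseteq> K"
  proof
    fix x assume x: "x \<in> N \<inter> H"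
    then have "K #>\<^bsub>?J\<^esub> x \<in> A \<inter> C" unfolding A_def Hchar by blast
    then have "K #>\<^bsub>?J\<^esub> x = K" using C(3) by simp
    then show "x \<in> K" using Jg.rcos_eq_self_iff[OF Kn, of x] x HG by auto
  qed
  moreover have "J \<subseteq> N <#> H"
  proof
    fix x assume x: "x \<in> J"
    then have "K #>\<^bsub>?J\<^esub> x \<in> A <#>\<^bsub>?Q\<^esub> C" using C(2) by (auto simp: carrier_FactGroup)
    then obtain a c where ac: "a \<in> A" "c \<in> C" "K #>\<^bsub>?J\<^esub> x = a \<otimes>\<^bsub>?Q\<^esub> c" unfolding set_mult_def by blast
    obtain n where n: "n \<in> N" "a = K #>\<^bsub>?J\<^esub> n" using ac by (auto simp: A_def)
    have nJ: "n \<in> J" "inv n \<in> J" using n sub J by (auto intro: subgroup.m_inv_closed)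
    have cc: "n \<in> carrier G" "x \<in> carrier G" using nJ x Jc by auto
    have "K #>\<^bsub>?J\<^esub> (inv n \<otimes> x) = (K #>\<^bsub>?J\<^esub> inv n) \<otimes>\<^bsub>?Q\<^esub> (K #>\<^bsub>?J\<^esub> x)" using Kn.rcos_sum[of "inv n" x] nJ x by simp
    also have "K #>\<^bsub>?J\<^esub> inv n = inv\<^bsub>?Q\<^esub> a"
      using n nJ Kn.inv_FactGroup[of a] Kn.rcos_inv[of n] m_inv_consistent[OF J nJ(1)] by (simp add: carrier_FactGroup)
    also have "inv\<^bsub>?Q\<^esub> a \<otimes>\<^bsub>?Q\<^esub> (K #>\<^bsub>?J\<^esub> x) = c"
      unfolding ac(3) using ac As C(1) subgroup.mem_carrier by (metis Q.inv_mult_cancel(1) Q.normal_iff)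
    finally have "inv n \<otimes> x \<in> H" unfolding Hchar using ac nJ x J by (auto intro: subgroup.m_closed)
    moreover have "x = n \<otimes> (inv n \<otimes> x)" using cc by simp
    ultimately show "x \<in> N <#> H" unfolding set_mult_def using n by blast
  qed
  moreover have "N <#> H \<subseteq> J" by (rule set_mult_least[OF J sub(2) HG(2)])
  ultimately show thesis using that[OF HG(1) KH HG(2)] KH sub by blast
qed

lemma set_mult_absorb:
  assumes "subgroup N G" "A \<subseteq> N" "subgroup H G" "N <#> (A <#> H) = J" "\<one> \<in> A"
  shows "N <#> H = J"
proof -
  have c: "N \<subseteq> carrier G" "H \<subseteq> carrier G" using assms subgroup.subset by auto
  have "N <#> (A <#> H) = (N <#> A) <#> H" using c assms by (intro set_mult_assoc[symmetric]) auto
  also have "N <#> A = N"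
  proof
    show "N <#> A \<subseteq> N" by (rule set_mult_least) (use assms in auto)
    show "N \<subseteq> N <#> A"
    proof
      fix x assume "x \<in> N"
      then have "x = x \<otimes> \<one>" using c by auto
      then show "x \<in> N <#> A" unfolding set_mult_def using \<open>x \<in> N\<close> assms(5) by blast
    qed
  qed
  finally show ?thesis using assms by simp
qed

text \<open>\<open>H\<close> is the normaliser in \<open>J\<close> of \<open>K <#> P\<close> for a
  Sylow subgroup \<open>P\<close> of \<open>N\<close>, and the Frattini argument gives
  \<open>N <#> H = J\<close>. If \<open>H = J\<close>, minimality makes \<open>N/K\<close> a
  \<open>p\<close>-group; its derived subgroup is proper and invariant, hence trivial by minimality,
  and \<open>N/K\<close> is abelian after all.\<close>

lemma non_abelian_section_reduction:
  assumes J: "subgroup J G" and K: "subgroup K G" and N: "subgroup N G" and sub: "K \<subset> N" "N \<subseteq> J"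
    and nK: "normalises J K" and nN: "normalises J N"
    and chief: "\<forall>L. subgroup L G \<longrightarrow> K \<subseteq> L \<longrightarrow> L \<subseteq> N \<longrightarrow> normalises J L \<longrightarrow> L = K \<or> L = N"
    and nab: "\<not> derived G N \<subseteq> K"
  obtains H where "subgroup H G" "K \<subseteq> H" "H \<subset> J" "N <#> H = J"
proof -
  have sub': "K \<subseteq> N" using sub by blast
  have Jc: "J \<subseteq> carrier G" using J subgroup.subset by auto
  have "index N K \<noteq> 1" using index_one_iff[OF N K sub'] sub by blast
  then obtain p where p: "Factorial_Ring.prime p" "p dvd index N K" using prime_factor_nat by blast
  obtain P where P: "sylow_of p N P" using sylow_of_exists[OF N p(1)] .
  then have Ps: "subgroup P G" "P \<subseteq> N" "pi_number {p} (card P)" "\<not> p dvd index N P" by (auto simp: sylow_of_def)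
  have PJ: "P \<subseteq> J" using Ps sub by blast
  have nPK: "normalises P K" by (rule normalises_mono[OF nK PJ])
  have KP: "subgroup (K <#> P) G" "K \<subseteq> K <#> P" "P \<subseteq> K <#> P" "K <#> P \<subseteq> N"
    using set_mult_subgroup[OF K Ps(1) nPK] subset_set_mult[OF K Ps(1)] set_mult_least[OF N sub' Ps(2)] by auto
  have PnK: "\<not> P \<subseteq> K"
  proof
    assume "P \<subseteq> K"
    then show False using index_trans[OF N K Ps(1) _ sub'] p Ps(4) by simp
  qed
  define H where "H = J \<inter> normalizer G (K <#> P)"
  have H: "subgroup H G" unfolding H_def by (rule subgroups_Inter_pair[OF J normalizer_subgroup[OF KP(1)]])
  have nKP: "normalises (K <#> P) (K <#> P)" by (rule normalises_self[OF KP(1)])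
  have KH: "K \<subseteq> H"
  proof
    fix x assume x: "x \<in> K"
    then have "normalises {x} (K <#> P)" using nKP KP by (auto simp: normalises_def)
    moreover have "x \<in> carrier G" using x K subgroup.mem_carrier by metis
    ultimately show "x \<in> H" unfolding H_def using x sub mem_normalizer[OF KP(1)] by blast
  qed
  have le: "J \<inter> normalizer G P \<subseteq> H"
  proof
    fix x assume x: "x \<in> J \<inter> normalizer G P"
    then have xc: "x \<in> carrier G" using Jc by auto
    have "normalises {x} (K <#> P)"
    proof (rule normalises_set_mult)
      show "normalises {x} K" using nK x by (auto simp: normalises_def)
      show "normalises {x} P" using x mem_normalizer[OF Ps(1)] by auto
    qed (use xc subgroup.subset[OF K] subgroup.subset[OF Ps(1)] in auto)
    then show "x \<in> H" unfolding H_def using x xc mem_normalizer[OF KP(1)] by auto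
  qed
  have NH: "N <#> H = J"
  proof
    show "N <#> H \<subseteq> J" by (rule set_mult_least[OF J sub(2)]) (auto simp: H_def)
    show "J \<subseteq> N <#> H"
      using frattini_argument[OF J N sub(2) nN p(1) P] mono_set_mult[OF order_refl[of N] le] by blast
  qed
  have "H \<noteq> J"
  proof
    assume "H = J"
    then have "normalises J (K <#> P)" unfolding H_def using normalises_iff_normalizer[OF KP(1) Jc] by blast
    then have "K <#> P = K \<or> K <#> P = N" using chief KP by blast
    then have eqN: "K <#> P = N" using PnK KP by blast
    \<comment> \<open>\<open>M\<close> will contain \<open>P \<inter> K\<close>, so that
      \<open>K <#> M\<close> meets \<open>P\<close> only in \<open>M\<close> and stays proper in
      \<open>N\<close>.\<close>
    have "subgroup (P \<inter> K) G" "P \<inter> K \<subset> P" using subgroups_Inter_pair[OF Ps(1) K] PnK by auto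
    then obtain M where M: "subgroup M G" "P \<inter> K \<subseteq> M" "M \<subset> P" "derived G P \<subseteq> M"
      using prime_power_group_not_perfect[OF Ps(1) p(1) Ps(3)] by metis
    have nMK: "normalises M K" using normalises_mono[OF nPK] M by blast
    have KM: "subgroup (K <#> M) G" "K \<subseteq> K <#> M" "M \<subseteq> K <#> M"
      using set_mult_subgroup[OF K M(1) nMK] subset_set_mult[OF K M(1)] by auto
    \<comment> \<open>Modulo \<open>K\<close> the group \<open>N\<close> is an image of
      \<open>P\<close>, so its commutators come from those of \<open>P\<close>, which lie in
      \<open>M\<close>.\<close>
    have dM: "derived G N \<subseteq> K <#> M"
      unfolding derived_subset_iff[OF KM(1)]
    proof (intro ballI)
      fix a b assume "a \<in> N" "b \<in> N"
      then obtain k y l z where ab: "k \<in> K" "y \<in> P" "a = k \<otimes> y" "l \<in> K" "z \<in> P" "b = l \<otimes> z"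
        unfolding eqN[symmetric] set_mult_def by blast
      have c: "k \<in> carrier G" "y \<in> carrier G" "l \<in> carrier G" "z \<in> carrier G"
        using ab subgroup.mem_carrier[OF K] subgroup.mem_carrier[OF Ps(1)] by auto
      have 1: "a \<otimes> b = (k \<otimes> cj y l) \<otimes> (y \<otimes> z)" using ab c by (simp add: cj_def m_assoc)
      have 2: "b \<otimes> a = (l \<otimes> cj z k) \<otimes> (z \<otimes> y)" using ab c by (simp add: cj_def m_assoc)
      have "a \<otimes> b \<otimes> inv a \<otimes> inv b = (a \<otimes> b) \<otimes> inv (b \<otimes> a)" using ab c by (simp add: m_assoc inv_mult_group)
      also have "\<dots> = (k \<otimes> cj y l) \<otimes> (y \<otimes> z \<otimes> inv y \<otimes> inv z) \<otimes> inv (l \<otimes> cj z k)"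
        unfolding 1 2 using c by (simp add: m_assoc inv_mult_group)
      finally have "a \<otimes> b \<otimes> inv a \<otimes> inv b
          = (k \<otimes> cj y l) \<otimes> (y \<otimes> z \<otimes> inv y \<otimes> inv z) \<otimes> inv (l \<otimes> cj z k)" .
      moreover have "y \<otimes> z \<otimes> inv y \<otimes> inv z \<in> M" using M(4) derived_subset_iff[OF M(1)] ab by blast
      then have "y \<otimes> z \<otimes> inv y \<otimes> inv z \<in> K <#> M" using KM by blast
      moreover have "k \<otimes> cj y l \<in> K" "l \<otimes> cj z k \<in> K"
        using ab nPK K by (auto simp: normalises_def intro: subgroup.m_closed)
      then have "k \<otimes> cj y l \<in> K <#> M" "inv (l \<otimes> cj z k) \<in> K <#> M"
        using KM(2) subgroup.m_inv_closed[OF KM(1)] by auto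
      ultimately show "a \<otimes> b \<otimes> inv a \<otimes> inv b \<in> K <#> M"
        using subgroup.m_closed[OF KM(1)] by simp
    qed
    have Nc: "N \<subseteq> carrier G" using N subgroup.subset by auto
    have D: "subgroup (derived G N) G" by (rule derived_is_subgroup[OF Nc])
    have DJ: "derived G N \<subseteq> J" using derived_incl[OF order_refl N] sub by blast
    let ?L = "K <#> derived G N"
    have L: "subgroup ?L G" by (rule set_mult_subgroup[OF K D normalises_mono[OF nK DJ]])
    have LJ: "normalises J ?L"
      using normalises_set_mult[OF nK normalises_derived[OF N Jc nN] Jc] subgroup.subset[OF K] subgroup.subset[OF D] by blast
    have LM: "?L \<subseteq> K <#> M" by (rule set_mult_least[OF KM(1,2) dM])
    have LN: "?L \<subseteq> N" by (rule set_mult_least[OF N sub']) (rule derived_incl[OF order_refl N])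
    have KL: "K \<subseteq> ?L" "derived G N \<subseteq> ?L" using subset_set_mult[OF K D] by auto
    have "?L \<noteq> K" using nab KL by blast
    then have "?L = N" using chief L KL(1) LN LJ by blast
    then have PKM: "P \<subseteq> K <#> M" using LM Ps by blast
    have "P \<subseteq> M"
    proof
      fix y assume y: "y \<in> P"
      then obtain k m where km: "k \<in> K" "m \<in> M" "y = k \<otimes> m" using PKM unfolding set_mult_def by blast
      have c: "k \<in> carrier G" "m \<in> carrier G" using km subgroup.mem_carrier[OF K] subgroup.mem_carrier[OF M(1)] by auto
      have mP: "m \<in> P" using km M by blast
      have "k = y \<otimes> inv m" using km c by (simp add: m_assoc)
      then have "k \<in> P" using y mP Ps(1) by (simp add: subgroup.m_closed subgroup.m_inv_closed)
      then have "k \<in> M" using km M by blast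
      then show "y \<in> M" using km M(1) by (simp add: subgroup.m_closed)
    qed
    then show False using M by blast
  qed
  then have "H \<subset> J" using H_def by blast
  then show thesis using that[OF H KH _ NH] by blast
qed

text \<open>Induction on \<open>index J K\<close> with all three groups varying, which replaces
  passing to quotients and subgroups. An invariant \<open>L\<close> strictly between
  \<open>K\<close> and \<open>N\<close> is handled by complementing \<open>N/L\<close> in
  \<open>J/L\<close> and then \<open>L/K\<close> inside the subgroup found. Otherwise the section is
  abelian, or there is a proper supplement \<open>H\<close> of \<open>N\<close>, in which
  \<open>N \<inter> H\<close> is complemented modulo \<open>K\<close>.\<close>

theorem schur_zassenhaus_section:
  assumes "subgroup J G" "subgroup K G" "subgroup N G" "K \<subseteq> N" "N \<subseteq> J"
    and "normalises J K" "normalises J N" "coprime (index N K) (index J N)"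
  shows "\<exists>H. subgroup H G \<and> K \<subseteq> H \<and> H \<subseteq> J \<and> N <#> H = J \<and> N \<inter> H = K"
  using assms
proof (induction "index J K" arbitrary: J K N rule: less_induct)
  case (less J K N)
  note J = less.prems(1) and K = less.prems(2) and N = less.prems(3) and KN = less.prems(4) and NJ = less.prems(5)
    and nK = less.prems(6) and nN = less.prems(7) and cop = less.prems(8)
  have KJ: "K \<subseteq> J" using KN NJ by blast
  have idx: "index J K = index J N * index N K" by (rule index_trans[OF J N K KN NJ])
  show ?case
  proof (cases "K = N")
    case True
    have "N <#> J = J" using set_mult_least[OF J NJ order_refl] subset_set_mult[OF N J] by blast
    then show ?thesis using True J NJ by blast
  next
    case False
    then have KN': "K \<subset> N" using KN by blast
    consider (middle) L where "subgroup L G" "K \<subset> L" "L \<subset> N" "normalises J L"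
      | (abelian) "derived G N \<subseteq> K"
      | (frattini) "\<forall>L. subgroup L G \<longrightarrow> K \<subseteq> L \<longrightarrow> L \<subseteq> N \<longrightarrow> normalises J L \<longrightarrow> L = K \<or> L = N" "\<not> derived G N \<subseteq> K"
      by blast
    then show ?thesis
    proof cases
      case (middle L)
      have L: "subgroup L G" "K \<subseteq> L" "L \<subseteq> N" "L \<subseteq> J" using middle NJ by auto
      have iNK: "index N K = index N L * index L K" by (rule index_trans[OF N L(1) K L(2,3)])
      have "index L K \<noteq> 1" using index_one_iff[OF L(1) K L(2)] middle by blast
      then have "index J L < index J K"
        using index_trans[OF J L(1) K L(2,4)] index_pos[OF J L(1,4)] index_pos[OF L(1) K L(2)] by simp
      moreover have "coprime (index N L) (index J N)" using cop iNK by simp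
      ultimately obtain H where H: "subgroup H G" "L \<subseteq> H" "H \<subseteq> J" "N <#> H = J" "N \<inter> H = L"
        using less.hyps[of J L N] J L N NJ middle(4) nN by blast
      \<comment> \<open>\<open>L\<close> is proper in \<open>N\<close>, so \<open>H\<close> is
        proper in \<open>J\<close>, and the induction hypothesis is available a second time.\<close>
      have "H \<noteq> J" using H(5) middle(3) NJ by blast
      then have "index J H \<noteq> 1" using index_one_iff[OF J H(1,3)] by blast
      moreover have KH: "K \<subseteq> H" using L H by blast
      ultimately have lt: "index H K < index J K"
        using index_trans[OF J H(1) K KH H(3)] index_pos[OF J H(1,3)] index_pos[OF H(1) K KH] by simp
      have "index H L = index J N"
        using index_set_mult(1)[OF N H(1) normalises_mono[OF nN H(3)]] H(4,5) by (simp add: Int_commute)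
      then have "coprime (index L K) (index H L)" using cop iNK by simp
      then obtain C where C: "subgroup C G" "K \<subseteq> C" "C \<subseteq> H" "L <#> C = H" "L \<inter> C = K"
        using less.hyps[OF lt H(1) K L(1,2) H(2)] normalises_mono[OF nK H(3)] normalises_mono[OF middle(4) H(3)] by blast
      have "N <#> C = J"
        using set_mult_absorb[OF N L(3) C(1)] C(4) H(4) subgroup.one_closed[OF L(1)] by simp
      moreover have "N \<inter> C = K" using C(3,5) H(5) by blast
      ultimately show ?thesis using C H by blast
    next
      case abelian
      then show ?thesis using abelian_section_complement[OF J K N KN NJ nK nN _ cop] by metis
    next
      case frattini
      obtain H where H: "subgroup H G" "K \<subseteq> H" "H \<subset> J" "N <#> H = J"
        using non_abelian_section_reduction[OF J K N KN' NJ nK nN frattini] by metis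
      have HJ: "H \<subseteq> J" using H by blast
      have I: "subgroup (N \<inter> H) G" "K \<subseteq> N \<inter> H" "N \<inter> H \<subseteq> H" using subgroups_Inter_pair[OF N H(1)] KN H by auto
      have "index J H \<noteq> 1" using index_one_iff[OF J H(1) HJ] H by blast
      then have lt: "index H K < index J K"
        using index_trans[OF J H(1) K H(2) HJ] index_pos[OF J H(1) HJ] index_pos[OF H(1) K H(2)] by simp
      have "index H (N \<inter> H) = index J N"
        using index_set_mult(1)[OF N H(1) normalises_mono[OF nN HJ]] H(4) by (simp add: Int_commute)
      moreover have "index N K = index N (N \<inter> H) * index (N \<inter> H) K"
        using index_trans[OF N I(1) K I(2)] by blast
      ultimately have "coprime (index (N \<inter> H) K) (index H (N \<inter> H))" using cop by simp
      moreover have "normalises H (N \<inter> H)"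
        using normalises_mono[OF nN HJ] normalises_self[OF H(1)] by (auto simp: normalises_def)
      ultimately obtain C where C: "subgroup C G" "K \<subseteq> C" "C \<subseteq> H" "(N \<inter> H) <#> C = H" "(N \<inter> H) \<inter> C = K"
        using less.hyps[OF lt H(1) K I(1,2,3) normalises_mono[OF nK HJ]] by blast
      have "N <#> C = J"
        using set_mult_absorb[OF N _ C(1), of "N \<inter> H"] C(4) H(4) subgroup.one_closed[OF I(1)] by simp
      moreover have "N \<inter> C = K" using C(3,5) by blast
      ultimately show ?thesis using C H by blast
    qed
  qed
qed

section \<open>Hall subgroups for the classes of the partition\<close>

context
  fixes I :: "'i set" and \<sigma> :: "'i \<Rightarrow> nat set"
  assumes part: "prime_partition I \<sigma>"
    and sol: "\<And>K. \<lbrakk>K \<lhd> G; K \<noteq> carrier G\<rbrakk> \<Longrightarrow> \<exists>N i. i \<in> I \<and> N \<lhd> G \<and> K \<subset> N \<and> pi_number (\<sigma> i) (index N K)"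
begin

text \<open>Above \<open>K\<close> lies a \<open>\<sigma> j\<close>-section \<open>N/K\<close>, and
  by induction \<open>Y\<close> is a Hall subgroup modulo \<open>N\<close>. For \<open>j = i\<close>
  it is also one modulo \<open>K\<close>. Otherwise \<open>N/K\<close> is a normal subgroup of
  \<open>Y/K\<close> with coprime order and index, and its complement is the required group.\<close>

lemma sigma_hall_exists:
  assumes i: "i \<in> I" and K: "K \<lhd> G"
  shows "\<exists>E. subgroup E G \<and> K \<subseteq> E \<and> pi_number (\<sigma> i) (index E K) \<and> pi_number (- \<sigma> i) (index (carrier G) E)"
  using K
proof (induction "index (carrier G) K" arbitrary: K rule: less_induct)
  case (less K)
  have K: "subgroup K G" "normalises (carrier G) K" "K \<subseteq> carrier G" using less.prems subgroup.subset by (auto simp: normal_iff)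
  show ?case
  proof (cases "K = carrier G")
    case True
    then show ?thesis using subgroup_self by (intro exI[of _ "carrier G"]) (simp add: pi_number_def)
  next
    case False
    then obtain N j where N: "j \<in> I" "N \<lhd> G" "K \<subset> N" "pi_number (\<sigma> j) (index N K)" using sol[OF less.prems] by blast
    have Ns: "subgroup N G" "normalises (carrier G) N" "N \<subseteq> carrier G" "K \<subseteq> N"
      using N subgroup.subset by (auto simp: normal_iff)
    have "index N K \<noteq> 1" using index_one_iff[OF Ns(1) K(1) Ns(4)] N by blast
    then have "index (carrier G) N < index (carrier G) K"
      using index_trans[OF subgroup_self Ns(1) K(1) Ns(4,3)] index_pos[OF subgroup_self Ns(1,3)] index_pos[OF Ns(1) K(1) Ns(4)] by simp
    then obtain Y where Y: "subgroup Y G" "N \<subseteq> Y" "pi_number (\<sigma> i) (index Y N)" "pi_number (- \<sigma> i) (index (carrier G) Y)"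
      using less.hyps[OF _ N(2)] by blast
    have Yc: "Y \<subseteq> carrier G" using Y subgroup.subset by auto
    show ?thesis
    proof (cases "j = i")
      case True
      have "index Y K = index Y N * index N K" by (rule index_trans[OF Y(1) Ns(1) K(1) Ns(4) Y(2)])
      then have "pi_number (\<sigma> i) (index Y K)" using Y N True by (simp add: pi_number_mult)
      then show ?thesis using Y Ns by blast
    next
      case False
      have "\<sigma> j \<inter> \<sigma> i = {}" using part False N i unfolding prime_partition_def disjoint_family_on_def by blast
      then have nk: "pi_number (- \<sigma> i) (index N K)" using pi_number_mono[OF N(4)] by blast
      then have "coprime (index N K) (index Y N)" using coprime_pi_number[OF Y(3)] by (simp add: coprime_commute)
      then obtain H where H: "subgroup H G" "K \<subseteq> H" "H \<subseteq> Y" "N <#> H = Y" "N \<inter> H = K"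
        using schur_zassenhaus_section[OF Y(1) K(1) Ns(1,4) Y(2)] normalises_mono[OF K(2) Yc] normalises_mono[OF Ns(2) Yc] by blast
      have Hc: "H \<subseteq> carrier G" using subgroup.subset[OF H(1)] .
      note im = index_set_mult[OF Ns(1) H(1) normalises_mono[OF Ns(2) Hc]]
      have "index H K = index Y N" using im(1) H by (simp add: Int_commute)
      moreover have "index Y H = index N K" using im(2) H by (simp add: Int_commute)
      ultimately have "pi_number (\<sigma> i) (index H K)" "pi_number (- \<sigma> i) (index (carrier G) H)"
        using Y nk index_trans[OF subgroup_self Y(1) H(1,3) Yc] by (auto simp: pi_number_mult)
      then show ?thesis using H by blast
    qed
  qed
qed

end

text \<open>For \<open>H\<close> normal in a normal subgroup, the aim is to find, for each prime, a
  Sylow subgroup of \<open>H\<close> that also lies in a given conjugate of \<open>H\<close>. Then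
  no prime divides the index in \<open>H\<close> of the intersection of the two.\<close>

lemma normality_transitive_of_sylow:
  assumes R: "\<And>p P K. \<lbrakk>Factorial_Ring.prime p; sylow_of p (carrier G) P; subgroup K G; K \<subseteq> P\<rbrakk> \<Longrightarrow> normalises (normalizer G P) K"
  shows "normality_transitive"
proof -
  \<comment> \<open>\<open>P\<close> and its conjugate under \<open>u\<close> both lie in the
    normalizer of the conjugate of \<open>Q\<close>, since a Sylow subgroup normalises its own
    subgroups. They are Sylow there, so some \<open>v\<close> in that normalizer brings the second
    back to \<open>P\<close>. Then \<open>v \<otimes> u\<close> normalises \<open>P\<close> and
    hence \<open>Q\<close>, while \<open>v\<close> leaves the conjugate of \<open>Q\<close>
    fixed.\<close>
  have weak: "cj u ` Q = Q"
    if p: "Factorial_Ring.prime p" and P: "sylow_of p (carrier G) P" and Q: "subgroup Q G" "Q \<subseteq> P"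
      and u: "u \<in> carrier G" and uQ: "cj u ` Q \<subseteq> P" for p P Q u
  proof -
    have Ps: "subgroup P G" "P \<subseteq> carrier G" using P by (auto simp: sylow_of_def)
    let ?Q = "cj u ` Q"
    have Qc: "Q \<subseteq> carrier G" using Q subgroup.subset by auto
    have Q': "subgroup ?Q G" by (rule subgroup_cj[OF Q(1) u])
    have PN: "P \<subseteq> normalizer G P" using normalises_iff_normalizer[OF Ps] normalises_self[OF Ps(1)] by blast
    let ?N = "normalizer G ?Q"
    have N: "subgroup ?N G" "?N \<subseteq> carrier G" using normalizer_subgroup[OF Q'] subgroup.subset by auto
    have 1: "P \<subseteq> ?N" using normalises_iff_normalizer[OF Q' Ps(2)] normalises_mono[OF R[OF p P Q' uQ] PN] by blast
    have QP: "normalises P Q" by (rule normalises_mono[OF R[OF p P Q] PN])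
    have uP: "cj u ` P \<subseteq> carrier G" using Ps u by auto
    have "normalises (cj u ` P) ?Q"
      unfolding normalises_def
    proof clarify
      fix y x assume yx: "y \<in> P" "x \<in> Q"
      have c: "y \<in> carrier G" "x \<in> carrier G" using yx Ps Qc by auto
      have "cj (cj u y) (cj u x) = cj u (cj y x)" using c u by (simp add: cj_def m_assoc inv_mult_group)
      then show "cj (cj u y) (cj u x) \<in> cj u ` Q" using QP yx by (auto simp: normalises_def)
    qed
    then have 2: "cj u ` P \<subseteq> ?N" using normalises_iff_normalizer[OF Q' uP] by blast
    have sN: "sylow_of p ?N S" if S: "sylow_of p (carrier G) S" "S \<subseteq> ?N" for S
      using S index_trans[OF subgroup_self N(1) _ S(2) N(2)] by (auto simp: sylow_of_def)
    have "sylow_of p (carrier G) (cj u ` P)"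
      using sylow_of_cj[OF subgroup_self P u] u by (simp add: normalises_def)
    then obtain v where v: "v \<in> ?N" "P = cj v ` cj u ` P"
      using sylow_conjugate[OF N(1) p sN[OF _ 2] sN[OF P 1]] by metis
    have vc: "v \<in> carrier G" using v N by auto
    have "cj (v \<otimes> u) ` P = P" using v vc u Ps cj_image_cj by simp
    then have "v \<otimes> u \<in> normalizer G P" using mem_normalizer[OF Ps(1)] vc u by (auto simp: normalises_def)
    then have "normalises {v \<otimes> u} Q" using normalises_mono[OF R[OF p P Q]] by blast
    then have "cj (v \<otimes> u) ` Q = Q" using normalises_image[OF Q(1)] vc u by simp
    moreover have "cj (v \<otimes> u) ` Q = cj v ` ?Q" using cj_image_cj[OF vc u Qc] by simp
    moreover have "cj v ` ?Q = ?Q" using normalises_image[OF Q'] mem_normalizer[OF Q'] v by blast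
    ultimately show ?thesis by simp
  qed
  show ?thesis
    unfolding normality_transitive_def
  proof (intro allI impI)
    fix H L assume Ln: "L \<lhd> G" and H: "subgroup H G" "H \<subseteq> L" "normalises L H"
    have L: "subgroup L G" "normalises (carrier G) L" "L \<subseteq> carrier G" using Ln subgroup.subset by (auto simp: normal_iff)
    have Hc: "H \<subseteq> carrier G" using H L by blast
    have "cj g ` H = H" if g: "g \<in> carrier G" for g
    proof -
      let ?H = "cj g ` H"
      have H': "subgroup ?H G" by (rule subgroup_cj[OF H(1) g])
      have HL: "?H \<subseteq> L" using H L g by (auto simp: normalises_def)
      have nH: "normalises ?H H" by (rule normalises_mono[OF H(3) HL])
      let ?J = "H <#> ?H"
      have J: "subgroup ?J G" "H \<subseteq> ?J" "?H \<subseteq> ?J"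
        using set_mult_subgroup[OF H(1) H' nH] subset_set_mult[OF H(1) H'] by auto
      have I: "subgroup (H \<inter> ?H) G" by (rule subgroups_Inter_pair[OF H(1) H'])
      have "index H (H \<inter> ?H) = 1"
      proof (rule ccontr)
        assume "index H (H \<inter> ?H) \<noteq> 1"
        then obtain p where p: "Factorial_Ring.prime p" "p dvd index H (H \<inter> ?H)" using prime_factor_nat by blast
        obtain Q where Q: "sylow_of p H Q" using sylow_of_exists[OF H(1) p(1)] .
        then have Qs: "subgroup Q G" "Q \<subseteq> H" "pi_number {p} (card Q)" "\<not> p dvd index H Q" by (auto simp: sylow_of_def)
        have Qc: "Q \<subseteq> carrier G" using Qs Hc by blast
        have QJ: "Q \<subseteq> ?J" using Qs J by blast
        obtain S where S: "sylow_of p ?J S" "Q \<subseteq> S" using sylow_containing[OF J(1) p(1) Qs(1) QJ Qs(3)] .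
        have Ss: "subgroup S G" "pi_number {p} (card S)" "S \<subseteq> carrier G"
          using S subgroup.subset by (auto simp: sylow_of_def)
        obtain P where P: "sylow_of p (carrier G) P" "S \<subseteq> P"
          using sylow_containing[OF subgroup_self p(1) Ss(1,3,2)] .
        have gQ: "subgroup (cj g ` Q) G" "cj g ` Q \<subseteq> ?J" "pi_number {p} (card (cj g ` Q))"
          using subgroup_cj[OF Qs(1) g] card_cj_image[OF Qs(1) g] Qs J by auto
        obtain y where y: "y \<in> ?J" "cj g ` Q \<subseteq> cj y ` S" using sylow_contains_conjugate[OF J(1) p(1) S(1) gQ] .
        have yc: "y \<in> carrier G" using y J(1) subgroup.mem_carrier by metis
        have "cj (inv y \<otimes> g) ` Q = cj (inv y) ` cj g ` Q" using cj_image_cj[of "inv y" g Q] yc g Qc by simp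
        also have "\<dots> \<subseteq> cj (inv y) ` cj y ` S" using y by blast
        also have "\<dots> = S" using cj_image_cj[of "inv y" y S] yc Ss by (simp add: subset_iff)
        finally have "cj (inv y \<otimes> g) ` Q \<subseteq> P" using P by blast
        then have fixQ: "cj (inv y \<otimes> g) ` Q = Q" using weak[OF p(1) P(1) Qs(1)] S P yc g by (meson inv_closed m_closed subset_trans)
        have "inv y \<in> ?J" using y J by (simp add: subgroup.m_inv_closed)
        \<comment> \<open>The factorisation splits \<open>fixQ\<close>: moving \<open>Q\<close> by
          \<open>g\<close> and then by \<open>k\<close> stays inside \<open>?H\<close>, and moving
          it by \<open>inv h\<close> stays inside \<open>H\<close>, but the results agree. So a
          Sylow subgroup of \<open>H\<close> lies in both.\<close>
        then obtain h k where hk: "h \<in> H" "k \<in> ?H" "inv y = h \<otimes> k" unfolding set_mult_def by blast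
        have c: "h \<in> carrier G" "k \<in> carrier G" using hk Hc subgroup.mem_carrier[OF H'] by auto
        have "cj h ` cj k ` cj g ` Q = Q" using fixQ hk c g Qc cj_image_cj by (simp add: image_subset_iff subset_iff m_assoc)
        then have "cj (inv h) ` cj h ` cj k ` cj g ` Q = cj (inv h) ` Q" by simp
        moreover have "cj (inv h) ` cj h ` Z = Z" if "Z \<subseteq> carrier G" for Z
          using cj_image_cj[of "inv h" h Z] c that by (simp add: subset_iff)
        moreover have "cj k ` cj g ` Q \<subseteq> carrier G" using c g Qc by auto
        ultimately have eq: "cj k ` cj g ` Q = cj (inv h) ` Q" by simp
        let ?Q = "cj (inv h) ` Q"
        have Q': "subgroup ?Q G" "card ?Q = card Q" using subgroup_cj[OF Qs(1)] card_cj_image[OF Qs(1)] c by auto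
        have "?Q \<subseteq> H" using Qs hk H(1) by (auto intro!: cj_in_subgroup subgroup.m_inv_closed)
        moreover have "cj k ` cj g ` Q \<subseteq> ?H"
        proof -
          have "cj k ` cj g ` Q \<subseteq> cj k ` ?H" using Qs by blast
          then show ?thesis using cj_image_self[OF H' hk(2)] by simp
        qed
        ultimately have "?Q \<subseteq> H \<inter> ?H" using eq by simp
        then have "index H ?Q = index H (H \<inter> ?H) * index (H \<inter> ?H) ?Q"
          using index_trans[OF H(1) I Q'(1)] by blast
        then have "p dvd index H ?Q" using p by simp
        then show False using Qs(4) Q' by (simp add: index_def)
      qed
      then have "H \<subseteq> ?H" using index_one_iff[OF H(1) I] by blast
      then show ?thesis using card_subset_eq[OF finite_subgroup[OF H']] card_cj_image[OF H(1) g] by metis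
    qed
    then show "H \<lhd> G" using H by (auto simp: normal_iff normalises_def)
  qed
qed

text \<open>\<open>index L (E \<inter> L)\<close> is prime to \<open>\<sigma> i\<close>, so
  \<open>E \<inter> L\<close> covers \<open>L/K\<close>, and by the modular law
  \<open>E \<inter> H\<close> covers \<open>H/K\<close>. As \<open>E\<close> normalises all its
  subgroups, \<open>L\<close> normalises \<open>H\<close>, and transitivity of normality
  finishes.\<close>

lemma sections_dedekind_of_hall:
  assumes tr: "normality_transitive"
    and hall: "\<And>i. i \<in> I \<Longrightarrow> \<exists>E. subgroup E G \<and> pi_number (- \<sigma> i) (index (carrier G) E) \<and>
      (\<forall>K. subgroup K G \<longrightarrow> K \<subseteq> E \<longrightarrow> normalises E K)"
  shows "sections_dedekind I \<sigma>"
  unfolding sections_dedekind_def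
proof (intro ballI allI impI)
  fix i K H L assume i: "i \<in> I" and Kn: "K \<lhd> G" and Ln: "L \<lhd> G" and H: "subgroup H G" "K \<subseteq> H" "H \<subseteq> L"
    and idx: "pi_number (\<sigma> i) (index L K)"
  obtain E where E: "subgroup E G" "pi_number (- \<sigma> i) (index (carrier G) E)"
    and ded: "\<And>M. \<lbrakk>subgroup M G; M \<subseteq> E\<rbrakk> \<Longrightarrow> normalises E M" using hall[OF i] by blast
  have L: "subgroup L G" "normalises (carrier G) L" "L \<subseteq> carrier G" and K: "subgroup K G" "normalises (carrier G) K"
    using Ln Kn subgroup.subset by (auto simp: normal_iff)
  have Ec: "E \<subseteq> carrier G" and Kc: "K \<subseteq> carrier G" using E K subgroup.subset by auto
  have KL: "K \<subseteq> L" using H by blast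
  have EL: "subgroup (E \<inter> L) G" by (rule subgroups_Inter_pair[OF E(1) L(1)])
  have EH: "subgroup (E \<inter> H) G" by (rule subgroups_Inter_pair[OF E(1) H(1)])
  have nEL: "normalises (E \<inter> L) K" using normalises_mono[OF K(2)] Ec by blast
  have M: "subgroup (K <#> (E \<inter> L)) G" "K \<subseteq> K <#> (E \<inter> L)" "E \<inter> L \<subseteq> K <#> (E \<inter> L)" "K <#> (E \<inter> L) \<subseteq> L"
    using set_mult_subgroup[OF K(1) EL nEL] subset_set_mult[OF K(1) EL] set_mult_least[OF L(1) KL, of "E \<inter> L"] by auto
  have "index L (K <#> (E \<inter> L)) dvd index L K" using index_trans[OF L(1) M(1) K(1) M(2,4)] by simp
  moreover have "pi_number (- \<sigma> i) (index L (E \<inter> L))"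
  proof -
    have nE: "normalises E L" by (rule normalises_mono[OF L(2) Ec])
    have LE: "subgroup (L <#> E) G" "E \<subseteq> L <#> E" using set_mult_subgroup[OF L(1) E(1) nE] subset_set_mult[OF L(1) E(1)] by auto
    have "index (L <#> E) E = index L (E \<inter> L)" by (rule index_set_mult(2)[OF L(1) E(1) nE])
    then show ?thesis using index_trans[OF subgroup_self LE(1) E(1) LE(2)] subgroup.subset[OF LE(1)] pi_number_dvd[OF E(2)] by simp
  qed
  moreover have "index L (K <#> (E \<inter> L)) dvd index L (E \<inter> L)" using index_trans[OF L(1) M(1) EL M(3,4)] by simp
  ultimately have "index L (K <#> (E \<inter> L)) = 1" using coprime_dvd_both idx by blast
  then have eL: "L = K <#> (E \<inter> L)" using index_one_iff[OF L(1) M(1,4)] by blast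
  have eH: "H = K <#> (E \<inter> H)"
  proof
    show "K <#> (E \<inter> H) \<subseteq> H" by (rule set_mult_least[OF H(1,2)]) blast
    show "H \<subseteq> K <#> (E \<inter> H)"
    proof
      fix h assume h: "h \<in> H"
      then obtain k e where ke: "k \<in> K" "e \<in> E \<inter> L" "h = k \<otimes> e" using eL H unfolding set_mult_def by blast
      have c: "k \<in> carrier G" "e \<in> carrier G" using ke Kc Ec by auto
      have "e = inv k \<otimes> h" using ke c by simp
      then have "e \<in> H" using h ke H by (metis subgroup.m_closed subgroup.m_inv_closed subsetD)
      then show "h \<in> K <#> (E \<inter> H)" unfolding set_mult_def using ke by blast
    qed
  qed
  have "normalises (E \<inter> L) (K <#> (E \<inter> H))"
  proof (rule normalises_set_mult[OF nEL])
    show "normalises (E \<inter> L) (E \<inter> H)" using normalises_mono[OF ded[OF EH]] by blast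
  qed (use Ec Kc in auto)
  then have "normalises (K <#> (E \<inter> L)) H"
    using eH normalises_mono[OF normalises_self[OF H(1)] H(2)] by (intro normalises_set_multI[OF H(1) K(1) EL nEL]) auto
  then have "normalises L H" using eL by simp
  then show "H \<lhd> G" using tr Ln H unfolding normality_transitive_def by blast
qed

end

section \<open>The defined notions in terms of orders\<close>

lemma prime_partition_unique:
  "\<lbrakk>prime_partition I \<sigma>; i \<in> I; j \<in> I; p \<in> \<sigma> i; p \<in> \<sigma> j\<rbrakk> \<Longrightarrow> i = j"
  unfolding prime_partition_def disjoint_family_on_def by blast

lemma pi_number_prod: "finite A \<Longrightarrow> (\<And>k. k \<in> A \<Longrightarrow> pi_number \<pi> (f k)) \<Longrightarrow> pi_number \<pi> (prod f A)"
  by (induction A rule: finite_induct) (auto intro: pi_number_mult)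

lemma sigma_primary_iff:
  assumes part: "prime_partition I \<sigma>" and Q: "group Q" "finite (carrier Q)"
  shows "sigma_primary I \<sigma> Q \<longleftrightarrow> (\<exists>i\<in>I. pi_number (\<sigma> i) (order Q))"
proof -
  interpret Q: group Q by (rule Q)
  have pos: "order Q > 0" using Q Q.order_gt_0_iff_finite by blast
  \<comment> \<open>Finiteness has to be secured because \<open>card\<close> of an infinite set is
    0; each class in \<open>sigma_set\<close> is determined by a prime divisor of the order.\<close>
  have "finite {p. p dvd order Q}" using pos by simp
  then have "finite (prime_divisors Q)" unfolding prime_divisors_def by (rule rev_finite_subset) blast
  moreover have "sigma_set I \<sigma> Q \<subseteq> (\<lambda>p. \<sigma> (SOME i. i \<in> I \<and> p \<in> \<sigma> i)) ` prime_divisors Q"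
  proof
    fix S assume "S \<in> sigma_set I \<sigma> Q"
    then obtain i p where ip: "i \<in> I" "S = \<sigma> i" "p \<in> \<sigma> i" "p \<in> prime_divisors Q" unfolding sigma_set_def by blast
    have "(SOME i. i \<in> I \<and> p \<in> \<sigma> i) = i" using ip prime_partition_unique[OF part] by (intro some_equality) blast+
    then show "S \<in> (\<lambda>p. \<sigma> (SOME i. i \<in> I \<and> p \<in> \<sigma> i)) ` prime_divisors Q" using ip by force
  qed
  ultimately have fin: "finite (sigma_set I \<sigma> Q)" using finite_surj by blast
  have "card (sigma_set I \<sigma> Q) \<le> 1 \<longleftrightarrow> (\<exists>i\<in>I. pi_number (\<sigma> i) (order Q))"
  proof
    assume c: "card (sigma_set I \<sigma> Q) \<le> 1"
    show "\<exists>i\<in>I. pi_number (\<sigma> i) (order Q)"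
    proof (cases "\<exists>p. Factorial_Ring.prime p \<and> p dvd order Q")
      case False
      \<comment> \<open>A group of order 1 must be assigned to some class; the class of the prime 2
        shows that there is one.\<close>
      obtain i where "i \<in> I" "2 \<in> \<sigma> i" using prime_partition_memE[OF part two_is_prime_nat] .
      then show ?thesis using False by (auto simp: pi_number_def)
    next
      case True
      then obtain p where p: "Factorial_Ring.prime p" "p dvd order Q" by blast
      obtain i where i: "i \<in> I" "p \<in> \<sigma> i" using prime_partition_memE[OF part p(1)] .
      have S: "\<sigma> j \<in> sigma_set I \<sigma> Q" if "j \<in> I" "q \<in> \<sigma> j" "Factorial_Ring.prime q" "q dvd order Q" for j q
        unfolding sigma_set_def prime_divisors_def using that by blast
      have "pi_number (\<sigma> i) (order Q)"
        unfolding pi_number_def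
      proof (intro allI impI)
        fix q assume q: "Factorial_Ring.prime q" "q dvd order Q"
        obtain j where j: "j \<in> I" "q \<in> \<sigma> j" using prime_partition_memE[OF part q(1)] .
        have "\<sigma> j = \<sigma> i" using S[OF j q] S[OF i p] c fin by (metis card_le_Suc0_iff_eq One_nat_def)
        then show "q \<in> \<sigma> i" using j by simp
      qed
      then show ?thesis using i by blast
    qed
  next
    assume "\<exists>i\<in>I. pi_number (\<sigma> i) (order Q)"
    then obtain i where i: "i \<in> I" "pi_number (\<sigma> i) (order Q)" by blast
    have "sigma_set I \<sigma> Q \<subseteq> {\<sigma> i}"
    proof
      fix S assume "S \<in> sigma_set I \<sigma> Q"
      then obtain j p where "j \<in> I" "S = \<sigma> j" "p \<in> \<sigma> j" "Factorial_Ring.prime p" "p dvd order Q"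
        unfolding sigma_set_def prime_divisors_def by blast
      then show "S \<in> {\<sigma> i}" using i prime_partition_unique[OF part] by (auto simp: pi_number_def)
    qed
    then show "card (sigma_set I \<sigma> Q) \<le> 1" using card_mono[of "{\<sigma> i}"] by fastforce
  qed
  then show ?thesis using Q by (simp add: sigma_primary_def)
qed

context finite_group
begin

text \<open>A member of largest order absorbs every other one, because their product is again a
  member; so a maximum for \<open>card\<close> is a maximum for inclusion.\<close>

lemma greatest_normal:
  assumes nrm: "\<And>N. P N \<Longrightarrow> N \<lhd> G" and ex: "P A" and join: "\<And>N M. \<lbrakk>P N; P M\<rbrakk> \<Longrightarrow> P (N <#> M)"
  shows "P (Greatest P)" "P N \<Longrightarrow> N \<subseteq> Greatest P"
proof -
  have "\<exists>A. P A \<and> (\<forall>B. P B \<longrightarrow> card B \<le> card A)"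
    by (rule exists_max_card[where U = "carrier G" and P = P, OF finite_carrier ex]) (use nrm in \<open>auto simp: normal_iff dest: subgroup.subset\<close>)
  then obtain M where M: "P M" and max: "\<And>B. P B \<Longrightarrow> card B \<le> card M" by blast
  have top: "B \<subseteq> M" if B: "P B" for B
  proof -
    have s: "subgroup M G" "subgroup B G" "subgroup (M <#> B) G"
      using nrm[OF M] nrm[OF B] nrm[OF join[OF M B]] by (auto simp: normal_iff)
    have "M = M <#> B" using subset_set_mult(1)[OF s(1,2)] max[OF join[OF M B]] s
      by (intro card_seteq) auto
    then show ?thesis using subset_set_mult(2)[OF s(1,2)] by blast
  qed
  then have "Greatest P = M" using M by (intro Greatest_equality) auto
  then show "P (Greatest P)" "P N \<Longrightarrow> N \<subseteq> Greatest P" using M top by auto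
qed

lemma normal_core_greatest:
  assumes "subgroup H G"
  shows "normal_core G H \<lhd> G" "normal_core G H \<subseteq> H" "\<lbrakk>N \<lhd> G; N \<subseteq> H\<rbrakk> \<Longrightarrow> N \<subseteq> normal_core G H"
proof -
  let ?P = "\<lambda>N. N \<lhd> G \<and> N \<subseteq> H"
  have 1: "?P {\<one>}" using one_is_normal subgroup.one_closed[OF assms] by blast
  have 2: "?P (A <#> B)" if "?P A" "?P B" for A B
    using that normal_set_mult set_mult_least[OF assms] by blast
  note g = greatest_normal[of ?P, OF conjunct1 1 2]
  show "normal_core G H \<lhd> G" "normal_core G H \<subseteq> H" "\<lbrakk>N \<lhd> G; N \<subseteq> H\<rbrakk> \<Longrightarrow> N \<subseteq> normal_core G H"
    using g unfolding normal_core_def by auto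
qed

lemma subgroup_finite_group: "subgroup H G \<Longrightarrow> finite_group (G\<lparr>carrier := H\<rparr>)"
  using subgroup_imp_group finite_subgroup by (simp add: finite_group_def finite_group_axioms_def)

lemma sigma_primary_section_iff:
  assumes "prime_partition I \<sigma>" "subgroup L G" "subgroup K G" "K \<subseteq> L" "normalises L K"
  shows "sigma_primary I \<sigma> (G\<lparr>carrier := L\<rparr> Mod K) \<longleftrightarrow> (\<exists>i\<in>I. pi_number (\<sigma> i) (index L K))"
proof -
  interpret L: finite_group "G\<lparr>carrier := L\<rparr>" by (rule subgroup_finite_group[OF assms(2)])
  have "K \<lhd> G\<lparr>carrier := L\<rparr>" using assms relative_normal_iff by blast
  then interpret Q: finite_group "G\<lparr>carrier := L\<rparr> Mod K" by (rule L.FactGroup_finite_group)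
  show ?thesis
    using sigma_primary_iff[OF assms(1) Q.is_group Q.finite_carrier] order_FactGroup[OF assms(2-5)] by simp
qed

text \<open>Chains of length two give both conditions. Conversely, normality descends a chain from
  \<open>carrier G\<close>: if \<open>C (Suc k)\<close> is normal, the core of \<open>C k\<close> in
  it is normal by transitivity, and either kind of step then makes \<open>C k\<close>
  normal.\<close>

lemma T_sigma_group_iff:
  assumes part: "prime_partition I \<sigma>"
  shows "T_sigma_group I \<sigma> G \<longleftrightarrow> normality_transitive \<and> sections_dedekind I \<sigma>"
proof
  assume T: "T_sigma_group I \<sigma> G"
  have two: "H \<lhd> G" if L: "L \<lhd> G" and H: "subgroup H G" "H \<subseteq> L"
    and step: "H \<lhd> G\<lparr>carrier := L\<rparr> \<or> sigma_primary I \<sigma> (G\<lparr>carrier := L\<rparr> Mod normal_core (G\<lparr>carrier := L\<rparr>) H)" for H L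
  proof -
    \<comment> \<open>The chain through \<open>L\<close>; its last step is a normal one because
      \<open>L \<lhd> G\<close>.\<close>
    let ?C = "\<lambda>k::nat. if k = 0 then H else if k = 1 then L else carrier G"
    have Ls: "subgroup L G" "L \<subseteq> carrier G" using L subgroup.subset by (auto simp: normal_iff)
    have "G\<lparr>carrier := carrier G\<rparr> = G" by simp
    then have "sigma_subnormal I \<sigma> H G"
      unfolding sigma_subnormal_def Let_def using Ls H L step
      by (intro exI[of _ 2] exI[of _ ?C]) (auto simp: less_Suc_eq numeral_2_eq_2 subgroup_self)
    then show ?thesis using T by (simp add: T_sigma_group_def)
  qed
  show "normality_transitive \<and> sections_dedekind I \<sigma>"
  proof
    show "normality_transitive"
      unfolding normality_transitive_def
    proof (intro allI impI)
      fix H L assume *: "L \<lhd> G" "subgroup H G" "H \<subseteq> L" "normalises L H"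
      then have "H \<lhd> G\<lparr>carrier := L\<rparr>" using relative_normal_iff by (simp add: normal_iff)
      then show "H \<lhd> G" using two * by blast
    qed
    show "sections_dedekind I \<sigma>"
      unfolding sections_dedekind_def
    proof (intro ballI allI impI)
      fix i K H L assume *: "i \<in> I" "K \<lhd> G" "L \<lhd> G" "subgroup H G" "K \<subseteq> H" "H \<subseteq> L" "pi_number (\<sigma> i) (index L K)"
      then have L: "subgroup L G" "L \<subseteq> carrier G" and K: "subgroup K G" "normalises (carrier G) K"
        using subgroup.subset[of L G] by (auto simp: normal_iff)
      let ?L = "G\<lparr>carrier := L\<rparr>"
      interpret Lg: finite_group ?L by (rule subgroup_finite_group[OF L(1)])
      have "subgroup H ?L" using * L relative_subgroup_iff by blast
      note core = Lg.normal_core_greatest[OF this]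
      have "K \<lhd> ?L" using relative_normal_iff[OF L(1)] K L * normalises_mono[OF K(2) L(2)] by blast
      then have KC: "K \<subseteq> normal_core ?L H" using core(3) * by blast
      have C: "subgroup (normal_core ?L H) G" "normal_core ?L H \<subseteq> L" "normalises L (normal_core ?L H)"
        using core(1) relative_normal_iff[OF L(1)] by auto
      \<comment> \<open>\<open>K\<close> lies in the core, so passing to the core only removes a
        factor from the index.\<close>
      have "index L K = index L (normal_core ?L H) * index (normal_core ?L H) K"
        by (rule index_trans[OF L(1) C(1) K(1) KC C(2)])
      then have "pi_number (\<sigma> i) (index L (normal_core ?L H))" using *(7) pi_number_dvd by (metis dvd_triv_left)
      then have "sigma_primary I \<sigma> (?L Mod normal_core ?L H)"
        using sigma_primary_section_iff[OF part L(1) C] *(1) by blast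
      then show "H \<lhd> G" using two * by blast
    qed
  qed
next
  assume T: "normality_transitive \<and> sections_dedekind I \<sigma>"
  show "T_sigma_group I \<sigma> G"
    unfolding T_sigma_group_def
  proof (intro allI impI)
    fix H assume "sigma_subnormal I \<sigma> H G"
    then obtain n C where C: "C 0 = H" "C n = carrier G" "\<And>k. k \<le> n \<Longrightarrow> subgroup (C k) G"
      and le: "\<And>k. k < n \<Longrightarrow> C k \<subseteq> C (Suc k)"
      and step: "\<And>k. k < n \<Longrightarrow> C k \<lhd> G\<lparr>carrier := C (Suc k)\<rparr> \<or>
        sigma_primary I \<sigma> (G\<lparr>carrier := C (Suc k)\<rparr> Mod normal_core (G\<lparr>carrier := C (Suc k)\<rparr>) (C k))"
      unfolding sigma_subnormal_def Let_def by blast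
    have "C k \<lhd> G" if "k \<le> n" for k
      using that
    proof (induction rule: inc_induct)
      case base
      then show ?case using C normal_self by simp
    next
      case (step k)
      let ?L = "G\<lparr>carrier := C (Suc k)\<rparr>"
      have L: "subgroup (C (Suc k)) G" and H: "subgroup (C k) G" "C k \<subseteq> C (Suc k)"
        using C(3)[of "Suc k"] C(3)[of k] le step by auto
      interpret Lg: finite_group ?L by (rule subgroup_finite_group[OF L])
      have "subgroup (C k) ?L" using H L relative_subgroup_iff by blast
      note core = Lg.normal_core_greatest[OF this]
      let ?K = "normal_core ?L (C k)"
      have K: "subgroup ?K G" "?K \<subseteq> C (Suc k)" "normalises (C (Suc k)) ?K"
        using core(1) relative_normal_iff[OF L] by auto
      have Kn: "?K \<lhd> G" using T step.IH K unfolding normality_transitive_def by blast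
      from \<open>k < n\<close> consider "C k \<lhd> ?L" | i where "i \<in> I" "pi_number (\<sigma> i) (index (C (Suc k)) ?K)"
        using \<open>\<And>k. k < n \<Longrightarrow> C k \<lhd> _ \<or> _\<close> sigma_primary_section_iff[OF part L K] by blast
      then show ?case
      proof cases
        case 1
        then show ?thesis using T step.IH H relative_normal_iff[OF L] unfolding normality_transitive_def by blast
      next
        case 2
        then show ?thesis using T step.IH H Kn core(2) unfolding sections_dedekind_def by blast
      qed
    qed
    then show "H \<lhd> G" using C(1) by blast
  qed
qed

section \<open>\<sigma>-solubility and the condition on Hall subgroups\<close>

lemma sigma_soluble_chief_index:
  assumes part: "prime_partition I \<sigma>" and sol: "sigma_soluble I \<sigma> G" and ch: "is_chief_factor G H K"
  shows "\<exists>i\<in>I. pi_number (\<sigma> i) (index H K)"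
proof -
  have "H \<lhd> G" "K \<lhd> G" "K \<subseteq> H" using ch unfolding is_chief_factor_def by auto
  then have "subgroup H G" "subgroup K G" "K \<subseteq> H" "normalises H K"
    using subgroup.subset[of H G] normalises_mono[of "carrier G" K H] by (auto simp: normal_iff)
  then show ?thesis using sigma_primary_section_iff[OF part] sol ch unfolding sigma_soluble_def by blast
qed

text \<open>A largest normal subgroup of \<open>G\<close> properly inside \<open>N\<close> gives a
  chief factor; \<open>sigma_soluble_above\<close> uses a smallest one properly above
  \<open>K\<close> in the same way.\<close>

lemma sigma_soluble_below:
  assumes part: "prime_partition I \<sigma>" and sol: "sigma_soluble I \<sigma> G" and N: "N \<lhd> G" "N \<noteq> {\<one>}"
  shows "\<exists>K i. i \<in> I \<and> K \<lhd> G \<and> K \<subset> N \<and> pi_number (\<sigma> i) (index N K)"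
proof -
  have Ns: "subgroup N G" using N by (simp add: normal_iff)
  let ?P = "\<lambda>K. K \<lhd> G \<and> K \<subset> N"
  have P1: "?P {\<one>}" using one_is_normal N subgroup.one_closed[OF Ns] by blast
  have "\<exists>K. ?P K \<and> (\<forall>B. ?P B \<longrightarrow> card B \<le> card K)"
    by (rule exists_max_card[where P = ?P, OF finite_subgroup[OF Ns] P1]) blast
  then obtain K where K: "?P K" and max: "\<And>B. ?P B \<Longrightarrow> card B \<le> card K" by blast
  have "\<not> (K \<subset> M \<and> M \<subset> N)" if "M \<lhd> G" for M
  proof
    assume *: "K \<subset> M \<and> M \<subset> N"
    then have "card K < card M" using that by (intro psubset_card_mono) (auto simp: normal_iff)
    then show False using max[of M] that * by force
  qed
  then have "is_chief_factor G N K" using N K unfolding is_chief_factor_def by blast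
  then show ?thesis using sigma_soluble_chief_index[OF part sol] K by blast
qed

lemma sigma_soluble_above:
  assumes part: "prime_partition I \<sigma>" and sol: "sigma_soluble I \<sigma> G" and K: "K \<lhd> G" "K \<noteq> carrier G"
  shows "\<exists>N i. i \<in> I \<and> N \<lhd> G \<and> K \<subset> N \<and> pi_number (\<sigma> i) (index N K)"
proof -
  let ?P = "\<lambda>N. N \<lhd> G \<and> K \<subset> N"
  have "?P (carrier G)" using normal_self K subgroup.subset by (auto simp: normal_iff)
  then obtain N where N: "?P N" and least: "\<And>B. ?P B \<Longrightarrow> card N \<le> card B"
    using ex_has_least_nat[of ?P "carrier G" card] by blast
  have "\<not> (K \<subset> M \<and> M \<subset> N)" if "M \<lhd> G" for M
  proof
    assume *: "K \<subset> M \<and> M \<subset> N"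
    then have "card M < card N" using N by (intro psubset_card_mono) (auto simp: normal_iff)
    then show False using least[of M] that * by force
  qed
  then have "is_chief_factor G N K" using N K unfolding is_chief_factor_def by blast
  then show ?thesis using sigma_soluble_chief_index[OF part sol] N by blast
qed

lemma pi_group_iff: "subgroup H G \<Longrightarrow> pi_group \<pi> (G\<lparr>carrier := H\<rparr>) \<longleftrightarrow> pi_number \<pi> (card H)"
  using subgroup_imp_group finite_subgroup
  by (auto simp: pi_group_def prime_divisors_def pi_number_def order_def)

lemma hall_pi_subgroup_iff:
  "hall_pi_subgroup \<pi> H G \<longleftrightarrow> subgroup H G \<and> pi_number \<pi> (card H) \<and> pi_number (- \<pi>) (index (carrier G) H)"
  using pi_group_iff[of H \<pi>] card_rcosets[of H] by (auto simp: hall_pi_subgroup_def pi_number_def)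

lemma condition_R_iff:
  "condition_R \<tau> G \<longleftrightarrow> (\<forall>\<pi> H K. \<pi> \<subseteq> \<tau> \<longrightarrow> hall_pi_subgroup \<pi> H G \<longrightarrow> subgroup K G \<longrightarrow> K \<subseteq> H \<longrightarrow>
     normalises (normalizer G H) K)"
proof -
  have "K \<lhd> G\<lparr>carrier := normalizer G H\<rparr> \<longleftrightarrow> normalises (normalizer G H) K"
    if "subgroup H G" "subgroup K G" "K \<subseteq> H" for H K
    using relative_normal_iff[OF normalizer_subgroup[OF that(1)], of K] that
      normalises_iff_normalizer[OF that(1) subgroup.subset[OF that(1)]] normalises_self[OF that(1)] by blast
  then show ?thesis
    unfolding condition_R_def using relative_subgroup_iff hall_pi_subgroup_iff by blast
qed

text \<open>The set of primes \<open>{p}\<close> yields the condition on Sylow subgroups. The set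
  \<open>\<sigma> i\<close> shows that a Hall \<open>\<sigma> i\<close>-subgroup, which lies in its
  own normalizer, normalises all its subgroups.\<close>

lemma T_sigma_of_condition_R:
  assumes part: "prime_partition I \<sigma>" and sol: "sigma_soluble I \<sigma> G" and R: "\<And>i. i \<in> I \<Longrightarrow> condition_R (\<sigma> i) G"
  shows "T_sigma_group I \<sigma> G"
proof -
  have "normality_transitive"
  proof (rule normality_transitive_of_sylow)
    fix p P K assume p: "Factorial_Ring.prime p" and P: "sylow_of p (carrier G) P" and K: "subgroup K G" "K \<subseteq> P"
    obtain i where i: "i \<in> I" "p \<in> \<sigma> i" using prime_partition_memE[OF part p] .
    have "pi_number (- {p}) (index (carrier G) P)"
      unfolding pi_number_def using P by (auto simp: sylow_of_def)
    then have "hall_pi_subgroup {p} P G" using P by (simp add: hall_pi_subgroup_iff sylow_of_def)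
    then show "normalises (normalizer G P) K" using R[OF i(1)] i K unfolding condition_R_iff by blast
  qed
  moreover have "sections_dedekind I \<sigma>"
  proof (rule sections_dedekind_of_hall[OF calculation])
    fix i assume i: "i \<in> I"
    obtain E where E: "subgroup E G" "pi_number (\<sigma> i) (index E {\<one>})" "pi_number (- \<sigma> i) (index (carrier G) E)"
      using sigma_hall_exists[OF part sigma_soluble_above[OF part sol] i one_is_normal] by blast
    have "normalises E K" if "subgroup K G" "K \<subseteq> E" for K
    proof -
      have "hall_pi_subgroup (\<sigma> i) E G" using E by (simp add: hall_pi_subgroup_iff)
      then have "normalises (normalizer G E) K" using R[OF i] that unfolding condition_R_iff by blast
      moreover have "E \<subseteq> normalizer G E"
        using normalises_iff_normalizer[OF E(1) subgroup.subset[OF E(1)]] normalises_self[OF E(1)] by blast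
      ultimately show ?thesis using normalises_mono by blast
    qed
    then show "\<exists>E. subgroup E G \<and> pi_number (- \<sigma> i) (index (carrier G) E) \<and>
      (\<forall>K. subgroup K G \<longrightarrow> K \<subseteq> E \<longrightarrow> normalises E K)" using E by blast
  qed
  ultimately show ?thesis using T_sigma_group_iff[OF part] by blast
qed

end

section \<open>$\sigma$-nilpotent quotients\<close>

context group
begin

text \<open>An ordered product, because the group is not assumed commutative; the product rule only
  asks that factors with different indices commute.\<close>

primrec lprod :: "(nat \<Rightarrow> 'a) \<Rightarrow> nat \<Rightarrow> 'a" where
  "lprod f 0 = \<one>"
| "lprod f (Suc m) = lprod f m \<otimes> f m"

lemma lprod_closed [simp]: "(\<And>k. k < m \<Longrightarrow> f k \<in> carrier G) \<Longrightarrow> lprod f m \<in> carrier G"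
  by (induction m) auto

lemma lprod_cong: "(\<And>k. k < m \<Longrightarrow> f k = g k) \<Longrightarrow> lprod f m = lprod g m"
  by (induction m) auto

lemma lprod_one: "(\<And>k. k < m \<Longrightarrow> f k = \<one>) \<Longrightarrow> lprod f m = \<one>"
  by (induction m) auto

lemma lprod_commute:
  assumes "y \<in> carrier G" "\<And>k. k < m \<Longrightarrow> f k \<in> carrier G" "\<And>k. k < m \<Longrightarrow> y \<otimes> f k = f k \<otimes> y"
  shows "y \<otimes> lprod f m = lprod f m \<otimes> y"
  using assms
proof (induction m)
  case (Suc m)
  have c: "lprod f m \<in> carrier G" "f m \<in> carrier G" using Suc.prems by auto
  have IH: "y \<otimes> lprod f m = lprod f m \<otimes> y" using Suc by auto
  have "y \<otimes> lprod f (Suc m) = (y \<otimes> lprod f m) \<otimes> f m" using c Suc.prems(1) by (simp add: m_assoc)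
  also have "\<dots> = lprod f m \<otimes> (y \<otimes> f m)" using c Suc.prems(1) IH by (simp add: m_assoc)
  also have "\<dots> = lprod f (Suc m) \<otimes> y" using c Suc.prems(1) Suc.prems(3)[of m] by (simp add: m_assoc)
  finally show ?case .
qed simp

lemma lprod_mult:
  assumes "\<And>k. k < m \<Longrightarrow> f k \<in> carrier G" "\<And>k. k < m \<Longrightarrow> g k \<in> carrier G"
    and "\<And>j k. \<lbrakk>j < m; k < m; j \<noteq> k\<rbrakk> \<Longrightarrow> f j \<otimes> g k = g k \<otimes> f j"
  shows "lprod (\<lambda>k. f k \<otimes> g k) m = lprod f m \<otimes> lprod g m"
  using assms
proof (induction m)
  case (Suc m)
  have c: "lprod f m \<in> carrier G" "lprod g m \<in> carrier G" "f m \<in> carrier G" "g m \<in> carrier G" using Suc.prems by auto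
  have "f m \<otimes> lprod g m = lprod g m \<otimes> f m" by (rule lprod_commute) (use Suc.prems in auto)
  then have "lprod f m \<otimes> lprod g m \<otimes> (f m \<otimes> g m) = lprod f m \<otimes> f m \<otimes> (lprod g m \<otimes> g m)"
    using c by (metis m_assoc m_closed)
  moreover have "lprod (\<lambda>k. f k \<otimes> g k) m = lprod f m \<otimes> lprod g m" using Suc by auto
  ultimately show ?case by simp
qed simp

lemma lprod_single:
  assumes "k < m" "f k \<in> carrier G" "\<And>j. \<lbrakk>j < m; j \<noteq> k\<rbrakk> \<Longrightarrow> f j = \<one>"
  shows "lprod f m = f k"
  using assms
proof (induction m)
  case (Suc m)
  show ?case
  proof (cases "k = m")
    case True
    then have "lprod f m = \<one>" using Suc.prems by (intro lprod_one) auto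
    then show ?thesis using True Suc.prems by simp
  next
    case False
    then show ?thesis using Suc by auto
  qed
qed simp

lemma lprod_pow:
  assumes "\<And>k. k < m \<Longrightarrow> f k \<in> carrier G" "\<And>j k. \<lbrakk>j < m; k < m\<rbrakk> \<Longrightarrow> j \<noteq> k \<Longrightarrow> f j \<otimes> f k = f k \<otimes> f j"
  shows "lprod (\<lambda>k. f k [^] (n::nat)) m = lprod f m [^] n"
proof (induction n)
  case 0
  then show ?case by (simp add: lprod_one)
next
  case (Suc n)
  have "lprod (\<lambda>k. f k [^] n \<otimes> f k) m = lprod (\<lambda>k. f k [^] n) m \<otimes> lprod f m"
    using assms by (intro lprod_mult) (auto intro: group_commutes_pow)
  then show ?case using Suc by simp
qed

end

context finite_group
begin

text \<open>A normal Hall \<open>\<sigma> i\<close>-subgroup of \<open>G Mod N\<close> for each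
  \<open>i\<close>, phrased through its preimage \<open>A\<close>. This is \<sigma>-nilpotency of
  the quotient (\<open>sigma_nilpotent_FactGroup_iff\<close>).\<close>

definition normal_halls :: "'i set \<Rightarrow> ('i \<Rightarrow> nat set) \<Rightarrow> 'a set \<Rightarrow> bool" where
  "normal_halls I \<sigma> N \<longleftrightarrow> (\<forall>i\<in>I. \<exists>A. A \<lhd> G \<and> N \<subseteq> A \<and> pi_number (\<sigma> i) (index A N) \<and>
     pi_number (- \<sigma> i) (index (carrier G) A))"

text \<open>The Hall subgroup is the product of those direct factors that are
  \<open>\<sigma> i\<close>-groups, that is, the set of elements whose other coordinates are
  trivial.\<close>

lemma normal_halls_of_sigma_nilpotent:
  assumes part: "prime_partition I \<sigma>" and nil: "sigma_nilpotent I \<sigma> G"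
  shows "normal_halls I \<sigma> {\<one>}"
  unfolding normal_halls_def
proof
  fix i assume i: "i \<in> I"
  obtain n :: nat and F :: "nat \<Rightarrow> 'a monoid" where F: "\<And>k. k < n \<Longrightarrow> sigma_primary I \<sigma> (F k)"
    and iso: "G \<cong> product_group {..<n} F"
    using nil unfolding sigma_nilpotent_def by blast
  let ?P = "product_group {..<n} F"
  have grp: "group (F k)" "finite (carrier (F k))" if "k < n" for k using F[OF that] by (auto simp: sigma_primary_def)
  have P: "group ?P" by (rule product_group) (use grp in auto)
  obtain \<phi> where "\<phi> \<in> iso G ?P" using iso unfolding is_iso_def by blast
  then have \<phi>: "\<phi> \<in> hom G ?P" "bij_betw \<phi> (carrier G) (carrier ?P)" unfolding iso_def by auto
  interpret \<phi>: group_hom G ?P \<phi> using P \<phi> by (simp add: group_hom_def group_hom_axioms_def is_group)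
  \<comment> \<open>A trivial factor belongs to \<open>S\<close> for every \<open>i\<close>. A
    factor outside \<open>S\<close> is a group for some other class, so its order has no prime
    divisor in \<open>\<sigma> i\<close>.\<close>
  define S where "S = {k. k < n \<and> pi_number (\<sigma> i) (order (F k))}"
  have nS: "pi_number (- \<sigma> i) (order (F k))" if k: "k < n" "k \<notin> S" for k
  proof -
    obtain j where j: "j \<in> I" "pi_number (\<sigma> j) (order (F k))"
      using sigma_primary_iff[OF part grp[OF k(1)]] F[OF k(1)] by blast
    then have "j \<noteq> i" using k by (auto simp: S_def)
    then have "\<sigma> j \<subseteq> - \<sigma> i" using prime_partition_unique[OF part j(1) i] by blast
    then show ?thesis using pi_number_mono[OF j(2)] by blast
  qed
  define B where "B = {x \<in> carrier G. \<forall>k<n. k \<notin> S \<longrightarrow> \<phi> x k = \<one>\<^bsub>F k\<^esub>}"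
  have \<phi>c: "\<phi> x k \<in> carrier (F k)" if "x \<in> carrier G" "k < n" for x k
    using \<phi>.hom_closed[OF that(1)] that(2) by auto
  have \<phi>m: "\<phi> (x \<otimes> y) k = \<phi> x k \<otimes>\<^bsub>F k\<^esub> \<phi> y k" if "x \<in> carrier G" "y \<in> carrier G" "k < n" for x y k
    using \<phi>.hom_mult[OF that(1,2)] that(3) by simp
  have \<phi>1: "\<phi> \<one> k = \<one>\<^bsub>F k\<^esub>" if "k < n" for k using \<phi>.hom_one that by simp
  have \<phi>i: "\<phi> (inv x) k = inv\<^bsub>F k\<^esub> \<phi> x k" if "x \<in> carrier G" "k < n" for x k
  proof -
    have "\<phi> x \<in> (\<Pi>\<^sub>E k\<in>{..<n}. carrier (F k))" using \<phi>.hom_closed[OF that(1)] by simp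
    then have "inv\<^bsub>?P\<^esub> \<phi> x = (\<lambda>k\<in>{..<n}. inv\<^bsub>F k\<^esub> \<phi> x k)" by (rule inv_product_group) (use grp in auto)
    then show ?thesis using \<phi>.hom_inv[OF that(1)] that by simp
  qed
  have Bs: "subgroup B G"
  proof (rule subgroupI)
    show "B \<noteq> {}" using \<phi>1 unfolding B_def by blast
    show "inv a \<in> B" if "a \<in> B" for a
      using that \<phi>i grp unfolding B_def by (simp add: group.inv_eq_1_iff monoid.inv_one group.is_monoid)
    show "a \<otimes> b \<in> B" if "a \<in> B" "b \<in> B" for a b
    proof -
      have "\<phi> (a \<otimes> b) k = \<one>\<^bsub>F k\<^esub>" if k: "k < n" "k \<notin> S" for k
      proof -
        interpret Fk: group "F k" using grp k by blast
        show ?thesis using \<open>a \<in> B\<close> \<open>b \<in> B\<close> k \<phi>m unfolding B_def by simp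
      qed
      then show ?thesis using that unfolding B_def by simp
    qed
  qed (auto simp: B_def)
  have Bn: "B \<lhd> G"
    unfolding normal_iff normalises_def
  proof (intro conjI ballI Bs)
    fix g b assume gb: "g \<in> carrier G" "b \<in> B"
    have "\<phi> (cj g b) k = \<one>\<^bsub>F k\<^esub>" if k: "k < n" "k \<notin> S" for k
    proof -
      interpret Fk: group "F k" using grp k by blast
      show ?thesis using gb k \<phi>c[of g k] unfolding B_def cj_def by (simp add: \<phi>m \<phi>i del: \<phi>.hom_inv)
    qed
    then show "cj g b \<in> B" using gb unfolding B_def by simp
  qed
  let ?f = "\<lambda>k. order (F k)"
  have "\<phi> ` B = (\<Pi>\<^sub>E k\<in>{..<n}. if k \<in> S then carrier (F k) else {\<one>\<^bsub>F k\<^esub>})" (is "_ = ?R")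
  proof
    show "\<phi> ` B \<subseteq> ?R" using \<phi>.hom_closed \<phi>c unfolding B_def by (auto simp: PiE_def Pi_def extensional_def)
    show "?R \<subseteq> \<phi> ` B"
    proof
      fix y assume y: "y \<in> ?R"
      have "y k \<in> carrier (F k)" if "k < n" for k
        using PiE_mem[OF y, of k] that grp[OF that] by (auto split: if_splits intro: monoid.one_closed group.is_monoid)
      then have "y \<in> carrier ?P" using y by (auto simp: PiE_def)
      then obtain x where x: "x \<in> carrier G" "y = \<phi> x" using \<phi>(2) unfolding bij_betw_def by blast
      have "y k = \<one>\<^bsub>F k\<^esub>" if "k < n" "k \<notin> S" for k using PiE_mem[OF y, of k] that by simp
      then show "y \<in> \<phi> ` B" using x unfolding B_def by blast
    qed
  qed
  moreover have "inj_on \<phi> B" using \<phi>(2) B_def by (auto simp: bij_betw_def intro: inj_on_subset)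
  ultimately have "card B = card ?R" using card_image by metis
  also have "\<dots> = (\<Prod>k<n. if k \<in> S then ?f k else 1)"
    unfolding card_PiE[OF finite_lessThan] by (intro prod.cong) (auto simp: order_def)
  finally have cB: "card B = (\<Prod>k<n. if k \<in> S then ?f k else 1)" .
  have cG: "card (carrier G) = (\<Prod>k<n. ?f k)"
    using bij_betw_same_card[OF \<phi>(2)] by (simp add: card_PiE order_def)
  have "card (carrier G) = (\<Prod>k<n. if k \<in> S then 1 else ?f k) * card B"
    unfolding cG cB prod.distrib[symmetric] by (intro prod.cong) auto
  then have iB: "index (carrier G) B = (\<Prod>k<n. if k \<in> S then 1 else ?f k)"
    using card_subgroup_pos[OF Bs] by (simp add: index_def)
  have "pi_number (\<sigma> i) (card B)" unfolding cB by (intro pi_number_prod) (auto simp: S_def)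
  moreover have "pi_number (- \<sigma> i) (index (carrier G) B)" unfolding iB by (intro pi_number_prod) (use nS in auto)
  ultimately show "\<exists>A. A \<lhd> G \<and> {\<one>} \<subseteq> A \<and> pi_number (\<sigma> i) (index A {\<one>}) \<and> pi_number (- \<sigma> i) (index (carrier G) A)"
    using Bn subgroup.one_closed[OF Bs] by auto
qed

lemma coprime_normals_commute:
  assumes A: "A \<lhd> G" and B: "B \<lhd> G" and cop: "coprime (card A) (card B)" and ab: "a \<in> A" "b \<in> B"
  shows "a \<otimes> b = b \<otimes> a"
proof -
  have s: "subgroup A G" "normalises (carrier G) A" "subgroup B G" "normalises (carrier G) B" using A B by (auto simp: normal_iff)
  have c: "a \<in> carrier G" "b \<in> carrier G" using s ab subgroup.mem_carrier by metis+
  let ?c = "cj a b \<otimes> inv b"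
  have "?c \<in> B" using s ab c by (simp add: normalises_def subgroup.m_closed subgroup.m_inv_closed)
  moreover have "?c = a \<otimes> cj b (inv a)" using c by (simp add: cj_def m_assoc)
  then have "?c \<in> A" using s ab c by (simp add: normalises_def subgroup.m_closed subgroup.m_inv_closed)
  ultimately have "?c [^] card A \<in> {\<one>}" "?c [^] card B \<in> {\<one>}"
    using pow_index_mem[OF s(1) triv_subgroup _ normalises_one[OF subgroup.subset[OF s(1)]], of ?c]
      pow_index_mem[OF s(3) triv_subgroup _ normalises_one[OF subgroup.subset[OF s(3)]], of ?c]
      subgroup.one_closed[OF s(1)] subgroup.one_closed[OF s(3)] by auto
  then have "?c \<in> {\<one>}" using coprime_pow_mem[OF triv_subgroup _ _ _ cop] c by simp
  then have "cj a b = b" using cj_eq_mult[OF c] c by simp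
  then show ?thesis using cj_commute c by simp
qed

end

text \<open>Multiplying the coordinates maps the direct product of the Hall subgroups isomorphically
  onto \<open>Q\<close>. The type is \<open>'a monoid\<close> because the factors, obtained from
  \<open>Q\<close> by replacing the carrier, must have the type that \<open>sigma_nilpotent\<close>
  demands.\<close>

lemma sigma_nilpotent_of_normal_halls:
  fixes Q :: "'a monoid"
  assumes part: "prime_partition I \<sigma>" and fg: "finite_group Q"
    and halls: "finite_group.normal_halls Q I \<sigma> {\<one>\<^bsub>Q\<^esub>}"
  shows "sigma_nilpotent I \<sigma> Q"
proof -
  interpret Q: finite_group Q by (rule fg)
  \<comment> \<open>\<open>I\<close> may be infinite, so only the classes that contain a prime
    divisor of the order are enumerated.\<close>
  define W where "W = {i \<in> I. \<exists>p\<in>\<sigma> i. p dvd order Q}"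
  have pos: "order Q > 0" using Q.order_gt_0_iff_finite by simp
  have "finite {p. p dvd order Q}" using pos by simp
  moreover have "W \<subseteq> (\<lambda>p. SOME i. i \<in> I \<and> p \<in> \<sigma> i) ` {p. p dvd order Q}"
  proof
    fix i assume "i \<in> W"
    then obtain p where ip: "i \<in> I" "p \<in> \<sigma> i" "p dvd order Q" unfolding W_def by blast
    have "(SOME i. i \<in> I \<and> p \<in> \<sigma> i) = i" using ip prime_partition_unique[OF part] by (intro some_equality) blast+
    then show "i \<in> (\<lambda>p. SOME i. i \<in> I \<and> p \<in> \<sigma> i) ` {p. p dvd order Q}" using ip by force
  qed
  ultimately have "finite W" using finite_surj by blast
  define n where "n = card W"
  obtain h where h: "bij_betw h {..<n} W"
    using ex_bij_betw_nat_finite[OF \<open>finite W\<close>] unfolding n_def lessThan_atLeast0 by blast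
  have hI: "h k \<in> I" if "k < n" for k using h that unfolding bij_betw_def W_def by blast
  have hinj: "h j \<noteq> h k" if "j < n" "k < n" "j \<noteq> k" for j k using h that unfolding bij_betw_def inj_on_def by blast
  have "\<forall>k\<in>{..<n}. \<exists>A. A \<lhd> Q \<and> pi_number (\<sigma> (h k)) (card A) \<and> pi_number (- \<sigma> (h k)) (index (carrier Q) A)"
    using halls hI unfolding Q.normal_halls_def by fastforce
  then obtain B where B0: "\<forall>k\<in>{..<n}. B k \<lhd> Q \<and> pi_number (\<sigma> (h k)) (card (B k)) \<and>
      pi_number (- \<sigma> (h k)) (index (carrier Q) (B k))"
    using bchoice[of "{..<n}"] by metis
  then have B: "B k \<lhd> Q" "pi_number (\<sigma> (h k)) (card (B k))" "pi_number (- \<sigma> (h k)) (index (carrier Q) (B k))"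
    if "k < n" for k using that by auto
  have Bs: "subgroup (B k) Q" "B k \<subseteq> carrier Q" if "k < n" for k
    using B(1)[OF that] subgroup.subset by (auto simp: Q.normal_iff)
  have disj: "\<sigma> (h j) \<subseteq> - \<sigma> (h k)" if "j < n" "k < n" "j \<noteq> k" for j k
    using prime_partition_unique[OF part hI[OF that(1)] hI[OF that(2)]] hinj[OF that] by blast
  have cop: "coprime (card (B k)) (card (B j))" if "j < n" "k < n" "j \<noteq> k" for j k
    using coprime_pi_number[OF B(2)[OF that(2)] pi_number_mono[OF B(2)[OF that(1)] disj[OF that]]] .
  have comm: "a \<otimes>\<^bsub>Q\<^esub> b = b \<otimes>\<^bsub>Q\<^esub> a" if "j < n" "k < n" "j \<noteq> k" "a \<in> B j" "b \<in> B k" for j k a b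
    using Q.coprime_normals_commute[OF B(1)[OF that(1)] B(1)[OF that(2)] _ that(4,5)] cop[OF that(2,1)] that(3) by blast
  define F where "F k = Q\<lparr>carrier := B k\<rparr>" for k
  let ?P = "product_group {..<n} F"
  have Fg: "group (F k)" "finite (carrier (F k))" if "k < n" for k
    using Q.subgroup_imp_group[OF Bs(1)[OF that]] Q.finite_subgroup[OF Bs(1)[OF that]] by (auto simp: F_def)
  have Fsp: "sigma_primary I \<sigma> (F k)" if "k < n" for k
    using sigma_primary_iff[OF part Fg[OF that]] B(2)[OF that] hI[OF that] by (auto simp: F_def order_def)
  have P: "group ?P" by (rule product_group) (use Fg in auto)
  define \<psi> where "\<psi> f = Q.lprod f n" for f
  have fB: "f k \<in> B k" "f k \<in> carrier Q" if "f \<in> carrier ?P" "k < n" for f k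
    using that Bs(2)[OF that(2)] by (auto simp: F_def PiE_def Pi_def)
  have hom: "\<psi> \<in> hom ?P Q"
  proof (rule homI)
    show "\<psi> f \<in> carrier Q" if "f \<in> carrier ?P" for f using fB[OF that] by (simp add: \<psi>_def)
    show "\<psi> (f \<otimes>\<^bsub>?P\<^esub> g) = \<psi> f \<otimes>\<^bsub>Q\<^esub> \<psi> g" if fg: "f \<in> carrier ?P" "g \<in> carrier ?P" for f g
    proof -
      have "\<psi> (f \<otimes>\<^bsub>?P\<^esub> g) = Q.lprod (\<lambda>k. f k \<otimes>\<^bsub>Q\<^esub> g k) n"
        unfolding \<psi>_def by (rule Q.lprod_cong) (simp add: F_def)
      also have "\<dots> = \<psi> f \<otimes>\<^bsub>Q\<^esub> \<psi> g"
        unfolding \<psi>_def using fB[OF fg(1)] fB[OF fg(2)] comm by (intro Q.lprod_mult) blast+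
      finally show ?thesis .
    qed
  qed
  interpret \<psi>: group_hom ?P Q \<psi> using P hom by (simp add: group_hom_def group_hom_axioms_def Q.is_group)
  have "inj_on \<psi> (carrier ?P)"
    unfolding \<psi>.inj_on_one_iff
  proof (intro allI impI)
    fix f assume f: "f \<in> carrier ?P" and f1: "\<psi> f = \<one>\<^bsub>Q\<^esub>"
    have "f k = \<one>\<^bsub>Q\<^esub>" if k: "k < n" for k
    proof -
      \<comment> \<open>This exponent is divisible by the orders of all other factors, so raising to
        it isolates the \<open>k\<close>-th coordinate; it is also prime to the order of
        \<open>B k\<close>.\<close>
      let ?c = "index (carrier Q) (B k)"
      have pw: "a [^]\<^bsub>Q\<^esub> card (B j) = \<one>\<^bsub>Q\<^esub>" if "j < n" "a \<in> B j" for j a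
        using Q.pow_index_mem[OF Bs(1)[OF that(1)] Q.triv_subgroup _ Q.normalises_one[OF Bs(2)[OF that(1)]] that(2)]
          subgroup.one_closed[OF Bs(1)[OF that(1)]] by simp
      have "f j [^]\<^bsub>Q\<^esub> ?c = \<one>\<^bsub>Q\<^esub>" if j: "j < n" "j \<noteq> k" for j
      proof -
        have "card (B j) dvd card (carrier Q)"
          using Q.card_mult_index[OF Q.subgroup_self Bs[OF j(1)]] by simp
        also have "card (carrier Q) = ?c * card (B k)" using Q.card_mult_index[OF Q.subgroup_self Bs[OF k]] .
        finally have "card (B j) dvd ?c" using cop[OF k j(1)] j by (simp add: coprime_dvd_mult_left_iff)
        then obtain m where "?c = card (B j) * m" by (rule dvdE)
        then show ?thesis using pw[OF j(1) fB(1)[OF f j(1)]] fB(2)[OF f j(1)] by (metis Q.nat_pow_one Q.nat_pow_pow)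
      qed
      then have "Q.lprod (\<lambda>j. f j [^]\<^bsub>Q\<^esub> ?c) n = f k [^]\<^bsub>Q\<^esub> ?c"
        using k fB(2)[OF f k] by (intro Q.lprod_single) auto
      moreover have "Q.lprod (\<lambda>j. f j [^]\<^bsub>Q\<^esub> ?c) n = \<psi> f [^]\<^bsub>Q\<^esub> ?c"
        unfolding \<psi>_def using fB[OF f] comm by (intro Q.lprod_pow) blast+
      ultimately have 1: "f k [^]\<^bsub>Q\<^esub> ?c \<in> {\<one>\<^bsub>Q\<^esub>}" using f1 by simp
      have 2: "f k [^]\<^bsub>Q\<^esub> card (B k) \<in> {\<one>\<^bsub>Q\<^esub>}" using pw[OF k fB(1)[OF f k]] by simp
      have "coprime ?c (card (B k))" using coprime_pi_number[OF B(2)[OF k] B(3)[OF k]] by (simp add: coprime_commute)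
      then show ?thesis using Q.coprime_pow_mem[OF Q.triv_subgroup fB(2)[OF f k] 1 2] by simp
    qed
    then show "f = \<one>\<^bsub>?P\<^esub>" using f by (auto simp: F_def PiE_def extensional_def fun_eq_iff)
  qed
  moreover have "\<psi> ` carrier ?P = carrier Q"
  proof -
    let ?T = "\<psi> ` carrier ?P"
    have T: "subgroup ?T Q" by (rule \<psi>.img_is_subgroup)
    have Tc: "?T \<subseteq> carrier Q" using T subgroup.subset by blast
    have BT: "B k \<subseteq> ?T" if k: "k < n" for k
    proof
      fix b assume b: "b \<in> B k"
      let ?f = "\<lambda>j\<in>{..<n}. if j = k then b else \<one>\<^bsub>Q\<^esub>"
      have "?f \<in> carrier ?P" using b subgroup.one_closed[OF Bs(1)] by (auto simp: F_def)
      moreover have "\<psi> ?f = b" unfolding \<psi>_def using k b Bs[OF k] by (subst Q.lprod_single[of k]) auto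
      ultimately show "b \<in> ?T" by (metis (no_types) imageI)
    qed
    \<comment> \<open>The image contains every \<open>B k\<close>, so a prime dividing this index
      would divide \<open>index (carrier Q) (B k)\<close> for the class of that very prime.\<close>
    have "index (carrier Q) ?T = 1"
    proof (rule ccontr)
      assume "index (carrier Q) ?T \<noteq> 1"
      then obtain p where p: "Factorial_Ring.prime p" "p dvd index (carrier Q) ?T" using prime_factor_nat by blast
      then have "p dvd order Q" using Q.card_mult_index[OF Q.subgroup_self T Tc] by (simp add: order_def)
      moreover obtain i where i: "i \<in> I" "p \<in> \<sigma> i" using prime_partition_memE[OF part p(1)] .
      ultimately have "i \<in> W" unfolding W_def by blast
      then obtain k where k: "k < n" "i = h k" using h unfolding bij_betw_def by blast
      have "p dvd index (carrier Q) (B k)"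
        using p(2) Q.index_trans[OF Q.subgroup_self T Bs(1)[OF k(1)] BT[OF k(1)] Tc] by simp
      then show False using B(3)[OF k(1)] p(1) i k by (auto simp: pi_number_def)
    qed
    then show ?thesis using Q.index_one_iff[OF Q.subgroup_self T Tc] by simp
  qed
  ultimately have "\<psi> \<in> iso ?P Q" using hom by (simp add: iso_def bij_betw_def)
  then have "?P \<cong> Q" unfolding is_iso_def by blast
  then have "Q \<cong> ?P" using group.iso_sym[OF P] by blast
  then show ?thesis unfolding sigma_nilpotent_def using Fsp by blast
qed

context finite_group
begin

lemma normal_halls_FactGroup_iff:
  assumes N: "N \<lhd> G"
  shows "finite_group.normal_halls (G Mod N) I \<sigma> {\<one>\<^bsub>G Mod N\<^esub>} \<longleftrightarrow> normal_halls I \<sigma> N"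
proof -
  interpret N: normal N G by (rule N)
  interpret Q: finite_group "G Mod N" by (rule FactGroup_finite_group[OF N])
  have cQ: "card (carrier (G Mod N)) = index (carrier G) N"
    using card_rcosets[OF N.subgroup_axioms] by (simp add: FactGroup_def)
  have Npos: "card N > 0" using N.subgroup_axioms by simp
  have NN: "normalises (carrier G) N" using N by (simp add: normal_iff)
  show ?thesis
  proof
    assume L: "Q.normal_halls I \<sigma> {\<one>\<^bsub>G Mod N\<^esub>}"
    show "normal_halls I \<sigma> N"
      unfolding normal_halls_def
    proof
      fix i assume "i \<in> I"
      then obtain B where B: "B \<lhd> G Mod N" "pi_number (\<sigma> i) (card B)" "pi_number (- \<sigma> i) (index (carrier (G Mod N)) B)"
        using L unfolding Q.normal_halls_def Q.index_one by blast
      have Bs: "subgroup B (G Mod N)" using B by (simp add: Q.normal_iff)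
      let ?A = "\<Union>B"
      have A: "?A \<lhd> G" by (rule N.factgroup_subgroup_union_normal[OF B(1)])
      have As: "subgroup ?A G" "?A \<subseteq> carrier G" using A subgroup.subset by (auto simp: normal_iff)
      have NA: "N \<subseteq> ?A" using subgroup.one_closed[OF Bs] by auto
      have i1: "index ?A N = card B" using card_Union_FactGroup[OF N Bs] Npos by (simp add: index_def)
      have "index (carrier (G Mod N)) B = index (carrier G) ?A"
        using index_trans[OF subgroup_self As(1) N.subgroup_axioms NA As(2)] i1 cQ Q.card_subgroup_pos[OF Bs]
        unfolding index_def[of "carrier (G Mod N)"] by simp
      then show "\<exists>A. A \<lhd> G \<and> N \<subseteq> A \<and> pi_number (\<sigma> i) (index A N) \<and> pi_number (- \<sigma> i) (index (carrier G) A)"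
        using A NA i1 B by metis
    qed
  next
    assume R: "normal_halls I \<sigma> N"
    show "Q.normal_halls I \<sigma> {\<one>\<^bsub>G Mod N\<^esub>}"
      unfolding Q.normal_halls_def
    proof
      fix i assume "i \<in> I"
      then obtain A where A: "A \<lhd> G" "N \<subseteq> A" "pi_number (\<sigma> i) (index A N)" "pi_number (- \<sigma> i) (index (carrier G) A)"
        using R unfolding normal_halls_def by blast
      have As: "subgroup A G" "A \<subseteq> carrier G" "normalises (carrier G) A" using A subgroup.subset by (auto simp: normal_iff)
      let ?B = "(\<lambda>x. N #> x) ` A"
      have Bs: "subgroup ?B (G Mod N)"
        using group_hom.subgroup_img_is_subgroup[of G "G Mod N" "\<lambda>x. N #> x" A] N.r_coset_hom_Mod As(1)
        by (simp add: group_hom_def group_hom_axioms_def is_group Q.is_group)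
      have Bn: "?B \<lhd> G Mod N"
        unfolding Q.normal_iff Q.normalises_def
      proof (intro conjI ballI Bs)
        fix x b assume xb: "x \<in> carrier (G Mod N)" "b \<in> ?B"
        obtain y where y: "y \<in> carrier G" "x = N #> y" using xb(1) by (auto simp: carrier_FactGroup)
        obtain a where a: "a \<in> A" "b = N #> a" using xb(2) by auto
        have "cj y a \<in> A" using As y a by (auto simp: normalises_def)
        then show "Q.cj x b \<in> ?B" using rcos_cj[OF N, of y a] y a As by auto
      qed
      have "?B = carrier (G\<lparr>carrier := A\<rparr> Mod N)" by (auto simp: carrier_FactGroup)
      then have i1: "card ?B = index A N"
        using order_FactGroup[OF As(1) N.subgroup_axioms A(2) normalises_mono[OF NN As(2)]] by (simp add: order_def)
      have "index (carrier (G Mod N)) ?B = index (carrier G) A"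
        using index_trans[OF subgroup_self As(1) N.subgroup_axioms A(2) As(2)] i1 cQ Q.card_subgroup_pos[OF Bs]
        unfolding index_def[of "carrier (G Mod N)"] by simp
      then show "\<exists>A. A \<lhd> G Mod N \<and> {\<one>\<^bsub>G Mod N\<^esub>} \<subseteq> A \<and> pi_number (\<sigma> i) (index A {\<one>\<^bsub>G Mod N\<^esub>}) \<and>
          pi_number (- \<sigma> i) (index (carrier (G Mod N)) A)"
        using Bn i1 A subgroup.one_closed[OF Bs] by (intro exI[of _ ?B]) (auto simp del: one_FactGroup)
    qed
  qed
qed

lemma sigma_nilpotent_FactGroup_iff:
  assumes part: "prime_partition I \<sigma>" and N: "N \<lhd> G"
  shows "sigma_nilpotent I \<sigma> (G Mod N) \<longleftrightarrow> normal_halls I \<sigma> N"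
proof -
  interpret Q: finite_group "G Mod N" by (rule FactGroup_finite_group[OF N])
  show ?thesis
    using Q.normal_halls_of_sigma_nilpotent[OF part] sigma_nilpotent_of_normal_halls[OF part Q.finite_group_axioms]
      normal_halls_FactGroup_iff[OF N] by blast
qed

section \<open>The residual as the least kernel of a \<sigma>-nilpotent quotient\<close>

lemma index_Int_dvd:
  assumes "subgroup A G" "subgroup N G" "N \<subseteq> A" "normalises A N" "subgroup B G"
  shows "index (A \<inter> B) (N \<inter> B) dvd index A N"
proof -
  have I: "subgroup (A \<inter> B) G" using subgroups_Inter_pair assms by blast
  have n: "normalises (A \<inter> B) N" using normalises_mono[OF assms(4)] by blast
  have H: "subgroup (N <#> (A \<inter> B)) G" "N \<subseteq> N <#> (A \<inter> B)" "N <#> (A \<inter> B) \<subseteq> A"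
    using set_mult_subgroup[OF assms(2) I n] subset_set_mult[OF assms(2) I] set_mult_least[OF assms(1,3), of "A \<inter> B"] by auto
  have "(A \<inter> B) \<inter> N = N \<inter> B" using assms(3) by blast
  then have "index (N <#> (A \<inter> B)) N = index (A \<inter> B) (N \<inter> B)" using index_set_mult(1)[OF assms(2) I n] by simp
  then show ?thesis using index_trans[OF assms(1) H(1) assms(2) H(2,3)] by simp
qed

text \<open>The witness is the intersection of the two Hall preimages. Through
  \<open>N \<inter> B\<close>, its index over \<open>N \<inter> M\<close> splits into divisors of
  \<open>index A N\<close> and \<open>index B M\<close>.\<close>

lemma normal_halls_Int:
  assumes N: "N \<lhd> G" "normal_halls I \<sigma> N" and M: "M \<lhd> G" "normal_halls I \<sigma> M"
  shows "normal_halls I \<sigma> (N \<inter> M)"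
  unfolding normal_halls_def
proof
  fix i assume i: "i \<in> I"
  obtain A where A: "A \<lhd> G" "N \<subseteq> A" "pi_number (\<sigma> i) (index A N)" "pi_number (- \<sigma> i) (index (carrier G) A)"
    using N i unfolding normal_halls_def by blast
  obtain B where B: "B \<lhd> G" "M \<subseteq> B" "pi_number (\<sigma> i) (index B M)" "pi_number (- \<sigma> i) (index (carrier G) B)"
    using M i unfolding normal_halls_def by blast
  have nA: "normalises Y N" "normalises Y M" "normalises Y B" if "Y \<subseteq> carrier G" for Y
    using N M B normalises_mono[OF _ that] by (auto simp: normal_iff)
  have s: "subgroup N G" "subgroup M G" "subgroup A G" "subgroup B G" using N M A B by (auto simp: normal_iff)
  have c: "A \<subseteq> carrier G" "B \<subseteq> carrier G" using s subgroup.subset by auto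
  have I: "subgroup (A \<inter> B) G" "subgroup (N \<inter> B) G" "subgroup (N \<inter> M) G" using subgroups_Inter_pair s by auto
  have 1: "pi_number (\<sigma> i) (index (A \<inter> B) (N \<inter> B))"
    using pi_number_dvd[OF A(3) index_Int_dvd[OF s(3,1) A(2) nA(1)[OF c(1)] s(4)]] .
  have 2: "pi_number (\<sigma> i) (index (N \<inter> B) (N \<inter> M))"
    using pi_number_dvd[OF B(3) index_Int_dvd[OF s(4,2) B(2) nA(2)[OF c(2)] s(1)]] by (simp add: Int_commute)
  have "index (A \<inter> B) (N \<inter> M) = index (A \<inter> B) (N \<inter> B) * index (N \<inter> B) (N \<inter> M)"
    using A B by (intro index_trans I) auto
  then have "pi_number (\<sigma> i) (index (A \<inter> B) (N \<inter> M))" using 1 2 by (simp add: pi_number_mult)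
  moreover have 3: "index A (A \<inter> B) dvd index (carrier G) B"
    using index_Int_dvd[OF subgroup_self s(4) c(2) nA(3)[OF order_refl] s(3)] by (metis Int_absorb1 Int_commute c(1))
  have "index (carrier G) (A \<inter> B) = index (carrier G) A * index A (A \<inter> B)"
    using c by (intro index_trans I s subgroup_self) auto
  then have "pi_number (- \<sigma> i) (index (carrier G) (A \<inter> B))" using A(4) pi_number_dvd[OF B(4) 3] by (simp add: pi_number_mult)
  ultimately show "\<exists>A. A \<lhd> G \<and> N \<inter> M \<subseteq> A \<and> pi_number (\<sigma> i) (index A (N \<inter> M)) \<and> pi_number (- \<sigma> i) (index (carrier G) A)"
    using normal_Int[OF A(1) B(1)] A(2) B(2) by blast
qed

text \<open>Closure under intersection puts a member of least order inside every other member, so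
  the intersection that defines the residual is itself one of the kernels.\<close>

lemma sigma_nilpotent_residual_least:
  assumes part: "prime_partition I \<sigma>"
  defines "D \<equiv> sigma_nilpotent_residual I \<sigma> G"
  shows "D \<lhd> G" "normal_halls I \<sigma> D" "\<lbrakk>N \<lhd> G; normal_halls I \<sigma> N\<rbrakk> \<Longrightarrow> D \<subseteq> N"
proof -
  let ?P = "\<lambda>N. N \<lhd> G \<and> normal_halls I \<sigma> N"
  have eq: "D = \<Inter>{N. ?P N}"
    unfolding D_def sigma_nilpotent_residual_def using sigma_nilpotent_FactGroup_iff[OF part] by (metis (no_types, lifting))
  have "?P (carrier G)"
    using normal_self subgroup_self unfolding normal_halls_def by (auto intro!: exI[of _ "carrier G"] simp: pi_number_def)
  then obtain N0 where N0: "?P N0" and least: "\<And>B. ?P B \<Longrightarrow> card N0 \<le> card B"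
    using ex_has_least_nat[of ?P "carrier G" card] by blast
  have sub: "N0 \<subseteq> N" if N: "?P N" for N
  proof -
    have "?P (N0 \<inter> N)" using normal_Int normal_halls_Int N0 N by blast
    then have "card N0 \<le> card (N0 \<inter> N)" by (rule least)
    then have "N0 \<inter> N = N0" using N0 by (intro card_seteq) (auto simp: normal_iff)
    then show ?thesis by blast
  qed
  then have "D = N0" using eq N0 by blast
  then show "D \<lhd> G" "normal_halls I \<sigma> D" "\<lbrakk>N \<lhd> G; normal_halls I \<sigma> N\<rbrakk> \<Longrightarrow> D \<subseteq> N" using N0 sub by auto
qed

section \<open>The main theorem\<close>

lemma centraliser_subgroup:
  assumes "S \<subseteq> carrier G"
  shows "subgroup {x \<in> carrier G. \<forall>s\<in>S. x \<otimes> s = s \<otimes> x} G" (is "subgroup ?C G")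
proof (rule subgroupI)
  have iff: "x \<otimes> s = s \<otimes> x \<longleftrightarrow> cj x s = s" if "x \<in> carrier G" "s \<in> S" for x s
    using cj_commute that assms by blast
  show "inv a \<in> ?C" if "a \<in> ?C" for a
  proof -
    have "cj (inv a) s = s" if "s \<in> S" for s
    proof -
      have "cj a s = s" "s \<in> carrier G" using \<open>a \<in> ?C\<close> iff that assms by auto
      then show ?thesis using \<open>a \<in> ?C\<close> cj_cancel(2)[of a s] by simp
    qed
    then show ?thesis using that iff by simp
  qed
  show "a \<otimes> b \<in> ?C" if "a \<in> ?C" "b \<in> ?C" for a b
  proof -
    have "cj (a \<otimes> b) s = s" if "s \<in> S" for s
    proof -
      have "cj a s = s" "cj b s = s" "s \<in> carrier G" using \<open>a \<in> ?C\<close> \<open>b \<in> ?C\<close> iff that assms by auto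
      then show ?thesis using \<open>a \<in> ?C\<close> \<open>b \<in> ?C\<close> cj_cj[of a b s] by simp
    qed
    then show ?thesis using that iff by simp
  qed
  have "\<one> \<in> ?C" using assms by auto
  then show "?C \<noteq> {}" by blast
qed auto

lemma centraliser_normal:
  assumes S: "S \<lhd> G"
  shows "{x \<in> carrier G. \<forall>s\<in>S. x \<otimes> s = s \<otimes> x} \<lhd> G" (is "?C \<lhd> G")
proof -
  have Sc: "S \<subseteq> carrier G" "normalises (carrier G) S" using S subgroup.subset by (auto simp: normal_iff)
  have "cj g x \<in> ?C" if g: "g \<in> carrier G" and x: "x \<in> ?C" for g x
  proof -
    have "cj g x \<otimes> s = s \<otimes> cj g x" if s: "s \<in> S" for s
    proof -
      have sc: "s \<in> carrier G" and s': "cj (inv g) s \<in> S" using s Sc g by (auto simp: normalises_def)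
      have "cj x (cj (inv g) s) = cj (inv g) s" using x s' cj_commute[of x "cj (inv g) s"] sc g by simp
      then have "cj g (cj x (cj (inv g) s)) = s" using g sc by simp
      moreover have "cj g (cj x (cj (inv g) s)) = cj (cj g x) s"
        using g sc x by (simp add: cj_def m_assoc inv_mult_group)
      ultimately show ?thesis using cj_commute[of "cj g x" s] g x sc by simp
    qed
    then show ?thesis using g x by simp
  qed
  then show ?thesis using centraliser_subgroup[OF Sc(1)] by (simp add: normal_iff normalises_def)
qed

text \<open>Commuting with a fixed element is membership in its centraliser, so
  \<open>prime_parts_mem\<close> can be applied to each side in turn.\<close>

lemma p_elements_commute:
  assumes A: "subgroup A G" and B: "subgroup B G" and ab: "a \<in> A" "b \<in> B"
    and pe: "\<And>p q x y. \<lbrakk>Factorial_Ring.prime p; Factorial_Ring.prime q; x \<in> A; y \<in> B; p_element p x; p_element q y\<rbrakk>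
      \<Longrightarrow> x \<otimes> y = y \<otimes> x"
  shows "a \<otimes> b = b \<otimes> a"
proof -
  have c: "a \<in> carrier G" "b \<in> carrier G" using A B ab subgroup.mem_carrier by metis+
  have 1: "x \<otimes> b = b \<otimes> x" if x: "x \<in> A" "p_element p x" "Factorial_Ring.prime p" for x p
  proof -
    have xc: "x \<in> carrier G" using x p_element_carrier by blast
    have "b \<in> {y \<in> carrier G. \<forall>s\<in>{x}. y \<otimes> s = s \<otimes> y}"
    proof (rule prime_parts_mem[OF centraliser_subgroup c(2)])
      fix q and k :: nat assume "Factorial_Ring.prime q" "p_element q (b [^] k)"
      then show "b [^] k \<in> {y \<in> carrier G. \<forall>s\<in>{x}. y \<otimes> s = s \<otimes> y}"
        using pe[OF x(3) _ x(1) _ x(2)] pow_in_subgroup[OF B ab(2)] c by simp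
    qed (use xc in auto)
    then show ?thesis by simp
  qed
  have "a \<in> {y \<in> carrier G. \<forall>s\<in>{b}. y \<otimes> s = s \<otimes> y}"
  proof (rule prime_parts_mem[OF centraliser_subgroup c(1)])
    fix p and k :: nat assume "Factorial_Ring.prime p" "p_element p (a [^] k)"
    then show "a [^] k \<in> {y \<in> carrier G. \<forall>s\<in>{b}. y \<otimes> s = s \<otimes> y}"
      using 1 pow_in_subgroup[OF A ab(1)] c by simp
  qed (use c in auto)
  then show ?thesis by simp
qed

text \<open>In the abelian group \<open>D\<close> a Hall \<open>\<pi>\<close>-subgroup exists by
  \<open>dedekind_section_hall\<close> and contains every \<open>\<pi>\<close>-subgroup, so it is
  the radical.\<close>

lemma abelian_hall_subgroup:
  assumes D: "subgroup D G" and comm: "\<And>x y. \<lbrakk>x \<in> D; y \<in> D\<rbrakk> \<Longrightarrow> x \<otimes> y = y \<otimes> x"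
  shows "subgroup (pi_radical \<pi> (G\<lparr>carrier := D\<rparr>)) G" "pi_radical \<pi> (G\<lparr>carrier := D\<rparr>) \<subseteq> D"
    "pi_number \<pi> (card (pi_radical \<pi> (G\<lparr>carrier := D\<rparr>)))"
    "pi_number (- \<pi>) (index D (pi_radical \<pi> (G\<lparr>carrier := D\<rparr>)))"
proof -
  have Dc: "D \<subseteq> carrier G" using D subgroup.subset by auto
  have nD: "normalises D Y" if "Y \<subseteq> D" for Y
    using that comm Dc cj_commute unfolding normalises_def by (metis subsetD)
  obtain A where A: "subgroup A G" "A \<subseteq> D" "pi_number \<pi> (index A {\<one>})" "pi_number (- \<pi>) (index D A)"
    using dedekind_section_hall[OF D triv_subgroup, of \<pi>] nD subgroup.one_closed[OF D] by (metis empty_subsetI insert_subset)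
  have normal: "N \<lhd> G\<lparr>carrier := D\<rparr> \<longleftrightarrow> subgroup N G \<and> N \<subseteq> D" for N
    using relative_normal_iff[OF D] nD by blast
  have "pi_radical \<pi> (G\<lparr>carrier := D\<rparr>) = A"
    unfolding pi_radical_def
  proof (rule Greatest_equality)
    have "pi_group \<pi> (G\<lparr>carrier := A\<rparr>)" using A pi_group_iff[OF A(1)] by simp
    then show "A \<lhd> G\<lparr>carrier := D\<rparr> \<and> pi_group \<pi> (G\<lparr>carrier := D, carrier := A\<rparr>)" using normal A by simp
    fix N assume N: "N \<lhd> G\<lparr>carrier := D\<rparr> \<and> pi_group \<pi> (G\<lparr>carrier := D, carrier := N\<rparr>)"
    then have Ns: "subgroup N G" "N \<subseteq> D" "pi_number \<pi> (card N)" using normal pi_group_iff by auto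
    show "N \<subseteq> A"
    proof
      fix x assume x: "x \<in> N"
      have xc: "x \<in> carrier G" using x Ns Dc by blast
      have "x [^] card N \<in> {\<one>}"
        using pow_index_mem[OF Ns(1) triv_subgroup _ normalises_one[OF subgroup.subset[OF Ns(1)]] x]
          subgroup.one_closed[OF Ns(1)] by simp
      then have 1: "x [^] card N \<in> A" using subgroup.one_closed[OF A(1)] by simp
      have 2: "x [^] index D A \<in> A" using pow_index_mem[OF D A(1,2) nD[OF A(2)]] x Ns by blast
      show "x \<in> A" using coprime_pow_mem[OF A(1) xc 1 2 coprime_pi_number[OF Ns(3) A(4)]] .
    qed
  qed
  then show "subgroup (pi_radical \<pi> (G\<lparr>carrier := D\<rparr>)) G" "pi_radical \<pi> (G\<lparr>carrier := D\<rparr>) \<subseteq> D"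
    "pi_number \<pi> (card (pi_radical \<pi> (G\<lparr>carrier := D\<rparr>)))"
    "pi_number (- \<pi>) (index D (pi_radical \<pi> (G\<lparr>carrier := D\<rparr>)))"
    using A by auto
qed

text \<open>The maps are conjugations by \<open>inv g\<close>, and \<open>inv g\<close> ranges over
  the whole group together with \<open>g\<close>. Normality of \<open>D\<close> makes each of them
  an automorphism of \<open>D\<close>, so the equivalence is about the invariance of
  subgroups.\<close>

lemma power_automorphisms_iff:
  assumes D: "D \<lhd> G"
  shows "(\<forall>g\<in>carrier G. power_automorphism (G\<lparr>carrier := D\<rparr>) (\<lambda>d. inv g \<otimes> d \<otimes> g)) \<longleftrightarrow>
    (\<forall>Y. subgroup Y G \<longrightarrow> Y \<subseteq> D \<longrightarrow> Y \<lhd> G)"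
proof -
  have Ds: "subgroup D G" "normalises (carrier G) D" "D \<subseteq> carrier G" using D subgroup.subset by (auto simp: normal_iff)
  have eq: "(\<lambda>d. inv g \<otimes> d \<otimes> g) = cj (inv g)" if "g \<in> carrier G" for g using that by (simp add: cj_def fun_eq_iff)
  have iso: "cj g \<in> iso (G\<lparr>carrier := D\<rparr>) (G\<lparr>carrier := D\<rparr>)" if g: "g \<in> carrier G" for g
  proof -
    have "cj g ` D = D" by (rule normalises_image[OF Ds(1) _ g]) (use Ds g in \<open>auto simp: normalises_def\<close>)
    moreover have "inj_on (cj g) D" using cj_inj[OF g] Ds(3) by (rule inj_on_subset)
    moreover have "cj g \<in> hom (G\<lparr>carrier := D\<rparr>) (G\<lparr>carrier := D\<rparr>)"
      using Ds g by (intro homI) (auto simp: normalises_def cj_mult subset_iff)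
    ultimately show ?thesis by (simp add: iso_def bij_betw_def)
  qed
  show ?thesis
  proof
    assume L: "\<forall>g\<in>carrier G. power_automorphism (G\<lparr>carrier := D\<rparr>) (\<lambda>d. inv g \<otimes> d \<otimes> g)"
    show "\<forall>Y. subgroup Y G \<longrightarrow> Y \<subseteq> D \<longrightarrow> Y \<lhd> G"
    proof (intro allI impI)
      fix Y assume Y: "subgroup Y G" "Y \<subseteq> D"
      have "cj g ` Y = Y" if g: "g \<in> carrier G" for g
      proof -
        have "power_automorphism (G\<lparr>carrier := D\<rparr>) (cj g)" using bspec[OF L, of "inv g"] g unfolding eq[OF inv_closed[OF g]] by simp
        then show ?thesis using Y relative_subgroup_iff[OF Ds(1)] unfolding power_automorphism_def by blast
      qed
      then show "Y \<lhd> G" using Y by (auto simp: normal_iff normalises_def)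
    qed
  next
    assume R: "\<forall>Y. subgroup Y G \<longrightarrow> Y \<subseteq> D \<longrightarrow> Y \<lhd> G"
    show "\<forall>g\<in>carrier G. power_automorphism (G\<lparr>carrier := D\<rparr>) (\<lambda>d. inv g \<otimes> d \<otimes> g)"
    proof
      fix g assume g: "g \<in> carrier G"
      have "cj (inv g) ` Y = Y" if "subgroup Y G" "Y \<subseteq> D" for Y
        by (rule normalises_image[OF that(1)]) (use R that g in \<open>auto simp: normal_iff normalises_def\<close>)
      then show "power_automorphism (G\<lparr>carrier := D\<rparr>) (\<lambda>d. inv g \<otimes> d \<otimes> g)"
        unfolding eq[OF g] power_automorphism_def using iso[of "inv g"] g relative_subgroup_iff[OF Ds(1)] by simp
    qed
  qed
qed

text \<open>\<open>M\<close> is a copy of \<open>G/D\<close>: a subgroup \<open>Y\<close> above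
  \<open>D\<close> corresponds to \<open>Y \<inter> M\<close>, and a subgroup \<open>H\<close> of
  \<open>M\<close> to \<open>D <#> H\<close>, from which the trivial intersection of
  \<open>D\<close> and \<open>M\<close> recovers \<open>H\<close>.\<close>

lemma dedekind_complement_iff:
  assumes sd: "is_semidirect_product G D M"
  shows "dedekind_group (G\<lparr>carrier := M\<rparr>) \<longleftrightarrow> (\<forall>Y. subgroup Y G \<longrightarrow> D \<subseteq> Y \<longrightarrow> Y \<lhd> G)"
proof -
  have D: "D \<lhd> G" and M: "subgroup M G" and DM: "carrier G = D <#> M" "D \<inter> M = {\<one>}"
    using sd unfolding is_semidirect_product_def by auto
  have Ds: "subgroup D G" "normalises (carrier G) D" "D \<subseteq> carrier G" using D subgroup.subset by (auto simp: normal_iff)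
  have Mc: "M \<subseteq> carrier G" using M subgroup.subset by auto
  have ded: "dedekind_group (G\<lparr>carrier := M\<rparr>) \<longleftrightarrow> (\<forall>H. subgroup H G \<longrightarrow> H \<subseteq> M \<longrightarrow> normalises M H)"
    using subgroup_imp_group[OF M]
    by (auto simp: dedekind_group_def relative_subgroup_iff[OF M] relative_normal_iff[OF M])
  show ?thesis
    unfolding ded
  proof
    assume L: "\<forall>H. subgroup H G \<longrightarrow> H \<subseteq> M \<longrightarrow> normalises M H"
    show "\<forall>Y. subgroup Y G \<longrightarrow> D \<subseteq> Y \<longrightarrow> Y \<lhd> G"
    proof (intro allI impI)
      fix Y assume Y: "subgroup Y G" "D \<subseteq> Y"
      have I: "subgroup (Y \<inter> M) G" by (rule subgroups_Inter_pair[OF Y(1) M])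
      have eY: "Y = D <#> (Y \<inter> M)"
      proof
        show "D <#> (Y \<inter> M) \<subseteq> Y" by (rule set_mult_least[OF Y]) blast
        show "Y \<subseteq> D <#> (Y \<inter> M)"
        proof
          fix y assume y: "y \<in> Y"
          then have "y \<in> D <#> M" using DM Y subgroup.mem_carrier by metis
          then obtain d m where dm: "d \<in> D" "m \<in> M" "y = d \<otimes> m" unfolding set_mult_def by blast
          have c: "d \<in> carrier G" "m \<in> carrier G" using dm Ds Mc by auto
          have "m = inv d \<otimes> y" using dm c by simp
          moreover have "inv d \<in> Y" using dm Y by (auto intro: subgroup.m_inv_closed)
          ultimately have "m \<in> Y" using y Y by (simp add: subgroup.m_closed)
          then show "y \<in> D <#> (Y \<inter> M)" unfolding set_mult_def using dm by blast
        qed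
      qed
      have "normalises M (Y \<inter> M)" using L I by blast
      then have "normalises M (D <#> (Y \<inter> M))"
        using normalises_mono[OF Ds(2) Mc] Mc Ds by (intro normalises_set_mult) auto
      then have "normalises M Y" using eY by simp
      moreover have "normalises D Y" using normalises_mono[OF normalises_self[OF Y(1)] Y(2)] .
      ultimately have "normalises (D <#> M) Y"
        by (intro normalises_set_multI[OF Y(1) Ds(1) M normalises_mono[OF Ds(2) Mc]])
      then show "Y \<lhd> G" using Y DM by (simp add: normal_iff)
    qed
  next
    assume R: "\<forall>Y. subgroup Y G \<longrightarrow> D \<subseteq> Y \<longrightarrow> Y \<lhd> G"
    show "\<forall>H. subgroup H G \<longrightarrow> H \<subseteq> M \<longrightarrow> normalises M H"
    proof (intro allI impI)
      fix H assume H: "subgroup H G" "H \<subseteq> M"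
      have Hc: "H \<subseteq> carrier G" using H Mc by blast
      have DH: "subgroup (D <#> H) G" "D \<subseteq> D <#> H" "H \<subseteq> D <#> H"
        using set_mult_subgroup[OF Ds(1) H(1) normalises_mono[OF Ds(2) Hc]] subset_set_mult[OF Ds(1) H(1)] by auto
      have n: "normalises (carrier G) (D <#> H)" using R DH by (simp add: normal_iff)
      show "normalises M H"
        unfolding normalises_def
      proof (intro ballI)
        fix m h assume mh: "m \<in> M" "h \<in> H"
        have "m \<in> carrier G" "h \<in> D <#> H" using mh Mc DH by auto
        then have "cj m h \<in> D <#> H" using n unfolding normalises_def by blast
        then obtain d k where dk: "d \<in> D" "k \<in> H" "cj m h = d \<otimes> k" unfolding set_mult_def by blast
        have c: "d \<in> carrier G" "k \<in> carrier G" using dk Ds Hc by auto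
        have cM: "cj m h \<in> M" "k \<in> M" using cj_in_subgroup[OF M mh(1)] mh H dk by blast+
        have "d = cj m h \<otimes> inv k" using dk c by (simp add: m_assoc)
        then have "d \<in> M" using cM M by (simp add: subgroup.m_closed subgroup.m_inv_closed)
        then have "d = \<one>" using dk DM by blast
        then show "cj m h \<in> H" using dk c by simp
      qed
    qed
  qed
qed

text \<open>Supplies the two abstract properties of the residual. A \<open>p\<close>-element
  \<open>y\<close> lies in the Hall preimage \<open>A\<close> of its class, so
  \<open>adjoin D y\<close> lies in the section \<open>A/D\<close> and is normal. Conversely, if all
  subgroups above \<open>N\<close> are normal, Hall subgroups modulo \<open>N\<close> exist and are
  normal, so \<open>D \<subseteq> N\<close>.\<close>

lemma T_sigma_residual_power_structure:
  assumes part: "prime_partition I \<sigma>" and sol: "sigma_soluble I \<sigma> G" and T: "T_sigma_group I \<sigma> G"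
  defines "D \<equiv> sigma_nilpotent_residual I \<sigma> G"
  shows "power_structure I \<sigma> D" "odd (card D)"
proof -
  have T12: "normality_transitive" "sections_dedekind I \<sigma>" using T T_sigma_group_iff[OF part] by auto
  note D = sigma_nilpotent_residual_least[OF part, folded D_def]
  have Ds: "subgroup D G" "normalises (carrier G) D" "D \<subseteq> carrier G" using D(1) subgroup.subset by (auto simp: normal_iff)
  have above: "Y \<lhd> G" if Y: "subgroup Y G" "D \<subseteq> Y" for Y
  proof -
    have "normalises (carrier G) Y"
    proof (rule normalises_of_p_elements[OF Y(1) order_refl])
      fix p y g assume y: "Factorial_Ring.prime p" "p_element p y" "y \<in> Y" and g: "g \<in> carrier G"
      have yc: "y \<in> carrier G" using y p_element_carrier by blast
      obtain i where i: "i \<in> I" "p \<in> \<sigma> i" using prime_partition_memE[OF part y(1)] .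
      obtain A where A: "A \<lhd> G" "D \<subseteq> A" "pi_number (\<sigma> i) (index A D)" "pi_number (- \<sigma> i) (index (carrier G) A)"
        using D(2) i unfolding normal_halls_def by blast
      have As: "subgroup A G" "normalises (carrier G) A" "A \<subseteq> carrier G" using A subgroup.subset by (auto simp: normal_iff)
      have "\<not> p dvd index (carrier G) A" using A(4) y i by (auto simp: pi_number_def)
      then have yA: "y \<in> A" using p_element_mem[OF subgroup_self As(1,3,2) yc y(2,1)] by blast
      have nD: "normalises {y} D" using Ds yc by (auto simp: normalises_def)
      have B: "subgroup (adjoin D y) G" "D \<subseteq> adjoin D y" "y \<in> adjoin D y" "adjoin D y \<subseteq> A"
        using adjoin_subgroup[OF Ds(1) yc nD] subset_adjoin[OF Ds(1) yc] adjoin_least[OF As(1) A(2) yA] by auto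
      have "adjoin D y \<lhd> G" using T12(2) i(1) D(1) A(1,3) B unfolding sections_dedekind_def by blast
      then have "cj g y \<in> adjoin D y" using g B by (auto simp: normal_iff normalises_def)
      then show "cj g y \<in> Y" using adjoin_least[OF Y y(3)] by blast
    qed
    then show ?thesis using Y by (simp add: normal_iff)
  qed
  have min: "D \<subseteq> N" if N: "N \<lhd> G" and up: "\<And>Y. \<lbrakk>subgroup Y G; N \<subseteq> Y\<rbrakk> \<Longrightarrow> Y \<lhd> G" for N
  proof (rule D(3)[OF N])
    have Ns: "subgroup N G" "N \<subseteq> carrier G" using N subgroup.subset by (auto simp: normal_iff)
    show "normal_halls I \<sigma> N"
      unfolding normal_halls_def
    proof
      fix i
      obtain A where "subgroup A G" "N \<subseteq> A" "pi_number (\<sigma> i) (index A N)" "pi_number (- \<sigma> i) (index (carrier G) A)"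
        using dedekind_section_hall[OF subgroup_self Ns, of "\<sigma> i"] up by (metis normal_iff)
      then show "\<exists>A. A \<lhd> G \<and> N \<subseteq> A \<and> pi_number (\<sigma> i) (index A N) \<and> pi_number (- \<sigma> i) (index (carrier G) A)"
        using up by blast
    qed
  qed
  show "power_structure I \<sigma> D" "odd (card D)"
    using residual_power_structure[OF T12 part sigma_soluble_below[OF part sol] D(1) above min] by blast+
qed

lemma T_sigma_of_power_structure:
  assumes part: "prime_partition I \<sigma>" shows "power_structure I \<sigma> D \<Longrightarrow> T_sigma_group I \<sigma> G"
  using power_structure_normality_transitive power_structure_sections_dedekind T_sigma_group_iff[OF part] by blast

lemma condition_R_of_power_structure:
  assumes "power_structure I \<sigma> D" "i \<in> I" shows "condition_R (\<sigma> i) G"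
  unfolding condition_R_iff
proof (intro allI impI)
  fix \<pi> H K assume *: "\<pi> \<subseteq> \<sigma> i" "hall_pi_subgroup \<pi> H G" "subgroup K G" "K \<subseteq> H"
  then have "subgroup H G" "pi_number (\<sigma> i) (card H)" using pi_number_mono by (auto simp: hall_pi_subgroup_iff)
  then show "normalises (normalizer G H) K" using power_structure_normalizer[OF assms] * by blast
qed

text \<open>\<open>S = A \<inter> M\<close> is a copy of the \<open>\<sigma> i\<close>-group
  \<open>A/D\<close>. It commutes with the radical of \<open>D\<close> by the power structure, so
  their product is direct; comparing orders inside \<open>A = D <#> S\<close> shows that this
  product is a Hall subgroup.\<close>

lemma hall_with_normal_complement:
  assumes halls: "normal_halls I \<sigma> D" and ps: "power_structure I \<sigma> D" and M: "subgroup M G" "carrier G = D <#> M" "D \<inter> M = {\<one>}" and i: "i \<in> I"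
  shows "\<exists>E. hall_pi_subgroup (\<sigma> i) E G \<and> has_normal_complement (pi_radical (\<sigma> i) (G\<lparr>carrier := D\<rparr>)) (G\<lparr>carrier := E\<rparr>)"
proof -
  have Ds: "subgroup D G" "normalises (carrier G) D" "D \<subseteq> carrier G"
    using D_normal[OF ps] subgroup.subset by (auto simp: normal_iff)
  let ?O = "pi_radical (\<sigma> i) (G\<lparr>carrier := D\<rparr>)"
  note O = abelian_hall_subgroup[OF Ds(1) D_comm[OF ps], of "\<sigma> i"]
  obtain A where A: "A \<lhd> G" "D \<subseteq> A" "pi_number (\<sigma> i) (index A D)" "pi_number (- \<sigma> i) (index (carrier G) A)"
    using halls i unfolding normal_halls_def by blast
  have As: "subgroup A G" "A \<subseteq> carrier G" using A subgroup.subset by (auto simp: normal_iff)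
  define S where "S = A \<inter> M"
  have S: "subgroup S G" "S \<subseteq> carrier G" unfolding S_def using subgroups_Inter_pair[OF As(1) M(1)] As by auto
  have DS1: "D \<inter> S = {\<one>}" using M(3) subgroup.one_closed[OF S(1)] unfolding S_def by blast
  have OS1: "?O \<inter> S = {\<one>}" using DS1 O(2) subgroup.one_closed[OF O(1)] subgroup.one_closed[OF S(1)] by blast
  have nSD: "normalises S D" by (rule normalises_mono[OF Ds(2) S(2)])
  have eA: "A = D <#> S"
  proof
    show "D <#> S \<subseteq> A" by (rule set_mult_least[OF As(1) A(2)]) (auto simp: S_def)
    show "A \<subseteq> D <#> S"
    proof
      fix a assume a: "a \<in> A"
      then have "a \<in> D <#> M" using M As by auto
      then obtain d m where dm: "d \<in> D" "m \<in> M" "a = d \<otimes> m" unfolding set_mult_def by blast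
      have c: "d \<in> carrier G" "m \<in> carrier G" using dm Ds subgroup.mem_carrier[OF M(1)] by auto
      have "m = inv d \<otimes> a" using dm c by simp
      moreover have "inv d \<in> A" using dm A As by (auto intro: subgroup.m_inv_closed)
      ultimately have "m \<in> A" using a As by (simp add: subgroup.m_closed)
      then show "a \<in> D <#> S" unfolding set_mult_def S_def using dm by blast
    qed
  qed
  have SD1: "S \<inter> D = {\<one>}" "S \<inter> ?O = {\<one>}" using DS1 OS1 by blast+
  have "index A D = card S" using index_set_mult(1)[OF Ds(1) S(1) nSD] eA SD1 by simp
  then have pS: "pi_number (\<sigma> i) (card S)" using A by simp
  have comm: "d \<otimes> s = s \<otimes> d" if d: "d \<in> ?O" and s: "s \<in> S" for d s
  proof (rule p_elements_commute[OF O(1) S(1) d s])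
    fix p q x y assume *: "Factorial_Ring.prime p" "Factorial_Ring.prime q" "x \<in> ?O" "y \<in> S" "p_element p x" "p_element q y"
    have c: "x \<in> carrier G" "y \<in> carrier G" using * p_element_carrier by auto
    consider "x = \<one>" | "y = \<one>" | "p dvd card ?O" "q dvd card S"
      using p_element_trivial[OF O(1) *(3,5,1)] p_element_trivial[OF S(1) *(4,6,2)] by blast
    then show "x \<otimes> y = y \<otimes> x"
    proof cases
      case 3
      then have "p \<in> \<sigma> i" "q \<in> \<sigma> i" using O(3) pS * by (auto simp: pi_number_def)
      then show ?thesis using D_commute[OF ps i] * O(2) by blast
    qed (use c in auto)
  qed
  have Oc: "?O \<subseteq> carrier G" using O(1) subgroup.subset by auto
  have nSO: "normalises S ?O" and nOS: "normalises ?O S"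
    using comm cj_commute Oc S(2) unfolding normalises_def by (metis subsetD)+
  let ?E = "?O <#> S"
  have E: "subgroup ?E G" "?O \<subseteq> ?E" "S \<subseteq> ?E" "?E \<subseteq> A"
    using set_mult_subgroup[OF O(1) S(1) nSO] subset_set_mult[OF O(1) S(1)] set_mult_least[OF As(1), of ?O S] O(2) A(2) S_def by auto
  have cE: "card ?E = card ?O * card S" using card_set_mult[OF O(1) S(1)] SD1 by simp
  have "card A = card D * card S" using card_set_mult[OF Ds(1) S(1)] SD1 eA by simp
  also have "card D = index D ?O * card ?O" by (rule card_mult_index[OF Ds(1) O(1,2)])
  finally have "card A = index D ?O * card ?E" using cE by simp
  then have "index A ?E = index D ?O" using card_subgroup_pos[OF E(1)] by (simp add: index_def[of A])
  moreover have "index (carrier G) ?E = index (carrier G) A * index A ?E"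
    by (rule index_trans[OF subgroup_self As(1) E(1) E(4) As(2)])
  ultimately have "pi_number (- \<sigma> i) (index (carrier G) ?E)" using A O by (simp add: pi_number_mult)
  moreover have "pi_number (\<sigma> i) (card ?E)" using O pS by (simp add: cE pi_number_mult)
  ultimately have hall: "hall_pi_subgroup (\<sigma> i) ?E G" using E by (simp add: hall_pi_subgroup_iff)
  have "normalises ?E S" by (rule normalises_set_multI[OF S(1) O(1) S(1) nSO nOS normalises_self[OF S(1)]])
  then have "S \<lhd> G\<lparr>carrier := ?E\<rparr>" using relative_normal_iff[OF E(1)] S E by blast
  moreover have "subgroup ?O (G\<lparr>carrier := ?E\<rparr>)" using relative_subgroup_iff[OF E(1)] O E by blast
  ultimately have "has_normal_complement ?O (G\<lparr>carrier := ?E\<rparr>)"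
    unfolding has_normal_complement_def using OS1 by (intro conjI exI[of _ S]) auto
  then show ?thesis using hall by blast
qed

text \<open>\<open>E\<close> is the product of the radical \<open>?O\<close> and \<open>S\<close>,
  both normal in \<open>E\<close> and with trivial intersection. So \<open>S\<close> centralises
  \<open>?O\<close>, and with \<open>?O\<close> abelian all of \<open>E\<close> does. The
  centraliser of \<open>?O\<close> is then a normal subgroup whose index is prime to
  \<open>\<sigma> i\<close>, so it contains every \<open>q\<close>-element with \<open>q\<close> in
  \<open>\<sigma> i\<close>.\<close>

lemma power_structure_of_complements:
  assumes part: "prime_partition I \<sigma>" and D: "D \<lhd> G" and comm: "\<And>x y. \<lbrakk>x \<in> D; y \<in> D\<rbrakk> \<Longrightarrow> x \<otimes> y = y \<otimes> x"
    and cop: "coprime (card D) (index (carrier G) D)"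
    and above: "\<And>Y. \<lbrakk>subgroup Y G; D \<subseteq> Y\<rbrakk> \<Longrightarrow> Y \<lhd> G" and below: "\<And>Y. \<lbrakk>subgroup Y G; Y \<subseteq> D\<rbrakk> \<Longrightarrow> Y \<lhd> G"
    and halls: "\<And>i. i \<in> I \<Longrightarrow> \<exists>E. hall_pi_subgroup (\<sigma> i) E G \<and>
      has_normal_complement (pi_radical (\<sigma> i) (G\<lparr>carrier := D\<rparr>)) (G\<lparr>carrier := E\<rparr>)"
  shows "power_structure I \<sigma> D"
proof -
  have Ds: "subgroup D G" "normalises (carrier G) D" "D \<subseteq> carrier G" using D subgroup.subset by (auto simp: normal_iff)
  have "d \<otimes> x = x \<otimes> d"
    if i: "i \<in> I" "p \<in> \<sigma> i" "q \<in> \<sigma> i" and d: "d \<in> D" "p_element p d" and x: "p_element q x" for i p q d x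
  proof -
    have pq: "Factorial_Ring.prime p" "Factorial_Ring.prime q" using prime_partition_prime[OF part i(1)] i by auto
    let ?O = "pi_radical (\<sigma> i) (G\<lparr>carrier := D\<rparr>)"
    note O = abelian_hall_subgroup[OF Ds(1) comm, of "\<sigma> i"]
    have On: "?O \<lhd> G" using below O by blast
    have Oc: "?O \<subseteq> carrier G" using O Ds by blast
    obtain E where E: "hall_pi_subgroup (\<sigma> i) E G" and nc: "has_normal_complement ?O (G\<lparr>carrier := E\<rparr>)"
      using halls[OF i(1)] by blast
    have Es: "subgroup E G" "pi_number (- \<sigma> i) (index (carrier G) E)" using E by (auto simp: hall_pi_subgroup_iff)
    obtain S where S0: "S \<lhd> G\<lparr>carrier := E\<rparr>" "E = ?O <#> S" "?O \<inter> S = {\<one>}" and OE: "subgroup ?O (G\<lparr>carrier := E\<rparr>)"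
      using nc unfolding has_normal_complement_def by auto
    have S: "subgroup S G" "S \<subseteq> E" "normalises E S" and OE': "?O \<subseteq> E"
      using S0(1) OE relative_normal_iff[OF Es(1)] relative_subgroup_iff[OF Es(1)] by auto
    let ?C = "{x \<in> carrier G. \<forall>s\<in>?O. x \<otimes> s = s \<otimes> x}"
    have C: "?C \<lhd> G" by (rule centraliser_normal[OF On])
    have Cs: "subgroup ?C G" "normalises (carrier G) ?C" "?C \<subseteq> carrier G" using C by (auto simp: normal_iff)
    have "?O \<subseteq> ?C" using comm O(2) Oc by blast
    moreover have "S \<subseteq> ?C"
    proof
      fix s assume s: "s \<in> S"
      have sc: "s \<in> carrier G" using s S subgroup.mem_carrier by metis
      have "s \<otimes> a = a \<otimes> s" if a: "a \<in> ?O" for a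
      proof -
        have ac: "a \<in> carrier G" using a Oc by blast
        let ?c = "cj a s \<otimes> inv s"
        have "cj a s \<in> S" using a s S OE' by (auto simp: normalises_def)
        then have "?c \<in> S" using s S by (simp add: subgroup.m_closed subgroup.m_inv_closed)
        moreover have "cj s (inv a) \<in> ?O" using On a sc O(1) by (simp add: normal_iff normalises_def subgroup.m_inv_closed)
        then have "a \<otimes> cj s (inv a) \<in> ?O" using a O(1) by (simp add: subgroup.m_closed)
        then have "?c \<in> ?O" using ac sc by (simp add: cj_def m_assoc)
        ultimately have "?c = \<one>" using S0 by blast
        then have "cj a s = s" using cj_eq_mult[OF ac sc] sc by simp
        then show ?thesis using cj_commute[OF ac sc] by simp
      qed
      then show "s \<in> ?C" using sc by blast
    qed
    ultimately have "?O <#> S \<subseteq> ?C" by (rule set_mult_least[OF Cs(1)])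
    then have EC: "E \<subseteq> ?C" using S0(2) by simp
    have "index (carrier G) E = index (carrier G) ?C * index ?C E"
      by (rule index_trans[OF subgroup_self Cs(1) Es(1) EC Cs(3)])
    then have "\<not> q dvd index (carrier G) ?C" using Es(2) pq i by (auto simp: pi_number_def)
    then have xC: "x \<in> ?C" using p_element_mem[OF subgroup_self Cs(1,3,2) _ x pq(2)] p_element_carrier[OF x] by blast
    have "\<not> p dvd index D ?O" using O(4) pq i by (auto simp: pi_number_def)
    then have "d \<in> ?O"
      using p_element_mem[OF Ds(1) O(1,2) _ d pq(1)] On normalises_mono[OF _ Ds(3)] by (auto simp: normal_iff)
    then show ?thesis using xC by simp
  qed
  then show ?thesis unfolding power_structure_def using D comm cop above below by blast
qed

end

theorem theorem1p10:
  fixes G :: "('a, 'b) monoid_scheme" and I :: "'i set" and \<sigma> :: "'i \<Rightarrow> nat set" and D :: "'a set"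
  assumes "prime_partition I \<sigma>"
    and "group G" and "finite (carrier G)"
    and "sigma_soluble I \<sigma> G"
    and "D = sigma_nilpotent_residual I \<sigma> G"
  shows "(T_sigma_group I \<sigma> G \<longleftrightarrow> (\<forall>i\<in>I. condition_R (\<sigma> i) G)) \<and>
    (T_sigma_group I \<sigma> G \<longleftrightarrow>
      (\<exists>M. is_semidirect_product G D M \<and>
         comm_group (G\<lparr>carrier := D\<rparr>) \<and> hall_subgroup D G \<and> odd (card D) \<and>
         dedekind_group (G\<lparr>carrier := M\<rparr>)) \<and>
      (\<forall>g\<in>carrier G. power_automorphism (G\<lparr>carrier := D\<rparr>)
         (\<lambda>d. inv\<^bsub>G\<^esub> g \<otimes>\<^bsub>G\<^esub> d \<otimes>\<^bsub>G\<^esub> g)) \<and>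
      (\<forall>i\<in>I. \<exists>E. hall_pi_subgroup (\<sigma> i) E G \<and>
         has_normal_complement (pi_radical (\<sigma> i) (G\<lparr>carrier := D\<rparr>)) (G\<lparr>carrier := E\<rparr>)))"
    (is "(?T \<longleftrightarrow> ?R) \<and> (?T \<longleftrightarrow> ?M \<and> ?P \<and> ?H)")
proof -
  note part = assms(1) and sol = assms(4) and D_eq = assms(5)
  interpret G: finite_group G using assms by (simp add: finite_group_def finite_group_axioms_def)
  have D: "D \<lhd> G" using G.sigma_nilpotent_residual_least(1)[OF part] D_eq by simp
  then have Ds: "subgroup D G" "D \<subseteq> carrier G" using subgroup.subset by (auto simp: G.normal_iff)
  have "?T \<Longrightarrow> ?R"
    using G.condition_R_of_power_structure[OF G.T_sigma_residual_power_structure(1)[OF part sol]] by blast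
  moreover have "?R \<Longrightarrow> ?T" using G.T_sigma_of_condition_R[OF part sol] by blast
  moreover have "?M \<and> ?P \<and> ?H" if T: ?T
  proof -
    have ps: "G.power_structure I \<sigma> D" and odd: "odd (card D)"
      using G.T_sigma_residual_power_structure[OF part sol T] D_eq by auto
    note comm = G.D_comm[OF ps] and cop = G.D_coprime[OF ps]
    obtain M where M: "subgroup M G" "D <#>\<^bsub>G\<^esub> M = carrier G" "D \<inter> M = {\<one>\<^bsub>G\<^esub>}"
      using G.abelian_normal_hall_complement[OF D comm cop] by blast
    have sd: "is_semidirect_product G D M" using D M by (simp add: is_semidirect_product_def)
    moreover have "comm_group (G\<lparr>carrier := D\<rparr>)"
      using G.subgroup_imp_group[OF Ds(1)] comm by (intro group.group_comm_groupI) auto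
    moreover have "hall_subgroup D G" using Ds cop G.card_rcosets by (simp add: hall_subgroup_def)
    moreover have "dedekind_group (G\<lparr>carrier := M\<rparr>)" using G.dedekind_complement_iff[OF sd] G.above_D[OF ps] by blast
    moreover have ?P using G.power_automorphisms_iff[OF D] G.below_D[OF ps] by blast
    moreover have ?H
      using G.hall_with_normal_complement[OF _ ps M(1) M(2)[symmetric] M(3)]
        G.sigma_nilpotent_residual_least(2)[OF part, folded D_eq] by blast
    ultimately show ?thesis using odd by blast
  qed
  moreover have ?T if 3: "?M \<and> ?P \<and> ?H"
  proof -
    obtain M where M: "is_semidirect_product G D M" "comm_group (G\<lparr>carrier := D\<rparr>)" "hall_subgroup D G"
      "dedekind_group (G\<lparr>carrier := M\<rparr>)"
      using 3 by blast
    interpret Dg: comm_group "G\<lparr>carrier := D\<rparr>" by (rule M(2))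
    have comm: "x \<otimes>\<^bsub>G\<^esub> y = y \<otimes>\<^bsub>G\<^esub> x" if "x \<in> D" "y \<in> D" for x y using Dg.m_comm that by simp
    have cop: "coprime (card D) (index (carrier G) D)" using M(3) G.card_rcosets[OF Ds(1)] by (simp add: hall_subgroup_def)
    have above: "Y \<lhd> G" if "subgroup Y G" "D \<subseteq> Y" for Y using G.dedekind_complement_iff[OF M(1)] M(4) that by blast
    have below: "Y \<lhd> G" if "subgroup Y G" "Y \<subseteq> D" for Y using G.power_automorphisms_iff[OF D] 3 that by blast
    have "G.power_structure I \<sigma> D"
      using G.power_structure_of_complements[OF part D comm cop above below] 3 by blast
    then show ?T by (rule G.T_sigma_of_power_structure[OF part])
  qed
  ultimately show ?thesis by blast
qed

end
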